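(* Let $\mathcal{C}$ be an abelian monoidal category in which every object has finite length. Assume that $\mathcal{C}$ has enough left flat objects and enough right flat objects. If every simple object of $\mathcal{C}$ is rigid, then $\mathcal{C}$ is rigid.
   Context: An abelian monoidal category here means an abelian category with a monoidal structure such that the monoidal product $\otimes$ is additive and right exact in each variable (no braiding is assumed). An object $X$ is left flat if the endofunctor $X\otimes(-)$ is exact, and right flat if $(-)\otimes X$ is exact. $\mathcal{C}$ has enough left (right) flat objects if every object of $\mathcal{C}$ is a quotient of a left (right) flat object. An object is rigid if it has both a left dual and a right dual; $\mathcal{C}$ is rigid if every object is rigid. *)

theory Defs
  imports "HOL-Algebra.Group"
begin

section \<open>Categories\<close>

record ('o, 'a) cat =
  Obj :: "'o set"
  Arr :: "'a set"
  Dom :: "'a \<Rightarrow> 'o"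
  Cod :: "'a \<Rightarrow> 'o"
  Id :: "'o \<Rightarrow> 'a"
  Comp :: "'a \<Rightarrow> 'a \<Rightarrow> 'a" (infixl "\<cdot>\<index>" 60)

definition Hom :: "('o, 'a, 'm) cat_scheme \<Rightarrow> 'o \<Rightarrow> 'o \<Rightarrow> 'a set" where
  "Hom C X Y = {f \<in> Arr C. Dom C f = X \<and> Cod C f = Y}"

text \<open>Composition is written in applicative order: \<open>g \<cdot> f\<close> is \<open>f\<close> followed by \<open>g\<close>.\<close>

locale category =
  fixes C :: "('o, 'a, 'm) cat_scheme" (structure)
  assumes Dom_closed: "f \<in> Arr C \<Longrightarrow> Dom C f \<in> Obj C"
    and Cod_closed: "f \<in> Arr C \<Longrightarrow> Cod C f \<in> Obj C"
    and Id_in_Hom: "X \<in> Obj C \<Longrightarrow> Id C X \<in> Hom C X X"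
    and Comp_in_Hom: "\<lbrakk>f \<in> Hom C X Y; g \<in> Hom C Y Z\<rbrakk> \<Longrightarrow> g \<cdot> f \<in> Hom C X Z"
    and Comp_Id_left: "f \<in> Hom C X Y \<Longrightarrow> Id C Y \<cdot> f = f"
    and Comp_Id_right: "f \<in> Hom C X Y \<Longrightarrow> f \<cdot> Id C X = f"
    and Comp_assoc:
      "\<lbrakk>f \<in> Hom C W X; g \<in> Hom C X Y; h \<in> Hom C Y Z\<rbrakk> \<Longrightarrow> (h \<cdot> g) \<cdot> f = h \<cdot> (g \<cdot> f)"

definition mono_arr :: "('o, 'a, 'm) cat_scheme \<Rightarrow> 'a \<Rightarrow> bool" where
  "mono_arr C f \<longleftrightarrow> f \<in> Arr C \<and>
     (\<forall>W \<in> Obj C. \<forall>g \<in> Hom C W (Dom C f). \<forall>h \<in> Hom C W (Dom C f).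
        f \<cdot>\<^bsub>C\<^esub> g = f \<cdot>\<^bsub>C\<^esub> h \<longrightarrow> g = h)"

definition epi_arr :: "('o, 'a, 'm) cat_scheme \<Rightarrow> 'a \<Rightarrow> bool" where
  "epi_arr C f \<longleftrightarrow> f \<in> Arr C \<and>
     (\<forall>W \<in> Obj C. \<forall>g \<in> Hom C (Cod C f) W. \<forall>h \<in> Hom C (Cod C f) W.
        g \<cdot>\<^bsub>C\<^esub> f = h \<cdot>\<^bsub>C\<^esub> f \<longrightarrow> g = h)"

definition inverse_arrs :: "('o, 'a, 'm) cat_scheme \<Rightarrow> 'a \<Rightarrow> 'a \<Rightarrow> bool" where
  "inverse_arrs C f g \<longleftrightarrow> f \<in> Arr C \<and> g \<in> Hom C (Cod C f) (Dom C f) \<and>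
     g \<cdot>\<^bsub>C\<^esub> f = Id C (Dom C f) \<and> f \<cdot>\<^bsub>C\<^esub> g = Id C (Cod C f)"

definition iso_arr :: "('o, 'a, 'm) cat_scheme \<Rightarrow> 'a \<Rightarrow> bool" where
  "iso_arr C f \<longleftrightarrow> (\<exists>g. inverse_arrs C f g)"

definition inv_arr :: "('o, 'a, 'm) cat_scheme \<Rightarrow> 'a \<Rightarrow> 'a" where
  "inv_arr C f = (THE g. inverse_arrs C f g)"

definition zero_object :: "('o, 'a, 'm) cat_scheme \<Rightarrow> 'o \<Rightarrow> bool" where
  "zero_object C Z \<longleftrightarrow> Z \<in> Obj C \<and>
     (\<forall>X \<in> Obj C. (\<exists>!f. f \<in> Hom C X Z) \<and> (\<exists>!f. f \<in> Hom C Z X))"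

definition simple_object :: "('o, 'a, 'm) cat_scheme \<Rightarrow> 'o \<Rightarrow> bool" where
  "simple_object C X \<longleftrightarrow> X \<in> Obj C \<and> \<not> zero_object C X \<and>
     (\<forall>m. mono_arr C m \<and> Cod C m = X \<longrightarrow> zero_object C (Dom C m) \<or> iso_arr C m)"


section \<open>Abelian categories\<close>

record ('o, 'a) preadd_cat = "('o, 'a) cat" +
  Add :: "'a \<Rightarrow> 'a \<Rightarrow> 'a" (infixl "\<boxplus>\<index>" 55)
  Zero :: "'o \<Rightarrow> 'o \<Rightarrow> 'a"

locale preadditive_category = category C
  for C :: "('o, 'a, 'm) preadd_cat_scheme" (structure) +
  assumes Hom_comm_group: "\<lbrakk>X \<in> Obj C; Y \<in> Obj C\<rbrakk> \<Longrightarrow>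
      comm_group \<lparr>carrier = Hom C X Y, monoid.mult = Add C, one = Zero C X Y\<rparr>"
    and Comp_Add_left: "\<lbrakk>f \<in> Hom C X Y; g \<in> Hom C Y Z; h \<in> Hom C Y Z\<rbrakk> \<Longrightarrow>
      (g \<boxplus> h) \<cdot> f = (g \<cdot> f) \<boxplus> (h \<cdot> f)"
    and Comp_Add_right: "\<lbrakk>f \<in> Hom C X Y; g \<in> Hom C X Y; h \<in> Hom C Y Z\<rbrakk> \<Longrightarrow>
      h \<cdot> (f \<boxplus> g) = (h \<cdot> f) \<boxplus> (h \<cdot> g)"

definition biproduct ::
    "('o, 'a, 'm) preadd_cat_scheme \<Rightarrow> 'o \<Rightarrow> 'o \<Rightarrow> 'o \<Rightarrow> 'a \<Rightarrow> 'a \<Rightarrow> 'a \<Rightarrow> 'a \<Rightarrow> bool" where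
  "biproduct C X Y P i j p q \<longleftrightarrow>
     i \<in> Hom C X P \<and> j \<in> Hom C Y P \<and> p \<in> Hom C P X \<and> q \<in> Hom C P Y \<and>
     p \<cdot>\<^bsub>C\<^esub> i = Id C X \<and> q \<cdot>\<^bsub>C\<^esub> j = Id C Y \<and>
     q \<cdot>\<^bsub>C\<^esub> i = Zero C X Y \<and> p \<cdot>\<^bsub>C\<^esub> j = Zero C Y X \<and>
     (i \<cdot>\<^bsub>C\<^esub> p) \<boxplus>\<^bsub>C\<^esub> (j \<cdot>\<^bsub>C\<^esub> q) = Id C P"

definition kernel_arr :: "('o, 'a, 'm) preadd_cat_scheme \<Rightarrow> 'a \<Rightarrow> 'a \<Rightarrow> bool" where
  "kernel_arr C k f \<longleftrightarrow> f \<in> Arr C \<and> k \<in> Arr C \<and> Cod C k = Dom C f \<and>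
     f \<cdot>\<^bsub>C\<^esub> k = Zero C (Dom C k) (Cod C f) \<and>
     (\<forall>W \<in> Obj C. \<forall>g \<in> Hom C W (Dom C f). f \<cdot>\<^bsub>C\<^esub> g = Zero C W (Cod C f) \<longrightarrow>
        (\<exists>!u. u \<in> Hom C W (Dom C k) \<and> k \<cdot>\<^bsub>C\<^esub> u = g))"

definition cokernel_arr :: "('o, 'a, 'm) preadd_cat_scheme \<Rightarrow> 'a \<Rightarrow> 'a \<Rightarrow> bool" where
  "cokernel_arr C q f \<longleftrightarrow> f \<in> Arr C \<and> q \<in> Arr C \<and> Dom C q = Cod C f \<and>
     q \<cdot>\<^bsub>C\<^esub> f = Zero C (Dom C f) (Cod C q) \<and>
     (\<forall>W \<in> Obj C. \<forall>g \<in> Hom C (Cod C f) W. g \<cdot>\<^bsub>C\<^esub> f = Zero C (Dom C f) W \<longrightarrow>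
        (\<exists>!u. u \<in> Hom C (Cod C q) W \<and> u \<cdot>\<^bsub>C\<^esub> q = g))"

locale abelian_category = preadditive_category C
  for C :: "('o, 'a, 'm) preadd_cat_scheme" (structure) +
  assumes ex_zero_object: "\<exists>Z. zero_object C Z"
    and ex_biproduct: "\<lbrakk>X \<in> Obj C; Y \<in> Obj C\<rbrakk> \<Longrightarrow> \<exists>P i j p q. biproduct C X Y P i j p q"
    and ex_kernel: "f \<in> Arr C \<Longrightarrow> \<exists>k. kernel_arr C k f"
    and ex_cokernel: "f \<in> Arr C \<Longrightarrow> \<exists>q. cokernel_arr C q f"
    and mono_normal: "mono_arr C f \<Longrightarrow> \<exists>g. kernel_arr C f g"
    and epi_normal: "epi_arr C f \<Longrightarrow> \<exists>g. cokernel_arr C f g"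

text \<open>The image is the kernel of the cokernel. Since kernels are determined only up to
  isomorphism, equality of the subobjects \<open>im f\<close> and \<open>ker g\<close> is expressed by a common
  representing monomorphism.\<close>

definition image_arr :: "('o, 'a, 'm) preadd_cat_scheme \<Rightarrow> 'a \<Rightarrow> 'a \<Rightarrow> bool" where
  "image_arr C i f \<longleftrightarrow> (\<exists>q. cokernel_arr C q f \<and> kernel_arr C i q)"

definition exact_at :: "('o, 'a, 'm) preadd_cat_scheme \<Rightarrow> 'a \<Rightarrow> 'a \<Rightarrow> bool" where
  "exact_at C f g \<longleftrightarrow> (\<exists>i. image_arr C i f \<and> kernel_arr C i g)"

definition short_exact :: "('o, 'a, 'm) preadd_cat_scheme \<Rightarrow> 'a \<Rightarrow> 'a \<Rightarrow> bool" where
  "short_exact C f g \<longleftrightarrow> mono_arr C f \<and> exact_at C f g \<and> epi_arr C g"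

text \<open>A composition series \<open>0 = Y 0 \<subseteq> Y 1 \<subseteq> \<dots> \<subseteq> Y n = X\<close> with inclusions \<open>m k\<close> and simple
  factors \<open>Cod C (q k)\<close>.\<close>

definition finite_length :: "('o, 'a, 'm) preadd_cat_scheme \<Rightarrow> 'o \<Rightarrow> bool" where
  "finite_length C X \<longleftrightarrow>
     (\<exists>(n::nat) (Y :: nat \<Rightarrow> 'o) (m :: nat \<Rightarrow> 'a) (q :: nat \<Rightarrow> 'a).
        zero_object C (Y 0) \<and> Y n = X \<and>
        (\<forall>k<n. m k \<in> Hom C (Y k) (Y (Suc k)) \<and> short_exact C (m k) (q k) \<and>
               simple_object C (Cod C (q k))))"

text \<open>The predicates below are applied only to endofunctors, each given by its action on
  arrows (the action on objects being determined through identities).\<close>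

definition additive_functor :: "('o, 'a, 'm) preadd_cat_scheme \<Rightarrow> ('a \<Rightarrow> 'a) \<Rightarrow> bool" where
  "additive_functor C F \<longleftrightarrow>
     (\<forall>X \<in> Obj C. \<forall>Y \<in> Obj C. \<forall>f \<in> Hom C X Y. \<forall>g \<in> Hom C X Y.
        F (f \<boxplus>\<^bsub>C\<^esub> g) = F f \<boxplus>\<^bsub>C\<^esub> F g)"

definition right_exact_functor :: "('o, 'a, 'm) preadd_cat_scheme \<Rightarrow> ('a \<Rightarrow> 'a) \<Rightarrow> bool" where
  "right_exact_functor C F \<longleftrightarrow>
     (\<forall>f g. short_exact C f g \<longrightarrow> exact_at C (F f) (F g) \<and> epi_arr C (F g))"

definition exact_functor :: "('o, 'a, 'm) preadd_cat_scheme \<Rightarrow> ('a \<Rightarrow> 'a) \<Rightarrow> bool" where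
  "exact_functor C F \<longleftrightarrow> (\<forall>f g. short_exact C f g \<longrightarrow> short_exact C (F f) (F g))"


section \<open>Monoidal structure\<close>

record ('o, 'a) preadd_mon_cat = "('o, 'a) preadd_cat" +
  TensO :: "'o \<Rightarrow> 'o \<Rightarrow> 'o" (infixl "\<otimes>\<^sub>o\<index>" 70)
  TensA :: "'a \<Rightarrow> 'a \<Rightarrow> 'a" (infixl "\<otimes>\<^sub>a\<index>" 70)
  Unit :: "'o"
  Assoc :: "'o \<Rightarrow> 'o \<Rightarrow> 'o \<Rightarrow> 'a"
  Lunit :: "'o \<Rightarrow> 'a"
  Runit :: "'o \<Rightarrow> 'a"

locale monoidal_category = category C
  for C :: "('o, 'a, 'm) preadd_mon_cat_scheme" (structure) +
  assumes TensO_closed: "\<lbrakk>X \<in> Obj C; Y \<in> Obj C\<rbrakk> \<Longrightarrow> X \<otimes>\<^sub>o Y \<in> Obj C"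
    and TensA_in_Hom: "\<lbrakk>f \<in> Hom C X Y; g \<in> Hom C X' Y'\<rbrakk> \<Longrightarrow>
      f \<otimes>\<^sub>a g \<in> Hom C (X \<otimes>\<^sub>o X') (Y \<otimes>\<^sub>o Y')"
    and TensA_Id: "\<lbrakk>X \<in> Obj C; Y \<in> Obj C\<rbrakk> \<Longrightarrow> Id C X \<otimes>\<^sub>a Id C Y = Id C (X \<otimes>\<^sub>o Y)"
    and TensA_Comp:
      "\<lbrakk>f \<in> Hom C X Y; g \<in> Hom C Y Z; f' \<in> Hom C X' Y'; g' \<in> Hom C Y' Z'\<rbrakk> \<Longrightarrow>
      (g \<cdot> f) \<otimes>\<^sub>a (g' \<cdot> f') = (g \<otimes>\<^sub>a g') \<cdot> (f \<otimes>\<^sub>a f')"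
    and Unit_closed: "Unit C \<in> Obj C"
    and Assoc_in_Hom: "\<lbrakk>X \<in> Obj C; Y \<in> Obj C; Z \<in> Obj C\<rbrakk> \<Longrightarrow>
      Assoc C X Y Z \<in> Hom C ((X \<otimes>\<^sub>o Y) \<otimes>\<^sub>o Z) (X \<otimes>\<^sub>o (Y \<otimes>\<^sub>o Z))"
    and Assoc_iso: "\<lbrakk>X \<in> Obj C; Y \<in> Obj C; Z \<in> Obj C\<rbrakk> \<Longrightarrow> iso_arr C (Assoc C X Y Z)"
    and Assoc_natural:
      "\<lbrakk>f \<in> Hom C X X'; g \<in> Hom C Y Y'; h \<in> Hom C Z Z'\<rbrakk> \<Longrightarrow>
      Assoc C X' Y' Z' \<cdot> ((f \<otimes>\<^sub>a g) \<otimes>\<^sub>a h) = (f \<otimes>\<^sub>a (g \<otimes>\<^sub>a h)) \<cdot> Assoc C X Y Z"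
    and Lunit_in_Hom: "X \<in> Obj C \<Longrightarrow> Lunit C X \<in> Hom C (Unit C \<otimes>\<^sub>o X) X"
    and Lunit_iso: "X \<in> Obj C \<Longrightarrow> iso_arr C (Lunit C X)"
    and Lunit_natural: "f \<in> Hom C X Y \<Longrightarrow>
      Lunit C Y \<cdot> (Id C (Unit C) \<otimes>\<^sub>a f) = f \<cdot> Lunit C X"
    and Runit_in_Hom: "X \<in> Obj C \<Longrightarrow> Runit C X \<in> Hom C (X \<otimes>\<^sub>o Unit C) X"
    and Runit_iso: "X \<in> Obj C \<Longrightarrow> iso_arr C (Runit C X)"
    and Runit_natural: "f \<in> Hom C X Y \<Longrightarrow>
      Runit C Y \<cdot> (f \<otimes>\<^sub>a Id C (Unit C)) = f \<cdot> Runit C X"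
    and pentagon: "\<lbrakk>W \<in> Obj C; X \<in> Obj C; Y \<in> Obj C; Z \<in> Obj C\<rbrakk> \<Longrightarrow>
      (Id C W \<otimes>\<^sub>a Assoc C X Y Z) \<cdot> Assoc C W (X \<otimes>\<^sub>o Y) Z \<cdot> (Assoc C W X Y \<otimes>\<^sub>a Id C Z)
      = Assoc C W X (Y \<otimes>\<^sub>o Z) \<cdot> Assoc C (W \<otimes>\<^sub>o X) Y Z"
    and triangle: "\<lbrakk>X \<in> Obj C; Y \<in> Obj C\<rbrakk> \<Longrightarrow>
      (Id C X \<otimes>\<^sub>a Lunit C Y) \<cdot> Assoc C X (Unit C) Y = Runit C X \<otimes>\<^sub>a Id C Y"

definition tens_left :: "('o, 'a, 'm) preadd_mon_cat_scheme \<Rightarrow> 'o \<Rightarrow> 'a \<Rightarrow> 'a" where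
  "tens_left C X f = Id C X \<otimes>\<^sub>a\<^bsub>C\<^esub> f"

definition tens_right :: "('o, 'a, 'm) preadd_mon_cat_scheme \<Rightarrow> 'o \<Rightarrow> 'a \<Rightarrow> 'a" where
  "tens_right C X f = f \<otimes>\<^sub>a\<^bsub>C\<^esub> Id C X"

locale abelian_monoidal_category = abelian_category C + monoidal_category C
  for C :: "('o, 'a, 'm) preadd_mon_cat_scheme" (structure) +
  assumes additive_tens_left: "X \<in> Obj C \<Longrightarrow> additive_functor C (tens_left C X)"
    and additive_tens_right: "X \<in> Obj C \<Longrightarrow> additive_functor C (tens_right C X)"
    and right_exact_tens_left: "X \<in> Obj C \<Longrightarrow> right_exact_functor C (tens_left C X)"
    and right_exact_tens_right: "X \<in> Obj C \<Longrightarrow> right_exact_functor C (tens_right C X)"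

definition left_flat :: "('o, 'a, 'm) preadd_mon_cat_scheme \<Rightarrow> 'o \<Rightarrow> bool" where
  "left_flat C X \<longleftrightarrow> X \<in> Obj C \<and> exact_functor C (tens_left C X)"

definition right_flat :: "('o, 'a, 'm) preadd_mon_cat_scheme \<Rightarrow> 'o \<Rightarrow> bool" where
  "right_flat C X \<longleftrightarrow> X \<in> Obj C \<and> exact_functor C (tens_right C X)"

definition enough_left_flat :: "('o, 'a, 'm) preadd_mon_cat_scheme \<Rightarrow> bool" where
  "enough_left_flat C \<longleftrightarrow>
     (\<forall>X \<in> Obj C. \<exists>P p. left_flat C P \<and> p \<in> Hom C P X \<and> epi_arr C p)"

definition enough_right_flat :: "('o, 'a, 'm) preadd_mon_cat_scheme \<Rightarrow> bool" where
  "enough_right_flat C \<longleftrightarrow>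
     (\<forall>X \<in> Obj C. \<exists>P p. right_flat C P \<and> p \<in> Hom C P X \<and> epi_arr C p)"

text \<open>\<open>D\<close> is a left dual of \<open>X\<close> with evaluation \<open>e : D \<otimes> X \<rightarrow> 1\<close> and coevaluation
  \<open>c : 1 \<rightarrow> X \<otimes> D\<close>. In the zigzag identities the unit constraints are moved to the
  outside, so that they read as equations of arrows \<open>1 \<otimes> X \<rightarrow> X\<close> and \<open>D \<otimes> 1 \<rightarrow> D\<close>.\<close>

definition duality :: "('o, 'a, 'm) preadd_mon_cat_scheme \<Rightarrow> 'o \<Rightarrow> 'o \<Rightarrow> 'a \<Rightarrow> 'a \<Rightarrow> bool" where
  "duality C D X e c \<longleftrightarrow> D \<in> Obj C \<and> X \<in> Obj C \<and>
     e \<in> Hom C (D \<otimes>\<^sub>o\<^bsub>C\<^esub> X) (Unit C) \<and> c \<in> Hom C (Unit C) (X \<otimes>\<^sub>o\<^bsub>C\<^esub> D) \<and>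
     Runit C X \<cdot>\<^bsub>C\<^esub> (Id C X \<otimes>\<^sub>a\<^bsub>C\<^esub> e) \<cdot>\<^bsub>C\<^esub> Assoc C X D X \<cdot>\<^bsub>C\<^esub> (c \<otimes>\<^sub>a\<^bsub>C\<^esub> Id C X)
       = Lunit C X \<and>
     Lunit C D \<cdot>\<^bsub>C\<^esub> (e \<otimes>\<^sub>a\<^bsub>C\<^esub> Id C D) \<cdot>\<^bsub>C\<^esub> inv_arr C (Assoc C D X D) \<cdot>\<^bsub>C\<^esub> (Id C D \<otimes>\<^sub>a\<^bsub>C\<^esub> c)
       = Runit C D"

definition has_left_dual :: "('o, 'a, 'm) preadd_mon_cat_scheme \<Rightarrow> 'o \<Rightarrow> bool" where
  "has_left_dual C X \<longleftrightarrow> (\<exists>D e c. duality C D X e c)"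

definition has_right_dual :: "('o, 'a, 'm) preadd_mon_cat_scheme \<Rightarrow> 'o \<Rightarrow> bool" where
  "has_right_dual C X \<longleftrightarrow> (\<exists>D e c. duality C X D e c)"

definition rigid_object :: "('o, 'a, 'm) preadd_mon_cat_scheme \<Rightarrow> 'o \<Rightarrow> bool" where
  "rigid_object C X \<longleftrightarrow> has_left_dual C X \<and> has_right_dual C X"

definition rigid_category :: "('o, 'a, 'm) preadd_mon_cat_scheme \<Rightarrow> bool" where
  "rigid_category C \<longleftrightarrow> (\<forall>X \<in> Obj C. rigid_object C X)"

end

theory Submission
  imports Defs
begin

text \<open>
  Left duals are stable under extensions. Let \<open>0 \<rightarrow> A \<rightarrow> X \<rightarrow> B \<rightarrow> 0\<close> be exact with maps \<open>i\<close>, \<open>p\<close>, and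
  let \<open>A'\<close>, \<open>B'\<close> be left duals of \<open>A\<close>, \<open>B\<close>. Since \<open>- \<otimes> B'\<close> is right adjoint to \<open>- \<otimes> B\<close>, the sequence
  stays exact after tensoring with \<open>B'\<close>; pulling it back along \<open>1 \<rightarrow> B \<otimes> B'\<close> gives an extension
  \<open>0 \<rightarrow> A \<otimes> B' \<rightarrow> E \<rightarrow> 1 \<rightarrow> 0\<close>. Tensoring with \<open>A'\<close> on the left and pushing out along
  \<open>A' \<otimes> A \<otimes> B' \<rightarrow> B'\<close> gives \<open>D\<close>, which is the left dual of \<open>X\<close>. Right exactness of the tensor product
  suffices to construct evaluation and coevaluation and to check the zigzag identities on generators.
  Reversing the tensor product yields right duals, and induction along a composition series does
  the rest. The calculations with \<open>D\<close> take place in a strictification of the category.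
\<close>

section \<open>Kernels and cokernels\<close>

text \<open>The obstacle is that \<open>p\<close> need not split and that tensoring with
  \<open>X\<close> is only known to be right exact. If \<open>p\<close> had a section
  \<open>\<phi>\<close>, the identity of \<open>X\<close> would be
  \<open>\<phi> p - (\<phi> p - 1)\<close>, one term passing through \<open>B\<close> and the other
  through \<open>A\<close>, and the dualities of \<open>B\<close> and \<open>A\<close> would combine
  into one for \<open>X\<close>. The object \<open>E\<close> supplies such a section universally:
  reading \<open>X \<otimes> B'\<close> as the maps from \<open>B\<close> to \<open>X\<close>, it
  consists of the pairs \<open>(\<phi>, \<lambda>)\<close> with \<open>p \<phi> = \<lambda>\<close>,
  and its projection \<open>r\<close> to the unit is epi. Over \<open>E\<close> the formulas of the
  split case make sense. The coevaluation descends along \<open>r\<close> because \<open>r\<close>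
  is a cokernel, and the zigzags are checked after composing with a whiskered \<open>r\<close>,
  which is still epi. The two universal constructions are treated differently: tensoring preserves
  cokernels but need not preserve pullbacks. So \<open>D\<close> is a colimit, which lets an
  evaluation out of \<open>D \<otimes> X\<close> be glued, while the universal property of
  \<open>E\<close> is applied only to \<open>E\<close> itself.\<close>

lemma HomD:
  assumes "f \<in> Hom C X Y"
  shows "f \<in> Arr C" "Dom C f = X" "Cod C f = Y"
  using assms by (auto simp: Hom_def)

lemma Arr_in_Hom: "f \<in> Arr C \<Longrightarrow> f \<in> Hom C (Dom C f) (Cod C f)"
  by (auto simp: Hom_def)

lemma (in category) Hom_Obj:
  assumes "f \<in> Hom C X Y"
  shows "X \<in> Obj C" "Y \<in> Obj C"
  using assms Dom_closed Cod_closed by (auto simp: Hom_def)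

lemma mono_arrI:
  assumes "f \<in> Hom C X Y"
    and "\<And>W g h. \<lbrakk>W \<in> Obj C; g \<in> Hom C W X; h \<in> Hom C W X; f \<cdot>\<^bsub>C\<^esub> g = f \<cdot>\<^bsub>C\<^esub> h\<rbrakk> \<Longrightarrow> g = h"
  shows "mono_arr C f"
  using assms by (auto simp: mono_arr_def Hom_def)

lemma epi_arrI:
  assumes "f \<in> Hom C X Y"
    and "\<And>W g h. \<lbrakk>W \<in> Obj C; g \<in> Hom C Y W; h \<in> Hom C Y W; g \<cdot>\<^bsub>C\<^esub> f = h \<cdot>\<^bsub>C\<^esub> f\<rbrakk> \<Longrightarrow> g = h"
  shows "epi_arr C f"
  using assms by (auto simp: epi_arr_def Hom_def)

lemma (in category) mono_arr_cancel:
  "\<lbrakk>mono_arr C f; f \<in> Hom C X Y; g \<in> Hom C W X; h \<in> Hom C W X; f \<cdot> g = f \<cdot> h\<rbrakk> \<Longrightarrow> g = h"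
  unfolding mono_arr_def by (metis HomD(2) Hom_Obj(1))

lemma (in category) epi_arr_cancel:
  "\<lbrakk>epi_arr C f; f \<in> Hom C X Y; g \<in> Hom C Y W; h \<in> Hom C Y W; g \<cdot> f = h \<cdot> f\<rbrakk> \<Longrightarrow> g = h"
  unfolding epi_arr_def by (metis HomD(3) Hom_Obj(2))

section \<open>Arithmetic in hom groups; criteria for monos, epis, kernels and cokernels\<close>

context preadditive_category
begin

lemma Zero_in_Hom:
  assumes "X \<in> Obj C" "Y \<in> Obj C"
  shows "Zero C X Y \<in> Hom C X Y"
proof -
  interpret G: comm_group "\<lparr>carrier = Hom C X Y, monoid.mult = Add C, one = Zero C X Y\<rparr>"
    using Hom_comm_group assms by blast
  show ?thesis
    using G.one_closed by simp
qed

lemma Add_in_Hom: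
  assumes "f \<in> Hom C X Y" "g \<in> Hom C X Y"
  shows "f \<boxplus> g \<in> Hom C X Y"
proof -
  interpret G: comm_group "\<lparr>carrier = Hom C X Y, monoid.mult = Add C, one = Zero C X Y\<rparr>"
    using Hom_comm_group Hom_Obj[OF assms(1)] by blast
  show ?thesis
    using assms G.m_closed by simp
qed

lemma Add_Zero:
  assumes "f \<in> Hom C X Y"
  shows "Zero C X Y \<boxplus> f = f" "f \<boxplus> Zero C X Y = f"
proof -
  interpret G: comm_group "\<lparr>carrier = Hom C X Y, monoid.mult = Add C, one = Zero C X Y\<rparr>"
    using Hom_comm_group Hom_Obj[OF assms] by blast
  show "Zero C X Y \<boxplus> f = f" "f \<boxplus> Zero C X Y = f"
    using assms G.l_one G.r_one by auto
qed

lemma Add_right_cancel: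
  assumes "f \<in> Hom C X Y" "g \<in> Hom C X Y" "h \<in> Hom C X Y" "f \<boxplus> h = g \<boxplus> h"
  shows "f = g"
proof -
  interpret G: comm_group "\<lparr>carrier = Hom C X Y, monoid.mult = Add C, one = Zero C X Y\<rparr>"
    using Hom_comm_group Hom_Obj[OF assms(1)] by blast
  show ?thesis
    using assms G.right_cancel by auto
qed

lemma Add_commute:
  assumes "f \<in> Hom C X Y" "g \<in> Hom C X Y"
  shows "f \<boxplus> g = g \<boxplus> f"
proof -
  interpret G: comm_group "\<lparr>carrier = Hom C X Y, monoid.mult = Add C, one = Zero C X Y\<rparr>"
    using Hom_comm_group Hom_Obj[OF assms(1)] by blast
  show ?thesis
    using assms G.m_comm by auto
qed

lemma Add_assoc:
  assumes "f \<in> Hom C X Y" "g \<in> Hom C X Y" "h \<in> Hom C X Y"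
  shows "f \<boxplus> g \<boxplus> h = f \<boxplus> (g \<boxplus> h)"
proof -
  interpret G: comm_group "\<lparr>carrier = Hom C X Y, monoid.mult = Add C, one = Zero C X Y\<rparr>"
    using Hom_comm_group Hom_Obj[OF assms(1)] by blast
  show ?thesis
    using assms G.m_assoc by auto
qed

text \<open>The hom groups come with an addition but no named negation. A difference is therefore an
  arrow whose sum with \<open>g\<close> is \<open>f\<close>, and later formulas with a minus sign
  are stated as equations between sums.\<close>

lemma Add_diff_exists:
  assumes "f \<in> Hom C X Y" "g \<in> Hom C X Y"
  obtains h where "h \<in> Hom C X Y" "h \<boxplus> g = f"
proof -
  let ?G = "\<lparr>carrier = Hom C X Y, monoid.mult = Add C, one = Zero C X Y\<rparr>"
  interpret G: comm_group ?G
    using Hom_comm_group Hom_Obj[OF assms(1)] by blast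
  have "f \<otimes>\<^bsub>?G\<^esub> inv\<^bsub>?G\<^esub> g \<otimes>\<^bsub>?G\<^esub> g = f"
    using assms G.m_assoc[of f "inv\<^bsub>?G\<^esub> g" g] G.inv_closed[of g] G.l_inv[of g] G.r_one[of f] by simp
  moreover have "f \<otimes>\<^bsub>?G\<^esub> inv\<^bsub>?G\<^esub> g \<in> Hom C X Y"
    using assms G.m_closed G.inv_closed by fastforce
  ultimately show ?thesis
    using that by auto
qed

text \<open>By additivity the composite with zero equals its own double, and cancellation in the
  group leaves zero.\<close>

lemma Comp_Zero_right:
  assumes "W \<in> Obj C" "f \<in> Hom C X Y"
  shows "f \<cdot> Zero C W X = Zero C W Y"
proof -
  have Z: "Zero C W X \<in> Hom C W X" "Zero C W Y \<in> Hom C W Y"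
    using assms Hom_Obj Zero_in_Hom by blast+
  then have "f \<cdot> Zero C W X \<boxplus> f \<cdot> Zero C W X = Zero C W Y \<boxplus> f \<cdot> Zero C W X"
    using Comp_Add_right[OF Z(1) Z(1) assms(2)] Add_Zero assms Comp_in_Hom by metis
  then show ?thesis
    using Add_right_cancel Z assms Comp_in_Hom by meson
qed

lemma Comp_Zero_left:
  assumes "W \<in> Obj C" "f \<in> Hom C X Y"
  shows "Zero C Y W \<cdot> f = Zero C X W"
proof -
  have Z: "Zero C Y W \<in> Hom C Y W" "Zero C X W \<in> Hom C X W"
    using assms Hom_Obj Zero_in_Hom by blast+
  then have "Zero C Y W \<cdot> f \<boxplus> Zero C Y W \<cdot> f = Zero C X W \<boxplus> Zero C Y W \<cdot> f"
    using Comp_Add_left[OF assms(2) Z(1) Z(1)] Add_Zero assms Comp_in_Hom by metis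
  then show ?thesis
    using Add_right_cancel Z assms Comp_in_Hom by meson
qed

text \<open>Two arrows with the same composite differ by an arrow that \<open>f\<close>
  kills.\<close>

lemma mono_arr_zeroI:
  assumes f: "f \<in> Hom C X Y"
    and "\<And>W g. \<lbrakk>g \<in> Hom C W X; f \<cdot> g = Zero C W Y\<rbrakk> \<Longrightarrow> g = Zero C W X"
  shows "mono_arr C f"
proof (rule mono_arrI[OF f])
  fix W g h assume gh: "W \<in> Obj C" "g \<in> Hom C W X" "h \<in> Hom C W X" "f \<cdot> g = f \<cdot> h"
  obtain a where a: "a \<in> Hom C W X" "a \<boxplus> h = g"
    using Add_diff_exists gh by metis
  have "f \<cdot> a \<boxplus> f \<cdot> h = Zero C W Y \<boxplus> f \<cdot> h"
    using a(2) gh(4) Comp_Add_right[OF a(1) gh(3) f] Add_Zero(1)[OF Comp_in_Hom[OF gh(3) f]] by simp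
  then have "f \<cdot> a = Zero C W Y"
    using Add_right_cancel a gh f Comp_in_Hom Zero_in_Hom Hom_Obj by meson
  then show "g = h"
    using assms(2)[OF a(1)] a gh Add_Zero by metis
qed

lemma epi_arr_zeroI:
  assumes f: "f \<in> Hom C X Y"
    and "\<And>W g. \<lbrakk>g \<in> Hom C Y W; g \<cdot> f = Zero C X W\<rbrakk> \<Longrightarrow> g = Zero C Y W"
  shows "epi_arr C f"
proof (rule epi_arrI[OF f])
  fix W g h assume gh: "W \<in> Obj C" "g \<in> Hom C Y W" "h \<in> Hom C Y W" "g \<cdot> f = h \<cdot> f"
  obtain a where a: "a \<in> Hom C Y W" "a \<boxplus> h = g"
    using Add_diff_exists gh by metis
  have "a \<cdot> f \<boxplus> h \<cdot> f = Zero C X W \<boxplus> h \<cdot> f"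
    using a(2) gh(4) Comp_Add_left[OF f a(1) gh(3)] Add_Zero(1)[OF Comp_in_Hom[OF f gh(3)]] by simp
  then have "a \<cdot> f = Zero C X W"
    using Add_right_cancel a gh f Comp_in_Hom Zero_in_Hom Hom_Obj by meson
  then show "g = h"
    using assms(2)[OF a(1)] a gh Add_Zero by metis
qed

text \<open>Monicity gives the uniqueness part of the universal property, which leaves only the
  existence of factorisations.\<close>

lemma kernel_arrI:
  assumes "f \<in> Hom C X Y" "k \<in> Hom C K X" "f \<cdot> k = Zero C K Y" "mono_arr C k"
    and "\<And>W g. \<lbrakk>g \<in> Hom C W X; f \<cdot> g = Zero C W Y\<rbrakk> \<Longrightarrow> \<exists>u \<in> Hom C W K. k \<cdot> u = g"
  shows "kernel_arr C k f"
proof -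
  have "\<exists>!u. u \<in> Hom C W K \<and> k \<cdot> u = g" if "g \<in> Hom C W X" "f \<cdot> g = Zero C W Y" for W g
    using assms(5)[OF that] mono_arr_cancel[OF assms(4,2)] by (auto intro!: ex_ex1I)
  then show ?thesis
    using assms(3) HomD[OF assms(1)] HomD[OF assms(2)] by (simp add: kernel_arr_def)
qed

lemma cokernel_arrI:
  assumes "f \<in> Hom C X Y" "q \<in> Hom C Y Q" "q \<cdot> f = Zero C X Q" "epi_arr C q"
    and "\<And>W g. \<lbrakk>g \<in> Hom C Y W; g \<cdot> f = Zero C X W\<rbrakk> \<Longrightarrow> \<exists>u \<in> Hom C Q W. u \<cdot> q = g"
  shows "cokernel_arr C q f"
proof -
  have "\<exists>!u. u \<in> Hom C Q W \<and> u \<cdot> q = g" if "g \<in> Hom C Y W" "g \<cdot> f = Zero C X W" for W g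
    using assms(5)[OF that] epi_arr_cancel[OF assms(4,2)] by (auto intro!: ex_ex1I)
  then show ?thesis
    using assms(3) HomD[OF assms(1)] HomD[OF assms(2)] by (simp add: cokernel_arr_def)
qed

lemma kernel_arr_factor:
  assumes "kernel_arr C k f" "k \<in> Hom C K X" "f \<in> Hom C X Y" "g \<in> Hom C W X" "f \<cdot> g = Zero C W Y"
  obtains u where "u \<in> Hom C W K" "k \<cdot> u = g"
  using assms Hom_Obj unfolding kernel_arr_def by (metis HomD)

lemma cokernel_arr_factor:
  assumes "cokernel_arr C q f" "q \<in> Hom C Y Q" "f \<in> Hom C X Y" "g \<in> Hom C Y W" "g \<cdot> f = Zero C X W"
  obtains u where "u \<in> Hom C Q W" "u \<cdot> q = g"
  using assms Hom_Obj unfolding cokernel_arr_def by (metis HomD)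

lemma kernel_arr_Zero:
  "\<lbrakk>kernel_arr C k f; k \<in> Hom C K X; f \<in> Hom C X Y\<rbrakk> \<Longrightarrow> f \<cdot> k = Zero C K Y"
  unfolding kernel_arr_def by (metis HomD)

lemma cokernel_arr_Zero:
  "\<lbrakk>cokernel_arr C q f; q \<in> Hom C Y Q; f \<in> Hom C X Y\<rbrakk> \<Longrightarrow> q \<cdot> f = Zero C X Q"
  unfolding cokernel_arr_def by (metis HomD)

lemma kernel_arr_mono:
  assumes "kernel_arr C k f"
  shows "mono_arr C k"
proof -
  have k: "k \<in> Hom C (Dom C k) (Dom C f)" and f: "f \<in> Hom C (Dom C f) (Cod C f)"
    using assms by (auto simp: kernel_arr_def Hom_def)
  show ?thesis
  proof (rule mono_arrI[OF k])
    fix W g h assume gh: "W \<in> Obj C" "g \<in> Hom C W (Dom C k)" "h \<in> Hom C W (Dom C k)" "k \<cdot> g = k \<cdot> h"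
    have "f \<cdot> (k \<cdot> g) = Zero C W (Cod C f)"
      using gh Comp_assoc[OF gh(2) k f] kernel_arr_Zero[OF assms k f]
        Comp_Zero_left[OF _ gh(2)] Hom_Obj[OF f] by metis
    moreover have "k \<cdot> g \<in> Hom C W (Dom C f)"
      using gh(2) k Comp_in_Hom by blast
    ultimately show "g = h"
      using assms gh unfolding kernel_arr_def by metis
  qed
qed

lemma cokernel_arr_epi:
  assumes "cokernel_arr C q f"
  shows "epi_arr C q"
proof -
  have q: "q \<in> Hom C (Cod C f) (Cod C q)" and f: "f \<in> Hom C (Dom C f) (Cod C f)"
    using assms by (auto simp: cokernel_arr_def Hom_def)
  show ?thesis
  proof (rule epi_arrI[OF q])
    fix W g h assume gh: "W \<in> Obj C" "g \<in> Hom C (Cod C q) W" "h \<in> Hom C (Cod C q) W" "g \<cdot> q = h \<cdot> q"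
    have "(g \<cdot> q) \<cdot> f = Zero C (Dom C f) W"
      using gh Comp_assoc[OF f q gh(2)] cokernel_arr_Zero[OF assms q f]
        Comp_Zero_right[OF _ gh(2)] Hom_Obj[OF f] by metis
    moreover have "g \<cdot> q \<in> Hom C (Cod C f) W"
      using gh(2) q Comp_in_Hom by blast
    ultimately show "g = h"
      using assms gh unfolding cokernel_arr_def by metis
  qed
qed

end

section \<open>Normality, exactness, right exact functors and pullbacks of epis\<close>

context abelian_category
begin

lemma kernel_exists:
  assumes "f \<in> Hom C X Y"
  obtains K k where "k \<in> Hom C K X" "kernel_arr C k f"
proof -
  obtain k where "kernel_arr C k f"
    using ex_kernel HomD(1)[OF assms] by metis
  moreover from this have "k \<in> Hom C (Dom C k) X"
    using HomD[OF assms] by (auto simp: kernel_arr_def Hom_def)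
  ultimately show ?thesis
    using that by blast
qed

lemma cokernel_exists:
  assumes "f \<in> Hom C X Y"
  obtains Q q where "q \<in> Hom C Y Q" "cokernel_arr C q f"
proof -
  obtain q where "cokernel_arr C q f"
    using ex_cokernel HomD(1)[OF assms] by metis
  moreover from this have "q \<in> Hom C Y (Cod C q)"
    using HomD[OF assms] by (auto simp: cokernel_arr_def Hom_def)
  ultimately show ?thesis
    using that by blast
qed

text \<open>Normality makes \<open>q\<close> the cokernel of some \<open>f\<close>. That
  \<open>f\<close> factors through \<open>k\<close>, so an arrow that kills \<open>k\<close> kills
  \<open>f\<close> and hence factors through \<open>q\<close>.\<close>

lemma epi_cokernel_of_kernel:
  assumes q: "epi_arr C q" "q \<in> Hom C X Y" and k: "k \<in> Hom C K X" "kernel_arr C k q"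
  shows "cokernel_arr C q k"
proof (rule cokernel_arrI[OF k(1) q(2) kernel_arr_Zero[OF k(2,1) q(2)] q(1)])
  fix W g assume g: "g \<in> Hom C X W" "g \<cdot> k = Zero C K W"
  obtain f where f: "cokernel_arr C q f"
    using epi_normal q by blast
  then have fH: "f \<in> Hom C (Dom C f) X"
    using HomD[OF q(2)] by (auto simp: cokernel_arr_def Hom_def)
  have "q \<cdot> f = Zero C (Dom C f) Y"
    using cokernel_arr_Zero[OF f q(2) fH] .
  then obtain u where u: "u \<in> Hom C (Dom C f) K" "k \<cdot> u = f"
    using kernel_arr_factor[OF k(2,1) q(2) fH] by metis
  have "g \<cdot> f = Zero C (Dom C f) W"
    using u g Comp_assoc[OF u(1) k(1) g(1)] Comp_Zero_left Hom_Obj by metis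
  then show "\<exists>u \<in> Hom C Y W. u \<cdot> q = g"
    using cokernel_arr_factor[OF f q(2) fH g(1)] by metis
qed

text \<open>The dual argument: \<open>m\<close> is the kernel of some \<open>f\<close>, and
  \<open>f\<close> factors through \<open>q\<close>.\<close>

lemma mono_kernel_of_cokernel:
  assumes m: "mono_arr C m" "m \<in> Hom C X Y" and q: "q \<in> Hom C Y Q" "cokernel_arr C q m"
  shows "kernel_arr C m q"
proof (rule kernel_arrI[OF q(1) m(2) cokernel_arr_Zero[OF q(2,1) m(2)] m(1)])
  fix W g assume g: "g \<in> Hom C W Y" "q \<cdot> g = Zero C W Q"
  obtain f where f: "kernel_arr C m f"
    using mono_normal m by blast
  then have fH: "f \<in> Hom C Y (Cod C f)"
    using HomD[OF m(2)] by (auto simp: kernel_arr_def Hom_def)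
  have "f \<cdot> m = Zero C X (Cod C f)"
    using kernel_arr_Zero[OF f m(2) fH] .
  then obtain u where u: "u \<in> Hom C Q (Cod C f)" "u \<cdot> q = f"
    using cokernel_arr_factor[OF q(2,1) m(2) fH] by metis
  have "f \<cdot> g = Zero C W (Cod C f)"
    using u g Comp_assoc[OF g(1) q(1) u(1)] Comp_Zero_right Hom_Obj by metis
  then show "\<exists>u \<in> Hom C W X. m \<cdot> u = g"
    using kernel_arr_factor[OF f m(2) fH g(1)] by metis
qed

text \<open>Exactness is defined through a common representative \<open>i\<close> of the image of
  \<open>m\<close> and the kernel of \<open>q\<close>. As a mono, \<open>m\<close> is itself a
  kernel of its cokernel \<open>c\<close>, so \<open>m\<close> and \<open>i\<close> represent the
  same subobject and \<open>m\<close> is a kernel of \<open>q\<close>.\<close>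

lemma short_exactD:
  assumes "short_exact C m q" "m \<in> Hom C X Y" "q \<in> Arr C"
  shows "q \<in> Hom C Y (Cod C q)" "kernel_arr C m q" "cokernel_arr C q m"
proof -
  obtain i c where ic: "cokernel_arr C c m" "kernel_arr C i c" "kernel_arr C i q"
    and mq: "mono_arr C m" "epi_arr C q"
    using assms by (auto simp: short_exact_def exact_at_def image_arr_def)
  have H: "c \<in> Hom C Y (Cod C c)" "i \<in> Hom C (Dom C i) Y"
    using ic HomD[OF assms(2)] by (auto simp: cokernel_arr_def kernel_arr_def Hom_def)
  show qH: "q \<in> Hom C Y (Cod C q)"
    using ic H(2) assms(3) by (auto simp: kernel_arr_def Hom_def)
  have mc: "kernel_arr C m c"
    using mono_kernel_of_cokernel[OF mq(1) assms(2) H(1) ic(1)] .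
  obtain z where z: "z \<in> Hom C X (Dom C i)" "i \<cdot> z = m"
    using kernel_arr_factor[OF ic(2) H(2,1) assms(2)] cokernel_arr_Zero[OF ic(1) H(1) assms(2)] by metis
  show k: "kernel_arr C m q"
  proof (rule kernel_arrI[OF qH assms(2) _ mq(1)])
    show "q \<cdot> m = Zero C X (Cod C q)"
      using z Comp_assoc[OF z(1) H(2) qH] kernel_arr_Zero[OF ic(3) H(2) qH] Comp_Zero_left Hom_Obj qH
      by metis
  next
    fix W g assume g: "g \<in> Hom C W Y" "q \<cdot> g = Zero C W (Cod C q)"
    obtain y where y: "y \<in> Hom C W (Dom C i)" "i \<cdot> y = g"
      using kernel_arr_factor[OF ic(3) H(2) qH g] by metis
    have "c \<cdot> g = Zero C W (Cod C c)"
      using y Comp_assoc[OF y(1) H(2) H(1)] kernel_arr_Zero[OF ic(2) H(2) H(1)] Comp_Zero_left Hom_Obj H(1)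
      by metis
    then show "\<exists>u \<in> Hom C W X. m \<cdot> u = g"
      using kernel_arr_factor[OF mc assms(2) H(1) g(1)] by metis
  qed
  show "cokernel_arr C q m"
    using epi_cokernel_of_kernel[OF mq(2) qH assms(2) k] .
qed

lemma short_exactI:
  assumes "m \<in> Hom C X Y" "q \<in> Hom C Y Z" "kernel_arr C m q" "epi_arr C q"
  shows "short_exact C m q"
  using assms epi_cokernel_of_kernel[OF assms(4,2,1,3)] kernel_arr_mono
  by (auto simp: short_exact_def exact_at_def image_arr_def)

text \<open>An arrow that kills \<open>f\<close> factors through the cokernel \<open>c\<close> of
  \<open>f\<close>, so it kills the kernel \<open>i\<close> of \<open>c\<close>; and the epi
  \<open>g\<close> is the cokernel of its kernel \<open>i\<close>. This is applied to images of
  short exact sequences under right exact functors, where the left map may have lost its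
  monicity.\<close>

lemma exact_at_epi_cokernel:
  assumes f: "f \<in> Hom C X Y" and g: "g \<in> Hom C Y Z" and ex: "exact_at C f g" and ep: "epi_arr C g"
  shows "cokernel_arr C g f"
proof -
  obtain i c where ic: "cokernel_arr C c f" "kernel_arr C i c" "kernel_arr C i g"
    using ex by (auto simp: exact_at_def image_arr_def)
  have H: "c \<in> Hom C Y (Cod C c)" "i \<in> Hom C (Dom C i) Y"
    using ic HomD[OF f] by (auto simp: cokernel_arr_def kernel_arr_def Hom_def)
  obtain z where z: "z \<in> Hom C X (Dom C i)" "i \<cdot> z = f"
    using kernel_arr_factor[OF ic(2) H(2,1) f] cokernel_arr_Zero[OF ic(1) H(1) f] by metis
  show ?thesis
  proof (rule cokernel_arrI[OF f g _ ep])
    show "g \<cdot> f = Zero C X Z"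
      using z Comp_assoc[OF z(1) H(2) g] kernel_arr_Zero[OF ic(3) H(2) g] Comp_Zero_left Hom_Obj g
      by metis
  next
    fix W h assume h: "h \<in> Hom C Y W" "h \<cdot> f = Zero C X W"
    obtain y where y: "y \<in> Hom C (Cod C c) W" "y \<cdot> c = h"
      using cokernel_arr_factor[OF ic(1) H(1) f h] by metis
    have "h \<cdot> i = Zero C (Dom C i) W"
      using y Comp_assoc[OF H(2) H(1) y(1)] kernel_arr_Zero[OF ic(2) H(2) H(1)] Comp_Zero_right Hom_Obj H(2)
      by metis
    then show "\<exists>u \<in> Hom C Z W. u \<cdot> g = h"
      using cokernel_arr_factor[OF epi_cokernel_of_kernel[OF ep g H(2) ic(3)] g H(2) h(1)] by metis
  qed
qed

text \<open>If \<open>h\<close> kills \<open>f'\<close>, then \<open>f\<close> factors through the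
  smaller subobject \<open>m \<cdot> k\<close>, where \<open>k\<close> is the kernel of
  \<open>h\<close>. That subobject is the kernel of some \<open>q'\<close>, which kills
  \<open>f\<close> and so factors through \<open>q\<close>. Hence \<open>q'\<close> kills
  \<open>m\<close>, the two subobjects agree, and \<open>h\<close> vanishes.\<close>

lemma epi_onto_image:
  assumes f: "f \<in> Hom C X Y" and q: "q \<in> Hom C Y Q" "cokernel_arr C q f"
    and m: "m \<in> Hom C I Y" "kernel_arr C m q" and f': "f' \<in> Hom C X I" "m \<cdot> f' = f"
  shows "epi_arr C f'"
proof (rule epi_arr_zeroI[OF f'(1)])
  fix W h assume h: "h \<in> Hom C I W" "h \<cdot> f' = Zero C X W"
  obtain K k where k: "k \<in> Hom C K I" "kernel_arr C k h"
    using kernel_exists[OF h(1)] by metis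
  obtain f'' where f'': "f'' \<in> Hom C X K" "k \<cdot> f'' = f'"
    using kernel_arr_factor[OF k(2,1) h(1) f'(1) h(2)] by metis
  have mk: "m \<cdot> k \<in> Hom C K Y"
    using k m Comp_in_Hom by blast
  have "mono_arr C (m \<cdot> k)"
  proof (rule mono_arrI[OF mk])
    fix V a b assume ab: "a \<in> Hom C V K" "b \<in> Hom C V K" "(m \<cdot> k) \<cdot> a = (m \<cdot> k) \<cdot> b"
    then have "m \<cdot> (k \<cdot> a) = m \<cdot> (k \<cdot> b)"
      using Comp_assoc k m by metis
    then have "k \<cdot> a = k \<cdot> b"
      using mono_arr_cancel[OF kernel_arr_mono[OF m(2)] m(1)] ab k Comp_in_Hom by meson
    then show "a = b"
      using mono_arr_cancel[OF kernel_arr_mono[OF k(2)] k(1)] ab by meson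
  qed
  then obtain q' where q': "kernel_arr C (m \<cdot> k) q'"
    using mono_normal by blast
  then have q'H: "q' \<in> Hom C Y (Cod C q')"
    using HomD[OF mk] by (auto simp: kernel_arr_def Hom_def)
  have "q' \<cdot> f = (q' \<cdot> (m \<cdot> k)) \<cdot> f''"
    using f''(2) f'(2) Comp_assoc[OF f''(1) k(1) m(1)] Comp_assoc[OF f''(1) mk q'H] by simp
  then have "q' \<cdot> f = Zero C X (Cod C q')"
    using kernel_arr_Zero[OF q' mk q'H] Comp_Zero_left f'' q'H Hom_Obj by metis
  then obtain w where w: "w \<in> Hom C Q (Cod C q')" "w \<cdot> q = q'"
    using cokernel_arr_factor[OF q(2,1) f q'H] by metis
  have "q' \<cdot> m = Zero C I (Cod C q')"
    using w Comp_assoc[OF m(1) q(1) w(1)] kernel_arr_Zero[OF m(2,1) q(1)] Comp_Zero_right m(1) Hom_Obj by metis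
  then obtain z where z: "z \<in> Hom C I K" "(m \<cdot> k) \<cdot> z = m"
    using kernel_arr_factor[OF q' mk q'H m(1)] by metis
  have I: "I \<in> Obj C"
    using m(1) Hom_Obj by blast
  have "m \<cdot> (k \<cdot> z) = m \<cdot> Id C I"
    using z Comp_assoc[OF z(1) k(1) m(1)] m Comp_Id_right by metis
  then have "k \<cdot> z = Id C I"
    using mono_arr_cancel[OF kernel_arr_mono[OF m(2)] m(1)] z(1) k(1) Comp_in_Hom Id_in_Hom I by meson
  then have "h = (h \<cdot> k) \<cdot> z"
    using Comp_assoc[OF z(1) k(1) h(1)] Comp_Id_right h by metis
  then show "h = Zero C I W"
    using kernel_arr_Zero[OF k(2,1) h(1)] Comp_Zero_left[OF _ z(1)] h Hom_Obj by metis
qed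

text \<open>Right exactness is defined on short exact sequences only. A general \<open>f\<close> is
  an epi \<open>f'\<close> onto its image followed by the inclusion \<open>m\<close>. The functor
  keeps \<open>f'\<close> epi and makes \<open>F q\<close> a cokernel of \<open>F m\<close>, and
  precomposing \<open>F m\<close> with an epi does not change its cokernel.\<close>

lemma right_exact_cokernel:
  assumes F_Hom: "\<And>X Y f. f \<in> Hom C X Y \<Longrightarrow> F f \<in> Hom C (FO X) (FO Y)"
    and F_Comp: "\<And>X Y Z f g. \<lbrakk>f \<in> Hom C X Y; g \<in> Hom C Y Z\<rbrakk> \<Longrightarrow> F (g \<cdot> f) = F g \<cdot> F f"
    and F: "right_exact_functor C F"
    and f: "f \<in> Hom C X Y" and q: "q \<in> Hom C Y Q" "cokernel_arr C q f"
  shows "cokernel_arr C (F q) (F f)"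
proof -
  have F_se: "cokernel_arr C (F b) (F a)"
    if "a \<in> Hom C U V" "b \<in> Hom C V W" "kernel_arr C a b" "epi_arr C b" for a b U V W
    using F short_exactI[OF that] exact_at_epi_cokernel[OF F_Hom F_Hom] that
    unfolding right_exact_functor_def by metis
  obtain I m where m: "m \<in> Hom C I Y" "kernel_arr C m q"
    using kernel_exists[OF q(1)] by metis
  obtain f' where f': "f' \<in> Hom C X I" "m \<cdot> f' = f"
    using kernel_arr_factor[OF m(2,1) q(1) f] cokernel_arr_Zero[OF q(2,1) f] by metis
  obtain K k where k: "k \<in> Hom C K X" "kernel_arr C k f'"
    using kernel_exists[OF f'(1)] by metis
  have ep: "epi_arr C (F f')"
    using cokernel_arr_epi[OF F_se[OF k(1) f'(1) k(2) epi_onto_image[OF f q m f']]] .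
  have c: "cokernel_arr C (F q) (F m)"
    using F_se[OF m(1) q(1) m(2) cokernel_arr_epi[OF q(2)]] .
  have Ff: "F f = F m \<cdot> F f'"
    using F_Comp[OF f'(1) m(1)] f' by metis
  show ?thesis
  proof (rule cokernel_arrI[OF F_Hom[OF f] F_Hom[OF q(1)] _ cokernel_arr_epi[OF c]])
    show "F q \<cdot> F f = Zero C (FO X) (FO Q)"
      unfolding Ff using cokernel_arr_Zero[OF c F_Hom[OF q(1)] F_Hom[OF m(1)]]
        Comp_assoc[OF F_Hom[OF f'(1)] F_Hom[OF m(1)] F_Hom[OF q(1)]]
        Comp_Zero_left[OF _ F_Hom[OF f'(1)]] Hom_Obj[OF F_Hom[OF q(1)]] by metis
  next
    fix W g assume g: "g \<in> Hom C (FO Y) W" "g \<cdot> F f = Zero C (FO X) W"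
    have Fm: "F m \<in> Hom C (FO I) (FO Y)"
      using F_Hom m by blast
    have "(g \<cdot> F m) \<cdot> F f' = Zero C (FO I) W \<cdot> F f'"
      using g(2) Comp_assoc[OF F_Hom[OF f'(1)] Fm g(1)] Comp_Zero_left[OF _ F_Hom[OF f'(1)]]
        Hom_Obj[OF g(1)] Ff by metis
    then have "g \<cdot> F m = Zero C (FO I) W"
      using epi_arr_cancel[OF ep F_Hom[OF f'(1)]] Comp_in_Hom[OF Fm g(1)] Zero_in_Hom
        Hom_Obj[OF Fm] Hom_Obj[OF g(1)] by meson
    then show "\<exists>u \<in> Hom C (FO Q) W. u \<cdot> F q = g"
      using cokernel_arr_factor[OF c F_Hom[OF q(1)] Fm g(1)] by metis
  qed
qed

text \<open>The pullback is the kernel of the difference \<open>q\<close> of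
  \<open>p \<cdot> x\<close> and \<open>c \<cdot> y\<close> on the biproduct of \<open>X\<close> and
  \<open>U\<close>. Since \<open>q\<close> restricts to \<open>p\<close> on \<open>X\<close>, it is
  epi and hence the cokernel of its kernel; this makes the projection to \<open>U\<close>
  epi.\<close>

lemma pullback_of_epi_exists:
  assumes p: "p \<in> Hom C X B" "epi_arr C p" and c: "c \<in> Hom C U B"
  obtains E s r where "s \<in> Hom C E X" "r \<in> Hom C E U" "p \<cdot> s = c \<cdot> r" "epi_arr C r"
    "\<And>W a b. \<lbrakk>a \<in> Hom C W X; b \<in> Hom C W U; p \<cdot> a = c \<cdot> b\<rbrakk>
       \<Longrightarrow> \<exists>h \<in> Hom C W E. s \<cdot> h = a \<and> r \<cdot> h = b"
    "\<And>W a b. \<lbrakk>a \<in> Hom C W E; b \<in> Hom C W E; s \<cdot> a = s \<cdot> b; r \<cdot> a = r \<cdot> b\<rbrakk> \<Longrightarrow> a = b"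
proof -
  obtain P i j x y where "biproduct C X U P i j x y"
    using ex_biproduct Hom_Obj p c by meson
  then have H: "i \<in> Hom C X P" "j \<in> Hom C U P" "x \<in> Hom C P X" "y \<in> Hom C P U"
    and eq: "x \<cdot> i = Id C X" "y \<cdot> j = Id C U" "y \<cdot> i = Zero C X U" "x \<cdot> j = Zero C U X"
      "(i \<cdot> x) \<boxplus> (j \<cdot> y) = Id C P"
    by (auto simp: biproduct_def)
  have O: "X \<in> Obj C" "U \<in> Obj C" "B \<in> Obj C" "P \<in> Obj C"
    using p c H Hom_Obj by blast+
  have px: "p \<cdot> x \<in> Hom C P B" and cy: "c \<cdot> y \<in> Hom C P B"
    using p c H Comp_in_Hom by blast+
  obtain q where q: "q \<in> Hom C P B" "q \<boxplus> c \<cdot> y = p \<cdot> x"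
    using Add_diff_exists[OF px cy] by metis
  have q0: "q \<cdot> h = Zero C W B \<longleftrightarrow> p \<cdot> (x \<cdot> h) = c \<cdot> (y \<cdot> h)" if h: "h \<in> Hom C W P" for W h
  proof -
    have eq: "q \<cdot> h \<boxplus> c \<cdot> (y \<cdot> h) = p \<cdot> (x \<cdot> h)"
      using Comp_Add_left[OF h q(1) cy] q(2) Comp_assoc[OF h H(3) p(1)] Comp_assoc[OF h H(4) c] by metis
    have H': "q \<cdot> h \<in> Hom C W B" "c \<cdot> (y \<cdot> h) \<in> Hom C W B" "Zero C W B \<in> Hom C W B"
      using h q c H Comp_in_Hom Zero_in_Hom Hom_Obj by meson+
    show ?thesis
      using eq Add_right_cancel[OF H'(1,3,2)] Add_Zero[OF H'(2)] by metis
  qed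
  have qi: "q \<cdot> i = p"
  proof -
    have "q \<cdot> i \<boxplus> c \<cdot> (y \<cdot> i) = p \<cdot> (x \<cdot> i)"
      using Comp_Add_left[OF H(1) q(1) cy] q(2) Comp_assoc[OF H(1) H(3) p(1)] Comp_assoc[OF H(1) H(4) c] by metis
    then have "q \<cdot> i \<boxplus> Zero C X B = p"
      using eq Comp_Id_right[OF p(1)] Comp_Zero_right[OF O(1) c] by metis
    then show ?thesis
      using Add_Zero[OF Comp_in_Hom[OF H(1) q(1)]] by metis
  qed
  have qe: "epi_arr C q"
  proof (rule epi_arrI[OF q(1)])
    fix W g h assume gh: "g \<in> Hom C B W" "h \<in> Hom C B W" "g \<cdot> q = h \<cdot> q"
    then have "g \<cdot> p = h \<cdot> p"
      using Comp_assoc[OF H(1) q(1)] qi by metis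
    then show "g = h"
      using epi_arr_cancel[OF p(2,1)] gh by blast
  qed
  obtain E m where m: "m \<in> Hom C E P" "kernel_arr C m q"
    using kernel_exists[OF q(1)] by metis
  have mq: "cokernel_arr C q m"
    using epi_cokernel_of_kernel[OF qe q(1) m] .
  have s: "x \<cdot> m \<in> Hom C E X" and r: "y \<cdot> m \<in> Hom C E U"
    using m H Comp_in_Hom by blast+
  show ?thesis
  proof (rule that[OF s r])
    show "p \<cdot> (x \<cdot> m) = c \<cdot> (y \<cdot> m)"
      using q0[OF m(1)] kernel_arr_Zero[OF m(2,1) q(1)] by metis
  next
    show "epi_arr C (y \<cdot> m)"
    proof (rule epi_arr_zeroI[OF r])
      fix W h assume h: "h \<in> Hom C U W" "h \<cdot> (y \<cdot> m) = Zero C E W"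
      have hy: "h \<cdot> y \<in> Hom C P W"
        using h H Comp_in_Hom by blast
      have "(h \<cdot> y) \<cdot> m = Zero C E W"
        using h Comp_assoc[OF m(1) H(4) h(1)] by metis
      \<comment> \<open>The arrow \<open>h \<cdot> y\<close> kills the kernel of \<open>q\<close>,
        so it has the form \<open>g \<cdot> q\<close>. Restricting to \<open>X\<close>, where
        \<open>y\<close> vanishes, gives \<open>g \<cdot> p = 0\<close>, and \<open>p\<close> is
        epi.\<close>
      then obtain g where g: "g \<in> Hom C B W" "g \<cdot> q = h \<cdot> y"
        using cokernel_arr_factor[OF mq q(1) m(1) hy] by metis
      have "g \<cdot> p = (h \<cdot> y) \<cdot> i"
        using g qi Comp_assoc[OF H(1) q(1) g(1)] by metis
      also have "\<dots> = Zero C B W \<cdot> p"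
        using Comp_assoc[OF H(1) H(4) h(1)] eq Comp_Zero_right[OF O(1) h(1)] Comp_Zero_left[OF _ p(1)]
          Hom_Obj h by metis
      finally have "g = Zero C B W"
        using epi_arr_cancel[OF p(2,1) g(1)] Zero_in_Hom O Hom_Obj h by meson
      then have "h \<cdot> y = Zero C P W"
        using g Comp_Zero_left q(1) Hom_Obj by metis
      then have "h \<cdot> Id C U = Zero C U W"
        using Comp_assoc[OF H(2) H(4) h(1)] eq Comp_Zero_left[OF _ H(2)] Hom_Obj h by metis
      then show "h = Zero C U W"
        using Comp_Id_right h by metis
    qed
  next
    fix W a b assume ab: "a \<in> Hom C W X" "b \<in> Hom C W U" "p \<cdot> a = c \<cdot> b"
    have W: "W \<in> Obj C"
      using ab Hom_Obj by blast
    have ia: "i \<cdot> a \<in> Hom C W P" and jb: "j \<cdot> b \<in> Hom C W P"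
      using ab H Comp_in_Hom by blast+
    define t where "t = i \<cdot> a \<boxplus> j \<cdot> b"
    have t: "t \<in> Hom C W P"
      unfolding t_def using ia jb Add_in_Hom by blast
    have "x \<cdot> t = x \<cdot> (i \<cdot> a) \<boxplus> x \<cdot> (j \<cdot> b)"
      unfolding t_def using Comp_Add_right[OF ia jb H(3)] .
    also have "x \<cdot> (i \<cdot> a) = a"
      using Comp_assoc[OF ab(1) H(1) H(3)] eq Comp_Id_left ab by metis
    also have "x \<cdot> (j \<cdot> b) = Zero C W X"
      using Comp_assoc[OF ab(2) H(2) H(3)] eq Comp_Zero_left O ab by metis
    finally have xt: "x \<cdot> t = a"
      using Add_Zero ab by metis
    have "y \<cdot> t = y \<cdot> (i \<cdot> a) \<boxplus> y \<cdot> (j \<cdot> b)"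
      unfolding t_def using Comp_Add_right[OF ia jb H(4)] .
    also have "y \<cdot> (i \<cdot> a) = Zero C W U"
      using Comp_assoc[OF ab(1) H(1) H(4)] eq Comp_Zero_left O ab by metis
    also have "y \<cdot> (j \<cdot> b) = b"
      using Comp_assoc[OF ab(2) H(2) H(4)] eq Comp_Id_left ab by metis
    finally have yt: "y \<cdot> t = b"
      using Add_Zero ab by metis
    obtain h where h: "h \<in> Hom C W E" "m \<cdot> h = t"
      using kernel_arr_factor[OF m(2,1) q(1) t] q0[OF t] xt yt ab by metis
    then show "\<exists>h \<in> Hom C W E. (x \<cdot> m) \<cdot> h = a \<and> (y \<cdot> m) \<cdot> h = b"
      using xt yt Comp_assoc[OF h(1) m(1)] H by metis
  next
    fix W a b
    assume ab: "a \<in> Hom C W E" "b \<in> Hom C W E" "(x \<cdot> m) \<cdot> a = (x \<cdot> m) \<cdot> b" "(y \<cdot> m) \<cdot> a = (y \<cdot> m) \<cdot> b"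
    have M: "m \<cdot> a \<in> Hom C W P" "m \<cdot> b \<in> Hom C W P"
      using ab m Comp_in_Hom by blast+
    have *: "x \<cdot> (m \<cdot> a) = x \<cdot> (m \<cdot> b)" "y \<cdot> (m \<cdot> a) = y \<cdot> (m \<cdot> b)"
      using ab Comp_assoc m(1) H(3,4) by metis+
    have "n = i \<cdot> (x \<cdot> n) \<boxplus> j \<cdot> (y \<cdot> n)" if n: "n \<in> Hom C W P" for n
      using Comp_Id_left[OF n] eq(5) Comp_Add_left[OF n Comp_in_Hom[OF H(3,1)] Comp_in_Hom[OF H(4,2)]]
        Comp_assoc[OF n H(3,1)] Comp_assoc[OF n H(4,2)] by metis
    then have "m \<cdot> a = m \<cdot> b"
      using M * by metis
    then show "a = b"
      using mono_arr_cancel[OF kernel_arr_mono[OF m(2)] m(1)] ab by blast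
  qed
qed

end

section \<open>Strict abelian monoidal categories\<close>

definition strict_duality ::
    "('o, 'a, 'm) preadd_mon_cat_scheme \<Rightarrow> 'o \<Rightarrow> 'o \<Rightarrow> 'a \<Rightarrow> 'a \<Rightarrow> bool" where
  "strict_duality C D X e c \<longleftrightarrow> D \<in> Obj C \<and> X \<in> Obj C \<and>
     e \<in> Hom C (D \<otimes>\<^sub>o\<^bsub>C\<^esub> X) (Unit C) \<and> c \<in> Hom C (Unit C) (X \<otimes>\<^sub>o\<^bsub>C\<^esub> D) \<and>
     (Id C X \<otimes>\<^sub>a\<^bsub>C\<^esub> e) \<cdot>\<^bsub>C\<^esub> (c \<otimes>\<^sub>a\<^bsub>C\<^esub> Id C X) = Id C X \<and>
     (e \<otimes>\<^sub>a\<^bsub>C\<^esub> Id C D) \<cdot>\<^bsub>C\<^esub> (Id C D \<otimes>\<^sub>a\<^bsub>C\<^esub> c) = Id C D"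

text \<open>Domains, codomains and the tensor product of objects obey their equations even on junk
  arguments. This leaves composability as the only side condition in calculations.\<close>

locale strict_abelian_monoidal = abelian_category C
  for C :: "('o, 'a, 'm) preadd_mon_cat_scheme" (structure) +
  assumes Dom_Comp [simp]: "Dom C (g \<cdot> f) = Dom C f"
    and Cod_Comp [simp]: "Cod C (g \<cdot> f) = Cod C g"
    and Dom_Id [simp]: "Dom C (Id C X) = X"
    and Cod_Id [simp]: "Cod C (Id C X) = X"
    and Dom_Add [simp]: "Dom C (f \<boxplus> g) = Dom C f"
    and Cod_Add [simp]: "Cod C (f \<boxplus> g) = Cod C f"
    and Dom_Zero [simp]: "Dom C (Zero C X Y) = X"
    and Cod_Zero [simp]: "Cod C (Zero C X Y) = Y"
    and Dom_TensA [simp]: "Dom C (f \<otimes>\<^sub>a g) = Dom C f \<otimes>\<^sub>o Dom C g"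
    and Cod_TensA [simp]: "Cod C (f \<otimes>\<^sub>a g) = Cod C f \<otimes>\<^sub>o Cod C g"
    and Unit_Obj [simp]: "Unit C \<in> Obj C"
    and TensO_Obj [simp]: "\<lbrakk>X \<in> Obj C; Y \<in> Obj C\<rbrakk> \<Longrightarrow> X \<otimes>\<^sub>o Y \<in> Obj C"
    and TensO_assoc [simp]: "X \<otimes>\<^sub>o Y \<otimes>\<^sub>o Z = X \<otimes>\<^sub>o (Y \<otimes>\<^sub>o Z)"
    and TensO_Unit_left [simp]: "Unit C \<otimes>\<^sub>o X = X"
    and TensO_Unit_right [simp]: "X \<otimes>\<^sub>o Unit C = X"
    and TensA_Arr [simp]: "\<lbrakk>f \<in> Arr C; g \<in> Arr C\<rbrakk> \<Longrightarrow> f \<otimes>\<^sub>a g \<in> Arr C"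
    and TensA_Id [simp]: "\<lbrakk>X \<in> Obj C; Y \<in> Obj C\<rbrakk> \<Longrightarrow> Id C X \<otimes>\<^sub>a Id C Y = Id C (X \<otimes>\<^sub>o Y)"
    and TensA_Comp: "\<lbrakk>f \<in> Arr C; g \<in> Arr C; f' \<in> Arr C; g' \<in> Arr C; Cod C f = Dom C g; Cod C f' = Dom C g'\<rbrakk>
      \<Longrightarrow> (g \<cdot> f) \<otimes>\<^sub>a (g' \<cdot> f') = (g \<otimes>\<^sub>a g') \<cdot> (f \<otimes>\<^sub>a f')"
    and TensA_assoc: "\<lbrakk>f \<in> Arr C; g \<in> Arr C; h \<in> Arr C\<rbrakk> \<Longrightarrow> f \<otimes>\<^sub>a g \<otimes>\<^sub>a h = f \<otimes>\<^sub>a (g \<otimes>\<^sub>a h)"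
    and TensA_Unit_left [simp]: "f \<in> Arr C \<Longrightarrow> Id C (Unit C) \<otimes>\<^sub>a f = f"
    and TensA_Unit_right [simp]: "f \<in> Arr C \<Longrightarrow> f \<otimes>\<^sub>a Id C (Unit C) = f"
    and TensA_Add_right: "\<lbrakk>W \<in> Obj C; f \<in> Hom C X Y; g \<in> Hom C X Y\<rbrakk> \<Longrightarrow>
      Id C W \<otimes>\<^sub>a (f \<boxplus> g) = (Id C W \<otimes>\<^sub>a f) \<boxplus> (Id C W \<otimes>\<^sub>a g)"
    and TensA_Add_left: "\<lbrakk>W \<in> Obj C; f \<in> Hom C X Y; g \<in> Hom C X Y\<rbrakk> \<Longrightarrow>
      (f \<boxplus> g) \<otimes>\<^sub>a Id C W = (f \<otimes>\<^sub>a Id C W) \<boxplus> (g \<otimes>\<^sub>a Id C W)"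
    and cokernel_TensA_left: "\<lbrakk>W \<in> Obj C; cokernel_arr C q f\<rbrakk> \<Longrightarrow>
      cokernel_arr C (Id C W \<otimes>\<^sub>a q) (Id C W \<otimes>\<^sub>a f)"
    and cokernel_TensA_right: "\<lbrakk>W \<in> Obj C; cokernel_arr C q f\<rbrakk> \<Longrightarrow>
      cokernel_arr C (q \<otimes>\<^sub>a Id C W) (f \<otimes>\<^sub>a Id C W)"
begin

text \<open>In a strict setting a composite of tensored arrows can be written as a chain of steps
  that each act on one segment of a tensor word. Such chains have a simple normal form: whiskers
  distribute over composites and sums, and nested whiskers collapse. Only \<open>interchange\<close>
  is then left to be applied by hand.\<close>

definition whisker :: "'o \<Rightarrow> 'a \<Rightarrow> 'o \<Rightarrow> 'a" ("_ \<triangleleft> _ \<triangleright> _" [72, 72, 72] 71) where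
  "W \<triangleleft> f \<triangleright> V = Id C W \<otimes>\<^sub>a f \<otimes>\<^sub>a Id C V"

lemma Id_Arr [simp]: "X \<in> Obj C \<Longrightarrow> Id C X \<in> Arr C"
  using Id_in_Hom by (simp add: Hom_def)

lemma Comp_Arr [simp]: "\<lbrakk>f \<in> Arr C; g \<in> Arr C; Cod C f = Dom C g\<rbrakk> \<Longrightarrow> g \<cdot> f \<in> Arr C"
  using Comp_in_Hom[of f "Dom C f" "Dom C g" g "Cod C g"] by (simp add: Hom_def)

lemma Add_Arr [simp]:
  "\<lbrakk>f \<in> Arr C; g \<in> Arr C; Dom C f = Dom C g; Cod C f = Cod C g\<rbrakk> \<Longrightarrow> f \<boxplus> g \<in> Arr C"
  using Add_in_Hom[of f "Dom C g" "Cod C g" g] by (simp add: Hom_def)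

lemma Zero_Arr [simp]: "\<lbrakk>X \<in> Obj C; Y \<in> Obj C\<rbrakk> \<Longrightarrow> Zero C X Y \<in> Arr C"
  using Zero_in_Hom by (simp add: Hom_def)

lemma Id_Comp [simp]: "\<lbrakk>f \<in> Arr C; Cod C f = X\<rbrakk> \<Longrightarrow> Id C X \<cdot> f = f"
  using Comp_Id_left[of f "Dom C f" X] by (simp add: Hom_def)

lemma Comp_Id [simp]: "\<lbrakk>f \<in> Arr C; Dom C f = X\<rbrakk> \<Longrightarrow> f \<cdot> Id C X = f"
  using Comp_Id_right[of f X "Cod C f"] by (simp add: Hom_def)

lemma Comp_Comp [simp]:
  "\<lbrakk>f \<in> Arr C; g \<in> Arr C; h \<in> Arr C; Cod C f = Dom C g; Cod C g = Dom C h\<rbrakk> \<Longrightarrow> h \<cdot> g \<cdot> f = h \<cdot> (g \<cdot> f)"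
  using Comp_assoc by (simp add: Hom_def)

text \<open>Composites are normalised to the right, which buries a redex \<open>h \<cdot> g\<close>
  inside a longer chain. Applied with \<open>THEN\<close>, this turns an equation for
  \<open>h \<cdot> g\<close> into one that rewrites at the head of such a chain.\<close>

lemma Comp_reassoc:
  "\<lbrakk>h \<cdot> g = k; f \<in> Arr C; g \<in> Arr C; h \<in> Arr C; Cod C f = Dom C g; Cod C g = Dom C h\<rbrakk> \<Longrightarrow> h \<cdot> (g \<cdot> f) = k \<cdot> f"
  using Comp_Comp[of f g h] by simp

lemma Add_Comp [simp]:
  "\<lbrakk>f \<in> Arr C; g \<in> Arr C; h \<in> Arr C; Cod C f = Dom C g; Dom C g = Dom C h; Cod C g = Cod C h\<rbrakk> \<Longrightarrow>
    (g \<boxplus> h) \<cdot> f = (g \<cdot> f) \<boxplus> (h \<cdot> f)"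
  using Comp_Add_left by (simp add: Hom_def)

lemma Comp_Add [simp]:
  "\<lbrakk>f \<in> Arr C; g \<in> Arr C; h \<in> Arr C; Dom C f = Dom C g; Cod C f = Cod C g; Cod C g = Dom C h\<rbrakk> \<Longrightarrow>
    h \<cdot> (f \<boxplus> g) = (h \<cdot> f) \<boxplus> (h \<cdot> g)"
  using Comp_Add_right by (simp add: Hom_def)

lemma Comp_Zero [simp]: "\<lbrakk>f \<in> Arr C; Dom C f = X; W \<in> Obj C\<rbrakk> \<Longrightarrow> f \<cdot> Zero C W X = Zero C W (Cod C f)"
  using Comp_Zero_right Arr_in_Hom by metis

lemma Zero_Comp [simp]: "\<lbrakk>f \<in> Arr C; Cod C f = X; W \<in> Obj C\<rbrakk> \<Longrightarrow> Zero C X W \<cdot> f = Zero C (Dom C f) W"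
  using Comp_Zero_left Arr_in_Hom by metis

lemma Add_Zero' [simp]:
  "\<lbrakk>f \<in> Arr C; Dom C f = X; Cod C f = Y\<rbrakk> \<Longrightarrow> Zero C X Y \<boxplus> f = f"
  "\<lbrakk>f \<in> Arr C; Dom C f = X; Cod C f = Y\<rbrakk> \<Longrightarrow> f \<boxplus> Zero C X Y = f"
  using Add_Zero by (auto simp: Hom_def)

lemma Add_cancel:
  assumes "f \<boxplus> h = g \<boxplus> h" "f \<in> Arr C" "g \<in> Arr C" "h \<in> Arr C"
    "Dom C f = Dom C g" "Cod C f = Cod C g" "Dom C h = Dom C g" "Cod C h = Cod C g"
  shows "f = g"
  using assms Add_right_cancel[of f "Dom C g" "Cod C g" g h] by (simp add: Hom_def)

lemma Dom_whisker [simp]: "Dom C (W \<triangleleft> f \<triangleright> V) = W \<otimes>\<^sub>o (Dom C f \<otimes>\<^sub>o V)"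
  and Cod_whisker [simp]: "Cod C (W \<triangleleft> f \<triangleright> V) = W \<otimes>\<^sub>o (Cod C f \<otimes>\<^sub>o V)"
  by (simp_all add: whisker_def)

lemma whisker_Arr [simp]: "\<lbrakk>W \<in> Obj C; f \<in> Arr C; V \<in> Obj C\<rbrakk> \<Longrightarrow> W \<triangleleft> f \<triangleright> V \<in> Arr C"
  by (simp add: whisker_def)

lemma whisker_Unit [simp]: "f \<in> Arr C \<Longrightarrow> Unit C \<triangleleft> f \<triangleright> Unit C = f"
  by (simp add: whisker_def)

lemma whisker_Id [simp]:
  "\<lbrakk>W \<in> Obj C; X \<in> Obj C; V \<in> Obj C\<rbrakk> \<Longrightarrow> W \<triangleleft> Id C X \<triangleright> V = Id C (W \<otimes>\<^sub>o (X \<otimes>\<^sub>o V))"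
  by (simp add: whisker_def)

lemma whisker_Comp [simp]:
  "\<lbrakk>W \<in> Obj C; V \<in> Obj C; f \<in> Arr C; g \<in> Arr C; Cod C f = Dom C g\<rbrakk> \<Longrightarrow>
    W \<triangleleft> (g \<cdot> f) \<triangleright> V = (W \<triangleleft> g \<triangleright> V) \<cdot> (W \<triangleleft> f \<triangleright> V)"
  using TensA_Comp[of "Id C W" "Id C W" f g]
    TensA_Comp[of "Id C W \<otimes>\<^sub>a f" "Id C W \<otimes>\<^sub>a g" "Id C V" "Id C V"]
  by (simp add: whisker_def)

lemma whisker_whisker [simp]:
  "\<lbrakk>W \<in> Obj C; V \<in> Obj C; W' \<in> Obj C; V' \<in> Obj C; f \<in> Arr C\<rbrakk> \<Longrightarrow>
    W \<triangleleft> (W' \<triangleleft> f \<triangleright> V') \<triangleright> V = (W \<otimes>\<^sub>o W') \<triangleleft> f \<triangleright> (V' \<otimes>\<^sub>o V)"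
  by (simp add: whisker_def TensA_assoc flip: TensA_Id)

lemma whisker_Add [simp]:
  assumes "W \<in> Obj C" "V \<in> Obj C" "f \<in> Arr C" "g \<in> Arr C" "Dom C f = Dom C g" "Cod C f = Cod C g"
  shows "W \<triangleleft> (f \<boxplus> g) \<triangleright> V = (W \<triangleleft> f \<triangleright> V) \<boxplus> (W \<triangleleft> g \<triangleright> V)"
  using assms TensA_Add_right[of W f "Dom C g" "Cod C g" g]
    TensA_Add_left[of V "Id C W \<otimes>\<^sub>a f" "W \<otimes>\<^sub>o Dom C g" "W \<otimes>\<^sub>o Cod C g" "Id C W \<otimes>\<^sub>a g"]
  by (simp add: whisker_def Hom_def)

lemma whisker_Zero [simp]:
  assumes "W \<in> Obj C" "V \<in> Obj C" "X \<in> Obj C" "Y \<in> Obj C"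
  shows "W \<triangleleft> Zero C X Y \<triangleright> V = Zero C (W \<otimes>\<^sub>o (X \<otimes>\<^sub>o V)) (W \<otimes>\<^sub>o (Y \<otimes>\<^sub>o V))"
proof (rule Add_cancel)
  show "(W \<triangleleft> Zero C X Y \<triangleright> V) \<boxplus> (W \<triangleleft> Zero C X Y \<triangleright> V)
    = Zero C (W \<otimes>\<^sub>o (X \<otimes>\<^sub>o V)) (W \<otimes>\<^sub>o (Y \<otimes>\<^sub>o V)) \<boxplus> (W \<triangleleft> Zero C X Y \<triangleright> V)"
    using assms whisker_Add[of W V "Zero C X Y" "Zero C X Y"] by (simp del: whisker_Add)
qed (use assms in simp_all)

lemma cokernel_whisker:
  assumes "W \<in> Obj C" "V \<in> Obj C" "cokernel_arr C q f"
  shows "cokernel_arr C (W \<triangleleft> q \<triangleright> V) (W \<triangleleft> f \<triangleright> V)"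
  unfolding whisker_def using assms cokernel_TensA_left cokernel_TensA_right by blast

text \<open>Every epi is a cokernel, and whiskering preserves cokernels. Thus an identity between
  arrows out of a tensor product may be checked after composing with a whiskered epi.\<close>

lemma epi_whisker:
  assumes "W \<in> Obj C" "V \<in> Obj C" "epi_arr C q"
  shows "epi_arr C (W \<triangleleft> q \<triangleright> V)"
  using epi_normal cokernel_whisker cokernel_arr_epi assms by meson

text \<open>Both sides are \<open>f\<close> and \<open>g\<close> tensored with identities on
  \<open>U\<close>, \<open>V\<close> and \<open>W\<close> around and between them. The right
  orientation depends on the chain at hand, so each use fixes its instance and direction.\<close>

lemma interchange:
  assumes "U \<in> Obj C" "V \<in> Obj C" "W \<in> Obj C" "f \<in> Arr C" "g \<in> Arr C"
  shows "(U \<triangleleft> f \<triangleright> (V \<otimes>\<^sub>o (Cod C g \<otimes>\<^sub>o W))) \<cdot> ((U \<otimes>\<^sub>o (Dom C f \<otimes>\<^sub>o V)) \<triangleleft> g \<triangleright> W)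
    = ((U \<otimes>\<^sub>o (Cod C f \<otimes>\<^sub>o V)) \<triangleleft> g \<triangleright> W) \<cdot> (U \<triangleleft> f \<triangleright> (V \<otimes>\<^sub>o (Dom C g \<otimes>\<^sub>o W)))"
proof -
  have O: "Dom C f \<in> Obj C" "Cod C f \<in> Obj C" "Dom C g \<in> Obj C" "Cod C g \<in> Obj C"
    using assms Dom_closed Cod_closed by auto
  have L: "U \<triangleleft> f \<triangleright> (V \<otimes>\<^sub>o (Z \<otimes>\<^sub>o W)) = (Id C U \<otimes>\<^sub>a f \<otimes>\<^sub>a Id C V) \<otimes>\<^sub>a Id C (Z \<otimes>\<^sub>o W)"
    if "Z \<in> Obj C" for Z
    using that assms by (simp add: whisker_def TensA_assoc)
  have R: "(U \<otimes>\<^sub>o (Z \<otimes>\<^sub>o V)) \<triangleleft> g \<triangleright> W = Id C (U \<otimes>\<^sub>o (Z \<otimes>\<^sub>o V)) \<otimes>\<^sub>a (g \<otimes>\<^sub>a Id C W)"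
    if "Z \<in> Obj C" for Z
    using that assms by (simp add: whisker_def TensA_assoc)
  show ?thesis
    unfolding L[OF O(3)] L[OF O(4)] R[OF O(1)] R[OF O(2)]
    using assms O
      TensA_Comp[of "Id C (U \<otimes>\<^sub>o (Dom C f \<otimes>\<^sub>o V))" "Id C U \<otimes>\<^sub>a f \<otimes>\<^sub>a Id C V" "g \<otimes>\<^sub>a Id C W" "Id C (Cod C g \<otimes>\<^sub>o W)"]
      TensA_Comp[of "Id C U \<otimes>\<^sub>a f \<otimes>\<^sub>a Id C V" "Id C (U \<otimes>\<^sub>o (Cod C f \<otimes>\<^sub>o V))" "Id C (Dom C g \<otimes>\<^sub>o W)" "g \<otimes>\<^sub>a Id C W"]
    by simp
qed

lemma zigzag_whisker:
  assumes "strict_duality C D X e c" "W \<in> Obj C" "V \<in> Obj C"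
  shows "((W \<otimes>\<^sub>o X) \<triangleleft> e \<triangleright> V) \<cdot> (W \<triangleleft> c \<triangleright> (X \<otimes>\<^sub>o V)) = Id C (W \<otimes>\<^sub>o (X \<otimes>\<^sub>o V))"
    and "(W \<triangleleft> e \<triangleright> (D \<otimes>\<^sub>o V)) \<cdot> ((W \<otimes>\<^sub>o D) \<triangleleft> c \<triangleright> V) = Id C (W \<otimes>\<^sub>o (D \<otimes>\<^sub>o V))"
proof -
  have H: "D \<in> Obj C" "X \<in> Obj C" "e \<in> Arr C" "Dom C e = D \<otimes>\<^sub>o X" "Cod C e = Unit C" "c \<in> Arr C"
      "Dom C c = Unit C" "Cod C c = X \<otimes>\<^sub>o D"
    and eq: "(X \<triangleleft> e \<triangleright> Unit C) \<cdot> (Unit C \<triangleleft> c \<triangleright> X) = Id C X"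
      "(Unit C \<triangleleft> e \<triangleright> D) \<cdot> (D \<triangleleft> c \<triangleright> Unit C) = Id C D"
    using assms(1) by (auto simp: strict_duality_def whisker_def Hom_def)
  have "W \<triangleleft> ((X \<triangleleft> e \<triangleright> Unit C) \<cdot> (Unit C \<triangleleft> c \<triangleright> X)) \<triangleright> V = W \<triangleleft> Id C X \<triangleright> V"
    using eq by simp
  then show "((W \<otimes>\<^sub>o X) \<triangleleft> e \<triangleright> V) \<cdot> (W \<triangleleft> c \<triangleright> (X \<otimes>\<^sub>o V)) = Id C (W \<otimes>\<^sub>o (X \<otimes>\<^sub>o V))"
    using H assms(2,3) by simp
  have "W \<triangleleft> ((Unit C \<triangleleft> e \<triangleright> D) \<cdot> (D \<triangleleft> c \<triangleright> Unit C)) \<triangleright> V = W \<triangleleft> Id C D \<triangleright> V"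
    using eq by simp
  then show "(W \<triangleleft> e \<triangleright> (D \<otimes>\<^sub>o V)) \<cdot> ((W \<otimes>\<^sub>o D) \<triangleleft> c \<triangleright> V) = Id C (W \<otimes>\<^sub>o (D \<otimes>\<^sub>o V))"
    using H assms(2,3) by simp
qed

text \<open>The pushout is the cokernel \<open>q\<close> of the difference \<open>z\<close> of
  \<open>i \<cdot> f\<close> and \<open>j \<cdot> g\<close>. Whiskering preserves this cokernel and,
  by additivity, the biproduct, so maps can be glued on \<open>D \<otimes> W\<close> as well. This
  is what allows an evaluation on \<open>D \<otimes> X\<close> to be prescribed along
  \<open>u\<close> and \<open>v\<close>.\<close>

lemma whiskered_pushout_exists:
  assumes f: "f \<in> Hom C Z P" and g: "g \<in> Hom C Z Q"
  obtains D u v where "u \<in> Hom C P D" "v \<in> Hom C Q D" "u \<cdot> f = v \<cdot> g"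
    "\<And>W Y a b. \<lbrakk>W \<in> Obj C; a \<in> Hom C (P \<otimes>\<^sub>o W) Y; b \<in> Hom C (Q \<otimes>\<^sub>o W) Y;
        a \<cdot> (Unit C \<triangleleft> f \<triangleright> W) = b \<cdot> (Unit C \<triangleleft> g \<triangleright> W)\<rbrakk>
      \<Longrightarrow> \<exists>h \<in> Hom C (D \<otimes>\<^sub>o W) Y. h \<cdot> (Unit C \<triangleleft> u \<triangleright> W) = a \<and> h \<cdot> (Unit C \<triangleleft> v \<triangleright> W) = b"
    "\<And>Y a b. \<lbrakk>a \<in> Hom C D Y; b \<in> Hom C D Y; a \<cdot> u = b \<cdot> u; a \<cdot> v = b \<cdot> v\<rbrakk> \<Longrightarrow> a = b"
proof -
  have O: "Z \<in> Obj C" "P \<in> Obj C" "Q \<in> Obj C"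
    using f g Hom_Obj by blast+
  obtain S i j x y where "biproduct C P Q S i j x y"
    using ex_biproduct O by meson
  then have H: "i \<in> Hom C P S" "j \<in> Hom C Q S" "x \<in> Hom C S P" "y \<in> Hom C S Q"
    and eq: "x \<cdot> i = Id C P" "y \<cdot> j = Id C Q" "y \<cdot> i = Zero C P Q" "x \<cdot> j = Zero C Q P"
      "(i \<cdot> x) \<boxplus> (j \<cdot> y) = Id C S"
    by (auto simp: biproduct_def)
  note S = Hom_Obj(2)[OF H(1)]
  note [simp] = O S HomD[OF f] HomD[OF g] HomD[OF H(1)] HomD[OF H(2)] HomD[OF H(3)] HomD[OF H(4)]
  have "i \<cdot> f \<in> Hom C Z S" "j \<cdot> g \<in> Hom C Z S"
    by (simp_all add: Hom_def)
  then obtain z where z: "z \<in> Hom C Z S" "z \<boxplus> j \<cdot> g = i \<cdot> f"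
    using Add_diff_exists by metis
  obtain D q where q: "q \<in> Hom C S D" "cokernel_arr C q z"
    using cokernel_exists[OF z(1)] by metis
  note [simp] = HomD[OF z(1)] HomD[OF q(1)] Hom_Obj(2)[OF q(1)]
  have qz: "q \<cdot> z = Zero C Z D"
    using cokernel_arr_Zero[OF q(2,1) z(1)] .
  show ?thesis
  proof (rule that[of "q \<cdot> i" D "q \<cdot> j"])
    show "q \<cdot> i \<in> Hom C P D" "q \<cdot> j \<in> Hom C Q D"
      by (simp_all add: Hom_def)
    have "q \<cdot> (z \<boxplus> j \<cdot> g) = q \<cdot> (i \<cdot> f)"
      using z by simp
    then show "q \<cdot> i \<cdot> f = q \<cdot> j \<cdot> g"
      using qz by simp
  next
    fix W Y a b assume W [simp]: "W \<in> Obj C" and a: "a \<in> Hom C (P \<otimes>\<^sub>o W) Y" and b: "b \<in> Hom C (Q \<otimes>\<^sub>o W) Y"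
      and ab: "a \<cdot> (Unit C \<triangleleft> f \<triangleright> W) = b \<cdot> (Unit C \<triangleleft> g \<triangleright> W)"
    note [simp] = HomD[OF a] HomD[OF b] Hom_Obj(2)[OF a]
    have w: "Unit C \<triangleleft> x \<triangleright> W \<cdot> Unit C \<triangleleft> i \<triangleright> W = Id C (P \<otimes>\<^sub>o W)"
      "Unit C \<triangleleft> y \<triangleright> W \<cdot> Unit C \<triangleleft> j \<triangleright> W = Id C (Q \<otimes>\<^sub>o W)"
      "Unit C \<triangleleft> y \<triangleright> W \<cdot> Unit C \<triangleleft> i \<triangleright> W = Zero C (P \<otimes>\<^sub>o W) (Q \<otimes>\<^sub>o W)"
      "Unit C \<triangleleft> x \<triangleright> W \<cdot> Unit C \<triangleleft> j \<triangleright> W = Zero C (Q \<otimes>\<^sub>o W) (P \<otimes>\<^sub>o W)"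
      by (simp_all add: eq flip: whisker_Comp)
    \<comment> \<open>The arrow out of the whiskered biproduct with components \<open>a\<close> and
      \<open>b\<close>. That it kills the whiskered \<open>z\<close> is the compatibility
      \<open>ab\<close> after cancelling one summand.\<close>
    define h where "h = a \<cdot> (Unit C \<triangleleft> x \<triangleright> W) \<boxplus> b \<cdot> (Unit C \<triangleleft> y \<triangleright> W)"
    have h: "h \<in> Hom C (S \<otimes>\<^sub>o W) Y"
      by (simp add: h_def Hom_def)
    note [simp] = HomD[OF h]
    have hi: "h \<cdot> (Unit C \<triangleleft> i \<triangleright> W) = a" and hj: "h \<cdot> (Unit C \<triangleleft> j \<triangleright> W) = b"
      by (simp_all add: h_def w)
    have "h \<cdot> (Unit C \<triangleleft> (z \<boxplus> j \<cdot> g) \<triangleright> W) = h \<cdot> (Unit C \<triangleleft> (i \<cdot> f) \<triangleright> W)"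
      using z by simp
    then have "h \<cdot> (Unit C \<triangleleft> z \<triangleright> W) \<boxplus> b \<cdot> (Unit C \<triangleleft> g \<triangleright> W) = a \<cdot> (Unit C \<triangleleft> f \<triangleright> W)"
      by (simp add: hi[THEN Comp_reassoc] hj[THEN Comp_reassoc])
    then have "h \<cdot> (Unit C \<triangleleft> z \<triangleright> W) = Zero C (Z \<otimes>\<^sub>o W) Y"
      using Add_cancel[of "h \<cdot> (Unit C \<triangleleft> z \<triangleright> W)" "b \<cdot> (Unit C \<triangleleft> g \<triangleright> W)" "Zero C (Z \<otimes>\<^sub>o W) Y"]
      by (simp add: ab)
    then obtain t where t: "t \<in> Hom C (D \<otimes>\<^sub>o W) Y" "t \<cdot> (Unit C \<triangleleft> q \<triangleright> W) = h"
      using cokernel_arr_factor[OF cokernel_whisker[of "Unit C" W q z], of "S \<otimes>\<^sub>o W" "D \<otimes>\<^sub>o W" "Z \<otimes>\<^sub>o W" h Y] q h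
      by (auto simp: Hom_def)
    show "\<exists>h \<in> Hom C (D \<otimes>\<^sub>o W) Y. h \<cdot> (Unit C \<triangleleft> (q \<cdot> i) \<triangleright> W) = a \<and> h \<cdot> (Unit C \<triangleleft> (q \<cdot> j) \<triangleright> W) = b"
      using t(2) hi hj HomD[OF t(1)] by (intro bexI[OF _ t(1)]) (simp add: Comp_reassoc)
  next
    fix Y a b
    assume a: "a \<in> Hom C D Y" and b: "b \<in> Hom C D Y" and ab: "a \<cdot> (q \<cdot> i) = b \<cdot> (q \<cdot> i)" "a \<cdot> (q \<cdot> j) = b \<cdot> (q \<cdot> j)"
    note [simp] = HomD[OF a] HomD[OF b] Hom_Obj(2)[OF a]
    have "n \<cdot> q = n \<cdot> (q \<cdot> i) \<cdot> x \<boxplus> n \<cdot> (q \<cdot> j) \<cdot> y" if "n \<in> Hom C D Y" for n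
    proof -
      have "n \<cdot> (q \<cdot> ((i \<cdot> x) \<boxplus> (j \<cdot> y))) = n \<cdot> q"
        using HomD[OF that] by (simp only: eq(5)) simp
      then show ?thesis
        using HomD[OF that] by simp
    qed
    then have "a \<cdot> q = b \<cdot> q"
      using a b ab by metis
    then show "a = b"
      using epi_arr_cancel[OF cokernel_arr_epi[OF q(2)] q(1) a b] by blast
  qed
qed

end

section \<open>Duals of extensions\<close>

context strict_abelian_monoidal
begin

text \<open>Arrows into \<open>Q \<otimes> D\<close> are transposed to arrows into \<open>Q\<close>,
  compatibly with composition by arrows out of \<open>Q\<close>. The kernel property of
  \<open>k\<close> is applied there, where \<open>D\<close> has disappeared, and the factorisation
  is moved back with \<open>c\<close>.\<close>

lemma kernel_whisker_dual:
  assumes dual: "strict_duality C D X e c" and f: "f \<in> Hom C Y Z" and k: "k \<in> Hom C K Y" "kernel_arr C k f"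
  shows "kernel_arr C (Unit C \<triangleleft> k \<triangleright> D) (Unit C \<triangleleft> f \<triangleright> D)"
proof -
  have X: "D \<in> Obj C" "X \<in> Obj C" "e \<in> Arr C" "Dom C e = D \<otimes>\<^sub>o X" "Cod C e = Unit C" "c \<in> Arr C"
      "Dom C c = Unit C" "Cod C c = X \<otimes>\<^sub>o D"
    using dual by (auto simp: strict_duality_def Hom_def)
  note [simp] = X HomD[OF f] HomD[OF k(1)] Hom_Obj[OF f] Hom_Obj[OF k(1)]
  text \<open>The transpose \<open>W \<otimes> X \<rightarrow> Q\<close> of \<open>g : W \<rightarrow> Q \<otimes> D\<close>.\<close>
  define tr where "tr Q g = (Q \<triangleleft> e \<triangleright> Unit C) \<cdot> (Unit C \<triangleleft> g \<triangleright> X)" for Q g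
  \<comment> \<open>One composite of the two transpositions is the identity, by the second zigzag.
    It recovers \<open>g\<close> from its transpose and so shows that a vanishing transpose forces
    \<open>g = 0\<close>.\<close>
  have untr: "(Unit C \<triangleleft> tr Q g \<triangleright> D) \<cdot> (W \<triangleleft> c \<triangleright> Unit C) = g" if g: "g \<in> Hom C W (Q \<otimes>\<^sub>o D)" and Q: "Q \<in> Obj C" for g W Q
  proof -
    note [simp] = HomD[OF g] Hom_Obj[OF g] Q
    note E = interchange[of "Unit C" "Unit C" "Unit C" g c, simplified] zigzag_whisker(2)[OF dual, of Q "Unit C", simplified]
    show ?thesis
      by (simp add: tr_def E E[THEN Comp_reassoc])
  qed
  have tr_Comp: "h \<cdot> tr Q g = tr R ((Unit C \<triangleleft> h \<triangleright> D) \<cdot> g)"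
    if h: "h \<in> Hom C Q R" and g: "g \<in> Hom C W (Q \<otimes>\<^sub>o D)" for Q R W g h
  proof -
    note [simp] = HomD[OF g] HomD[OF h] Hom_Obj[OF g] Hom_Obj[OF h]
    note E = interchange[of "Unit C" "Unit C" "Unit C" h e, simplified]
    show ?thesis
      by (simp add: tr_def E E[THEN Comp_reassoc])
  qed
  have kf: "f \<cdot> k = Zero C K Z"
    using kernel_arr_Zero[OF k(2,1) f] .
  have cancel: "tr Q g = Zero C (W \<otimes>\<^sub>o X) Q \<Longrightarrow> g = Zero C W (Q \<otimes>\<^sub>o D)"
    if g: "g \<in> Hom C W (Q \<otimes>\<^sub>o D)" and Q: "Q \<in> Obj C" for g W Q
    using untr[OF g Q] Hom_Obj[OF g] Q by simp
  show ?thesis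
  proof (rule kernel_arrI)
    show "Unit C \<triangleleft> f \<triangleright> D \<in> Hom C (Y \<otimes>\<^sub>o D) (Z \<otimes>\<^sub>o D)" "Unit C \<triangleleft> k \<triangleright> D \<in> Hom C (K \<otimes>\<^sub>o D) (Y \<otimes>\<^sub>o D)"
      by (simp_all add: Hom_def)
    show "(Unit C \<triangleleft> f \<triangleright> D) \<cdot> (Unit C \<triangleleft> k \<triangleright> D) = Zero C (K \<otimes>\<^sub>o D) (Z \<otimes>\<^sub>o D)"
      by (simp add: kf flip: whisker_Comp)
  next
    fix W g assume g: "g \<in> Hom C W (Y \<otimes>\<^sub>o D)" "(Unit C \<triangleleft> f \<triangleright> D) \<cdot> g = Zero C W (Z \<otimes>\<^sub>o D)"
    note [simp] = HomD[OF g(1)] Hom_Obj[OF g(1)]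
    have tg: "tr Y g \<in> Hom C (W \<otimes>\<^sub>o X) Y"
      by (simp add: tr_def Hom_def)
    have "f \<cdot> tr Y g = Zero C (W \<otimes>\<^sub>o X) Z"
      using tr_Comp[OF f g(1)] g(2) by (simp add: tr_def)
    then obtain h where h: "h \<in> Hom C (W \<otimes>\<^sub>o X) K" "k \<cdot> h = tr Y g"
      using kernel_arr_factor[OF k(2,1) f tg] by metis
    note [simp] = HomD[OF h(1)]
    have "(Unit C \<triangleleft> k \<triangleright> D) \<cdot> ((Unit C \<triangleleft> h \<triangleright> D) \<cdot> (W \<triangleleft> c \<triangleright> Unit C)) = g"
      using untr[OF g(1)] by (simp flip: h(2))
    then show "\<exists>u \<in> Hom C W (K \<otimes>\<^sub>o D). (Unit C \<triangleleft> k \<triangleright> D) \<cdot> u = g"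
      by (intro bexI[of _ "(Unit C \<triangleleft> h \<triangleright> D) \<cdot> (W \<triangleleft> c \<triangleright> Unit C)"]) (simp_all add: Hom_def)
  next
    show "mono_arr C (Unit C \<triangleleft> k \<triangleright> D)"
    proof (rule mono_arr_zeroI)
      show "Unit C \<triangleleft> k \<triangleright> D \<in> Hom C (K \<otimes>\<^sub>o D) (Y \<otimes>\<^sub>o D)"
        by (simp add: Hom_def)
    next
      fix W g assume g: "g \<in> Hom C W (K \<otimes>\<^sub>o D)" "(Unit C \<triangleleft> k \<triangleright> D) \<cdot> g = Zero C W (Y \<otimes>\<^sub>o D)"
      note [simp] = HomD[OF g(1)] Hom_Obj[OF g(1)]
      have tg: "tr K g \<in> Hom C (W \<otimes>\<^sub>o X) K"
        by (simp add: tr_def Hom_def)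
      have "k \<cdot> tr K g = k \<cdot> Zero C (W \<otimes>\<^sub>o X) K"
        using tr_Comp[OF k(1) g(1)] g(2) by (simp add: tr_def)
      then have "tr K g = Zero C (W \<otimes>\<^sub>o X) K"
        using mono_arr_cancel[OF kernel_arr_mono[OF k(2)] k(1) tg] Zero_in_Hom by simp
      then show "g = Zero C W (K \<otimes>\<^sub>o D)"
        using cancel[OF g(1)] by simp
    qed
  qed
qed

text \<open>All formulas come from vector spaces. For
  \<open>\<epsilon> = (\<phi>, \<lambda>)\<close> in \<open>E\<close>, the maps \<open>s\<close> and
  \<open>r\<close> give \<open>\<phi>\<close> and \<open>\<lambda>\<close>, and
  \<open>d \<epsilon>\<close> is \<open>\<phi> p - \<lambda>\<close> regarded as a map from
  \<open>X\<close> to \<open>A\<close>. The object \<open>D\<close> is generated by two kinds of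
  functionals on \<open>X\<close>, namely \<open>u \<beta> = \<beta> p\<close> and
  \<open>v (\<alpha>, \<epsilon>) = \<alpha> (d \<epsilon>)\<close>, and \<open>e\<close> evaluates
  them.\<close>

theorem strict_duality_extension:
  assumes dA: "strict_duality C A' A a_ev a_co" and dB: "strict_duality C B' B b_ev b_co"
    and i: "i \<in> Hom C A X" and p: "p \<in> Hom C X B" and ip: "kernel_arr C i p" and ep: "epi_arr C p"
  shows "\<exists>D e c. strict_duality C D X e c"
proof -
  let ?I = "Unit C"
  have A: "A' \<in> Obj C" "A \<in> Obj C" "a_ev \<in> Arr C" "Dom C a_ev = A' \<otimes>\<^sub>o A" "Cod C a_ev = Unit C" "a_co \<in> Arr C"
      "Dom C a_co = Unit C" "Cod C a_co = A \<otimes>\<^sub>o A'"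
    using dA by (auto simp: strict_duality_def Hom_def)
  have B: "B' \<in> Obj C" "B \<in> Obj C" "b_ev \<in> Arr C" "Dom C b_ev = B' \<otimes>\<^sub>o B" "Cod C b_ev = Unit C" "b_co \<in> Arr C"
      "Dom C b_co = Unit C" "Cod C b_co = B \<otimes>\<^sub>o B'"
    using dB by (auto simp: strict_duality_def Hom_def)
  note [simp] = A B HomD[OF i] HomD[OF p] Hom_Obj[OF p]
  have pi: "p \<cdot> i = Zero C A B"
    using kernel_arr_Zero[OF ip i p] .
  have i_cancel: "f = g" if "i \<cdot> f = i \<cdot> g" "f \<in> Arr C" "g \<in> Arr C" "Cod C f = A" "Cod C g = A" "Dom C f = Dom C g" for f g
    using mono_arr_cancel[OF kernel_arr_mono[OF ip] i, of f "Dom C g" g] that by (simp add: Hom_def)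
  have iB': "kernel_arr C (?I \<triangleleft> i \<triangleright> B') (?I \<triangleleft> p \<triangleright> B')"
    using kernel_whisker_dual[OF dB p i ip] .
  have H: "?I \<triangleleft> p \<triangleright> B' \<in> Hom C (X \<otimes>\<^sub>o B') (B \<otimes>\<^sub>o B')" "?I \<triangleleft> i \<triangleright> B' \<in> Hom C (A \<otimes>\<^sub>o B') (X \<otimes>\<^sub>o B')"
    "b_co \<in> Hom C ?I (B \<otimes>\<^sub>o B')"
    by (simp_all add: Hom_def)
  obtain E s r where s: "s \<in> Hom C E (X \<otimes>\<^sub>o B')" and r: "r \<in> Hom C E ?I"
    and ps: "(?I \<triangleleft> p \<triangleright> B') \<cdot> s = b_co \<cdot> r" and er: "epi_arr C r"
    and E_ex: "\<And>W a b. \<lbrakk>a \<in> Hom C W (X \<otimes>\<^sub>o B'); b \<in> Hom C W ?I; (?I \<triangleleft> p \<triangleright> B') \<cdot> a = b_co \<cdot> b\<rbrakk>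
       \<Longrightarrow> \<exists>h \<in> Hom C W E. s \<cdot> h = a \<and> r \<cdot> h = b"
    and E_cancel: "\<And>W a b. \<lbrakk>a \<in> Hom C W E; b \<in> Hom C W E; s \<cdot> a = s \<cdot> b; r \<cdot> a = r \<cdot> b\<rbrakk> \<Longrightarrow> a = b"
    by (rule pullback_of_epi_exists[OF H(1) epi_whisker[OF Unit_Obj B(1) ep] H(3)]) blast
  note [simp] = HomD[OF s] HomD[OF r] Hom_Obj[OF s]
  \<comment> \<open>The defining equations are also kept in whiskered form, to be applied inside a
    longer tensor word.\<close>
  note psw = arg_cong[OF ps, of "\<lambda>f. W \<triangleleft> f \<triangleright> V" for W V, simplified]

  \<comment> \<open>The arrow \<open>k\<close> sends \<open>\<alpha> : B \<rightarrow> A\<close> to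
    the pair \<open>(i \<alpha>, 0)\<close>.\<close>
  have "(?I \<triangleleft> p \<triangleright> B') \<cdot> (?I \<triangleleft> i \<triangleright> B') = b_co \<cdot> Zero C (A \<otimes>\<^sub>o B') ?I"
    by (simp add: pi flip: whisker_Comp)
  then obtain k where k: "k \<in> Hom C (A \<otimes>\<^sub>o B') E" and sk: "s \<cdot> k = ?I \<triangleleft> i \<triangleright> B'"
    and rk: "r \<cdot> k = Zero C (A \<otimes>\<^sub>o B') ?I"
    using E_ex[OF H(2) Zero_in_Hom] by auto
  note [simp] = HomD[OF k]
  \<comment> \<open>In a pullback square the kernel of \<open>r\<close> is the kernel of the map
    opposite to it, here \<open>p\<close> tensored with \<open>B'\<close>. That \<open>r\<close> is
    in turn the cokernel of \<open>k\<close> will let the coevaluation descend from \<open>E\<close>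
    to the unit.\<close>
  have "kernel_arr C k r"
  proof (rule kernel_arrI[OF r k rk])
    show "mono_arr C k"
    proof (rule mono_arrI[OF k])
      fix W g h assume gh: "g \<in> Hom C W (A \<otimes>\<^sub>o B')" "h \<in> Hom C W (A \<otimes>\<^sub>o B')" "k \<cdot> g = k \<cdot> h"
      then have "(?I \<triangleleft> i \<triangleright> B') \<cdot> g = (?I \<triangleleft> i \<triangleright> B') \<cdot> h"
        unfolding sk[symmetric] using Comp_assoc[OF _ k s] by simp
      then show "g = h"
        using mono_arr_cancel[OF kernel_arr_mono[OF iB'] H(2)] gh by blast
    qed
  next
    fix W g assume g: "g \<in> Hom C W E" "r \<cdot> g = Zero C W ?I"
    note [simp] = HomD[OF g(1)] Hom_Obj[OF g(1)]
    have "(?I \<triangleleft> p \<triangleright> B') \<cdot> (s \<cdot> g) = Zero C W (B \<otimes>\<^sub>o B')"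
      by (simp add: ps[THEN Comp_reassoc] g(2))
    then obtain h where h: "h \<in> Hom C W (A \<otimes>\<^sub>o B')" "(?I \<triangleleft> i \<triangleright> B') \<cdot> h = s \<cdot> g"
      using kernel_arr_factor[OF iB' H(2,1), of "s \<cdot> g" W] by (auto simp: Hom_def)
    note [simp] = HomD[OF h(1)]
    have "k \<cdot> h = g"
      by (rule E_cancel[of _ W]) (simp_all add: Hom_def sk[THEN Comp_reassoc] rk[THEN Comp_reassoc] h(2) g(2))
    then show "\<exists>u \<in> Hom C W (A \<otimes>\<^sub>o B'). k \<cdot> u = g"
      using h by blast
  qed
  then have rk_coker: "cokernel_arr C r k"
    using epi_cokernel_of_kernel[OF er r k] by blast

  have "(X \<triangleleft> b_ev \<triangleright> ?I) \<cdot> ((X \<otimes>\<^sub>o B') \<triangleleft> p \<triangleright> ?I) \<cdot> (?I \<triangleleft> s \<triangleright> X) \<in> Hom C (E \<otimes>\<^sub>o X) X"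
    "?I \<triangleleft> r \<triangleright> X \<in> Hom C (E \<otimes>\<^sub>o X) X"
    by (simp_all add: Hom_def)
  \<comment> \<open>\<open>t\<close> is the endomorphism \<open>\<phi> p - \<lambda>\<close> of
    \<open>X\<close>, parametrised by \<open>E\<close>. Since \<open>p \<phi> = \<lambda>\<close>,
    composing with \<open>p\<close> gives zero, so \<open>t\<close> lands in \<open>A\<close>; this
    defines \<open>d\<close>.\<close>
  then obtain t where t: "t \<in> Hom C (E \<otimes>\<^sub>o X) X"
    and t_eq: "t \<boxplus> (?I \<triangleleft> r \<triangleright> X) = (X \<triangleleft> b_ev \<triangleright> ?I) \<cdot> ((X \<otimes>\<^sub>o B') \<triangleleft> p \<triangleright> ?I) \<cdot> (?I \<triangleleft> s \<triangleright> X)"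
    using Add_diff_exists by metis
  note [simp] = HomD[OF t]
  have "p \<cdot> t \<boxplus> p \<cdot> (?I \<triangleleft> r \<triangleright> X) = p \<cdot> (t \<boxplus> (?I \<triangleleft> r \<triangleright> X))"
    by simp
  also have "\<dots> = p \<cdot> (?I \<triangleleft> r \<triangleright> X)"
  proof -
    note E = interchange[of ?I ?I ?I p b_ev, simplified] interchange[of ?I B' ?I p p, simplified]
      psw[of ?I X, simplified] interchange[of ?I ?I ?I b_co p, simplified, symmetric]
      zigzag_whisker(1)[OF dB, of ?I ?I, simplified]
    show ?thesis
      unfolding t_eq by (simp add: E E[THEN Comp_reassoc])
  qed
  also have "\<dots> = Zero C (E \<otimes>\<^sub>o X) B \<boxplus> p \<cdot> (?I \<triangleleft> r \<triangleright> X)"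
    by simp
  finally have "p \<cdot> t = Zero C (E \<otimes>\<^sub>o X) B"
    by (rule Add_cancel) simp_all
  then obtain d where d: "d \<in> Hom C (E \<otimes>\<^sub>o X) A" and id: "i \<cdot> d = t"
    using kernel_arr_factor[OF ip i p t] by metis
  note [simp] = HomD[OF d]
  have d_eq: "i \<cdot> d \<boxplus> (?I \<triangleleft> r \<triangleright> X) = (X \<triangleleft> b_ev \<triangleright> ?I) \<cdot> ((X \<otimes>\<^sub>o B') \<triangleleft> p \<triangleright> ?I) \<cdot> (?I \<triangleleft> s \<triangleright> X)"
    using t_eq id by simp
  note d_eqw = arg_cong[OF d_eq, of "\<lambda>f. W \<triangleleft> f \<triangleright> V" for W V, simplified]
  note sww = arg_cong[OF sk, of "\<lambda>f. W \<triangleleft> f \<triangleright> V" for W V, simplified]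
  note rkw = arg_cong[OF rk, of "\<lambda>f. W \<triangleleft> f \<triangleright> V" for W V, simplified]

  \<comment> \<open>For \<open>\<epsilon> = k \<alpha>\<close> this reads
    \<open>d \<epsilon> = \<alpha> p\<close>. It is the compatibility that makes \<open>e\<close>
    well defined on the pushout.\<close>
  have d_k: "d \<cdot> (?I \<triangleleft> k \<triangleright> X) = (A \<triangleleft> b_ev \<triangleright> ?I) \<cdot> ((A \<otimes>\<^sub>o B') \<triangleleft> p \<triangleright> ?I)"
  proof (rule i_cancel)
    note E = sww[of ?I X, simplified] rkw[of ?I X, simplified]
      interchange[of ?I ?I ?I i b_ev, simplified] interchange[of ?I B' ?I i p, simplified]
    have "(i \<cdot> d \<boxplus> (?I \<triangleleft> r \<triangleright> X)) \<cdot> (?I \<triangleleft> k \<triangleright> X) = i \<cdot> ((A \<triangleleft> b_ev \<triangleright> ?I) \<cdot> ((A \<otimes>\<^sub>o B') \<triangleleft> p \<triangleright> ?I))"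
      unfolding d_eq by (simp add: E E[THEN Comp_reassoc])
    then show "i \<cdot> (d \<cdot> (?I \<triangleleft> k \<triangleright> X)) = i \<cdot> ((A \<triangleleft> b_ev \<triangleright> ?I) \<cdot> ((A \<otimes>\<^sub>o B') \<triangleleft> p \<triangleright> ?I))"
      by (simp add: E)
  qed simp_all
  \<comment> \<open>On \<open>A\<close> the map \<open>\<phi> p\<close> vanishes, so
    \<open>d \<epsilon>\<close> acts there as \<open>- \<lambda>\<close>.\<close>
  have d_i: "d \<cdot> (E \<triangleleft> i \<triangleright> ?I) \<boxplus> (?I \<triangleleft> r \<triangleright> A) = Zero C (E \<otimes>\<^sub>o A) A"
  proof (rule i_cancel)
    note piw = arg_cong[OF pi, of "\<lambda>f. W \<triangleleft> f \<triangleright> V" for W V, simplified]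
    note E = interchange[of ?I ?I ?I r i, simplified] interchange[of ?I ?I ?I s i, simplified]
      piw[of "X \<otimes>\<^sub>o B'" ?I, simplified]
    have "(i \<cdot> d \<boxplus> (?I \<triangleleft> r \<triangleright> X)) \<cdot> (E \<triangleleft> i \<triangleright> ?I) = Zero C (E \<otimes>\<^sub>o A) X"
      unfolding d_eq by (simp add: E E[THEN Comp_reassoc])
    then show "i \<cdot> (d \<cdot> (E \<triangleleft> i \<triangleright> ?I) \<boxplus> (?I \<triangleleft> r \<triangleright> A)) = i \<cdot> Zero C (E \<otimes>\<^sub>o A) A"
      by (simp add: E)
  qed simp_all
  \<comment> \<open>For two elements of \<open>E\<close> one has \<open>i (d \<epsilon>) \<phi>' =
    \<phi> \<lambda>' - \<lambda> \<phi>'\<close>: two sections differ by a map into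
    \<open>A\<close>. The equation is checked on the components \<open>s\<close> and
    \<open>r\<close> of the pullback.\<close>
  have d_s: "k \<cdot> ((?I \<triangleleft> d \<triangleright> B') \<cdot> (E \<triangleleft> s \<triangleright> ?I)) \<boxplus> (?I \<triangleleft> r \<triangleright> E) = E \<triangleleft> r \<triangleright> ?I"
  proof (rule E_cancel[of _ "E \<otimes>\<^sub>o E"])
    note E = interchange[of ?I ?I ?I s s, simplified] interchange[of ?I ?I ?I s r, simplified]
      interchange[of ?I ?I ?I r s, simplified] psw[of "X \<otimes>\<^sub>o B'" ?I, simplified]
      zigzag_whisker(2)[OF dB, of X ?I, simplified]
    have "((?I \<triangleleft> (i \<cdot> d \<boxplus> (?I \<triangleleft> r \<triangleright> X)) \<triangleright> B')) \<cdot> (E \<triangleleft> s \<triangleright> ?I) = s \<cdot> (E \<triangleleft> r \<triangleright> ?I)"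
      unfolding d_eq by (simp add: E E[THEN Comp_reassoc])
    then show "s \<cdot> (k \<cdot> ((?I \<triangleleft> d \<triangleright> B') \<cdot> (E \<triangleleft> s \<triangleright> ?I)) \<boxplus> (?I \<triangleleft> r \<triangleright> E)) = s \<cdot> (E \<triangleleft> r \<triangleright> ?I)"
      by (simp add: E sk sk[THEN Comp_reassoc])
    show "r \<cdot> (k \<cdot> ((?I \<triangleleft> d \<triangleright> B') \<cdot> (E \<triangleleft> s \<triangleright> ?I)) \<boxplus> (?I \<triangleleft> r \<triangleright> E)) = r \<cdot> (E \<triangleleft> r \<triangleright> ?I)"
      using interchange[of ?I ?I ?I r r] by (simp add: rk rk[THEN Comp_reassoc])
  qed (simp_all add: Hom_def)

  have "?I \<triangleleft> a_ev \<triangleright> B' \<in> Hom C (A' \<otimes>\<^sub>o (A \<otimes>\<^sub>o B')) B'" "A' \<triangleleft> k \<triangleright> ?I \<in> Hom C (A' \<otimes>\<^sub>o (A \<otimes>\<^sub>o B')) (A' \<otimes>\<^sub>o E)"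
    by (simp_all add: Hom_def)
  \<comment> \<open>On \<open>\<alpha> \<otimes> (a \<otimes> \<beta>)\<close> both kinds of
    generators give the functional \<open>\<alpha>(a) \<beta> p\<close>; this is the relation that
    the pushout imposes.\<close>
  then obtain D u v where u: "u \<in> Hom C B' D" and v: "v \<in> Hom C (A' \<otimes>\<^sub>o E) D"
    and uv: "u \<cdot> (?I \<triangleleft> a_ev \<triangleright> B') = v \<cdot> (A' \<triangleleft> k \<triangleright> ?I)"
    and D_ex: "\<And>W Y a b. \<lbrakk>W \<in> Obj C; a \<in> Hom C (B' \<otimes>\<^sub>o W) Y; b \<in> Hom C (A' \<otimes>\<^sub>o E \<otimes>\<^sub>o W) Y;
        a \<cdot> (Unit C \<triangleleft> (?I \<triangleleft> a_ev \<triangleright> B') \<triangleright> W) = b \<cdot> (Unit C \<triangleleft> (A' \<triangleleft> k \<triangleright> ?I) \<triangleright> W)\<rbrakk>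
      \<Longrightarrow> \<exists>h \<in> Hom C (D \<otimes>\<^sub>o W) Y. h \<cdot> (Unit C \<triangleleft> u \<triangleright> W) = a \<and> h \<cdot> (Unit C \<triangleleft> v \<triangleright> W) = b"
    and D_cancel: "\<And>Y a b. \<lbrakk>a \<in> Hom C D Y; b \<in> Hom C D Y; a \<cdot> u = b \<cdot> u; a \<cdot> v = b \<cdot> v\<rbrakk> \<Longrightarrow> a = b"
    by (rule whiskered_pushout_exists) blast
  note [simp] = HomD[OF u] HomD[OF v] Hom_Obj(2)[OF u]
  note uvw = arg_cong[OF uv, of "\<lambda>f. W \<triangleleft> f \<triangleright> V" for W V, simplified]
  note d_kw = arg_cong[OF d_k, of "\<lambda>f. W \<triangleleft> f \<triangleright> V" for W V, simplified]
  note d_iw = arg_cong[OF d_i, of "\<lambda>f. W \<triangleleft> f \<triangleright> V" for W V, simplified]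
  note d_sw = arg_cong[OF d_s, of "\<lambda>f. W \<triangleleft> f \<triangleright> V" for W V, simplified]

  have "b_ev \<cdot> (B' \<triangleleft> p \<triangleright> ?I) \<cdot> (Unit C \<triangleleft> (?I \<triangleleft> a_ev \<triangleright> B') \<triangleright> X)
    = a_ev \<cdot> (A' \<triangleleft> d \<triangleright> ?I) \<cdot> (Unit C \<triangleleft> (A' \<triangleleft> k \<triangleright> ?I) \<triangleright> X)"
  proof -
    note E = d_kw[of A' ?I, simplified] interchange[of ?I B' ?I a_ev p, simplified, symmetric]
      interchange[of ?I ?I ?I a_ev b_ev, simplified, symmetric]
    show ?thesis
      by (simp add: E E[THEN Comp_reassoc])
  qed
  then obtain e where e: "e \<in> Hom C (D \<otimes>\<^sub>o X) ?I"
    and eu: "e \<cdot> (?I \<triangleleft> u \<triangleright> X) = b_ev \<cdot> (B' \<triangleleft> p \<triangleright> ?I)" and ev: "e \<cdot> (?I \<triangleleft> v \<triangleright> X) = a_ev \<cdot> (A' \<triangleleft> d \<triangleright> ?I)"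
    using D_ex[of X "b_ev \<cdot> (B' \<triangleleft> p \<triangleright> ?I)" ?I "a_ev \<cdot> (A' \<triangleleft> d \<triangleright> ?I)"] by (auto simp: Hom_def)
  note [simp] = HomD[OF e]

  have "(X \<triangleleft> u \<triangleright> ?I) \<cdot> s \<in> Hom C E (X \<otimes>\<^sub>o D)"
    "(?I \<triangleleft> i \<triangleright> D) \<cdot> (A \<triangleleft> v \<triangleright> ?I) \<cdot> (?I \<triangleleft> a_co \<triangleright> E) \<in> Hom C E (X \<otimes>\<^sub>o D)"
    by (simp_all add: Hom_def)
  \<comment> \<open>\<open>w\<close> is the intended composite of \<open>c\<close> with
    \<open>r\<close>: the map \<open>\<phi>\<close> with its \<open>B'\<close> sent through
    \<open>u\<close>, minus \<open>i\<close> applied to a dual basis of \<open>A\<close> whose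
    functionals are joined to \<open>\<epsilon>\<close> by \<open>v\<close>. Evaluated on
    \<open>X\<close> it yields \<open>\<phi> p - i (d \<epsilon>) = \<lambda>\<close>.\<close>
  then obtain w where w: "w \<in> Hom C E (X \<otimes>\<^sub>o D)"
    and w_eq: "w \<boxplus> (?I \<triangleleft> i \<triangleright> D) \<cdot> (A \<triangleleft> v \<triangleright> ?I) \<cdot> (?I \<triangleleft> a_co \<triangleright> E) = (X \<triangleleft> u \<triangleright> ?I) \<cdot> s"
    using Add_diff_exists by metis
  note [simp] = HomD[OF w]
  \<comment> \<open>Along \<open>k\<close> the two terms agree: the pushout relation turns
    \<open>v\<close> into \<open>u\<close>, and the zigzag of \<open>A\<close> removes the dual
    basis. Hence \<open>w\<close> factors through the cokernel \<open>r\<close> of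
    \<open>k\<close>.\<close>
  have "w \<cdot> k = Zero C (A \<otimes>\<^sub>o B') (X \<otimes>\<^sub>o D)"
  proof (rule Add_cancel[where h = "(?I \<triangleleft> i \<triangleright> D) \<cdot> (A \<triangleleft> u \<triangleright> ?I)"])
    note E = uvw[of A ?I, simplified, symmetric] interchange[of ?I ?I ?I a_co k, simplified]
      zigzag_whisker(1)[OF dA, of ?I B', simplified] interchange[of ?I ?I ?I i u, simplified, symmetric]
    have "w \<cdot> k \<boxplus> (?I \<triangleleft> i \<triangleright> D) \<cdot> (A \<triangleleft> u \<triangleright> ?I)
      = (w \<boxplus> (?I \<triangleleft> i \<triangleright> D) \<cdot> (A \<triangleleft> v \<triangleright> ?I) \<cdot> (?I \<triangleleft> a_co \<triangleright> E)) \<cdot> k"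
      by (simp add: E E[THEN Comp_reassoc])
    also have "\<dots> = Zero C (A \<otimes>\<^sub>o B') (X \<otimes>\<^sub>o D) \<boxplus> (?I \<triangleleft> i \<triangleright> D) \<cdot> (A \<triangleleft> u \<triangleright> ?I)"
      unfolding w_eq by (simp add: sk E)
    finally show "w \<cdot> k \<boxplus> (?I \<triangleleft> i \<triangleright> D) \<cdot> (A \<triangleleft> u \<triangleright> ?I) = \<dots>" .
  qed simp_all
  then obtain c where c: "c \<in> Hom C ?I (X \<otimes>\<^sub>o D)" and cr: "c \<cdot> r = w"
    using cokernel_arr_factor[OF rk_coker r k w] by metis
  note [simp] = HomD[OF c]
  have c_eq: "c \<cdot> r \<boxplus> (?I \<triangleleft> i \<triangleright> D) \<cdot> (A \<triangleleft> v \<triangleright> ?I) \<cdot> (?I \<triangleleft> a_co \<triangleright> E) = (X \<triangleleft> u \<triangleright> ?I) \<cdot> s"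
    using w_eq cr by simp
  note c_eqw = arg_cong[OF c_eq, of "\<lambda>f. W \<triangleleft> f \<triangleright> V" for W V, simplified]
  note euw = arg_cong[OF eu, of "\<lambda>f. W \<triangleleft> f \<triangleright> V" for W V, simplified]
  note evw = arg_cong[OF ev, of "\<lambda>f. W \<triangleleft> f \<triangleright> V" for W V, simplified]

  \<comment> \<open>After the epi \<open>r\<close> tensored with \<open>X\<close> this becomes
    \<open>\<phi> p - i (d \<epsilon>) = \<lambda>\<close>. The subtracted term is added to both
    sides and cancelled at the end.\<close>
  have Z1: "(X \<triangleleft> e \<triangleright> ?I) \<cdot> (?I \<triangleleft> c \<triangleright> X) = Id C X"
  proof (rule epi_arr_cancel[OF epi_whisker[OF _ _ er, of ?I X], of "E \<otimes>\<^sub>o X" X _ X])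
    note E = euw[of X ?I, simplified] interchange[of ?I ?I ?I i e, simplified, symmetric] evw[of A ?I, simplified]
      interchange[of ?I ?I ?I a_co d, simplified, symmetric] zigzag_whisker(1)[OF dA, of ?I ?I, simplified]
    have "(X \<triangleleft> e \<triangleright> ?I) \<cdot> (?I \<triangleleft> (c \<cdot> r \<boxplus> (?I \<triangleleft> i \<triangleright> D) \<cdot> (A \<triangleleft> v \<triangleright> ?I) \<cdot> (?I \<triangleleft> a_co \<triangleright> E)) \<triangleright> X)
       = (?I \<triangleleft> r \<triangleright> X) \<boxplus> i \<cdot> d"
      unfolding c_eq using d_eq Add_commute[of "?I \<triangleleft> r \<triangleright> X" "E \<otimes>\<^sub>o X" X "i \<cdot> d"]
      by (simp add: Hom_def E E[THEN Comp_reassoc])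
    then have "(X \<triangleleft> e \<triangleright> ?I) \<cdot> (?I \<triangleleft> c \<triangleright> X) \<cdot> (?I \<triangleleft> r \<triangleright> X) \<boxplus> i \<cdot> d = (?I \<triangleleft> r \<triangleright> X) \<boxplus> i \<cdot> d"
      by (simp add: E E[THEN Comp_reassoc])
    then have "(X \<triangleleft> e \<triangleright> ?I) \<cdot> (?I \<triangleleft> c \<triangleright> X) \<cdot> (?I \<triangleleft> r \<triangleright> X) = ?I \<triangleleft> r \<triangleright> X"
      by (rule Add_cancel) simp_all
    then show "(X \<triangleleft> e \<triangleright> ?I) \<cdot> (?I \<triangleleft> c \<triangleright> X) \<cdot> (?I \<triangleleft> r \<triangleright> X) = Id C X \<cdot> (?I \<triangleleft> r \<triangleright> X)"
      by simp
  qed (simp_all add: Hom_def)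

  \<comment> \<open>The arrows \<open>u\<close> and \<open>v\<close> are jointly epi, so the
    identity is tested on the two kinds of generators, each time after a whiskered
    \<open>r\<close>.\<close>
  have Z2: "(?I \<triangleleft> e \<triangleright> D) \<cdot> (D \<triangleleft> c \<triangleright> ?I) = Id C D"
  proof (rule D_cancel[of _ D])
    \<comment> \<open>Along \<open>u\<close> the evaluation involves \<open>p\<close>, which kills
      the subtracted term of \<open>c\<close> because \<open>p \<cdot> i = 0\<close>; the other term
      reduces by the zigzag of \<open>B\<close>.\<close>
    show "(?I \<triangleleft> e \<triangleright> D) \<cdot> (D \<triangleleft> c \<triangleright> ?I) \<cdot> u = Id C D \<cdot> u"
    proof (rule epi_arr_cancel[OF epi_whisker[OF _ _ er, of B' ?I], of "B' \<otimes>\<^sub>o E" B' _ D])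
      note piw = arg_cong[OF pi, of "\<lambda>f. W \<triangleleft> f \<triangleright> V" for W V, simplified]
      note E = interchange[of ?I ?I ?I u c, simplified, symmetric] euw[of ?I D, simplified]
        interchange[of B' ?I ?I p u, simplified] psw[of B' ?I, simplified] piw[of B' D, simplified]
        interchange[of ?I ?I ?I b_ev u, simplified] zigzag_whisker(2)[OF dB, of ?I ?I, simplified]
      have "(?I \<triangleleft> b_ev \<triangleright> D) \<cdot> (B' \<triangleleft> p \<triangleright> D) \<cdot> (B' \<triangleleft> (c \<cdot> r \<boxplus> (?I \<triangleleft> i \<triangleright> D) \<cdot> (A \<triangleleft> v \<triangleright> ?I) \<cdot> (?I \<triangleleft> a_co \<triangleright> E)) \<triangleright> ?I)
        = u \<cdot> (B' \<triangleleft> r \<triangleright> ?I)"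
        unfolding c_eq by (simp add: E E[THEN Comp_reassoc])
      then have "(?I \<triangleleft> b_ev \<triangleright> D) \<cdot> (B' \<triangleleft> p \<triangleright> D) \<cdot> (B' \<triangleleft> c \<triangleright> ?I) \<cdot> (B' \<triangleleft> r \<triangleright> ?I) = u \<cdot> (B' \<triangleleft> r \<triangleright> ?I)"
        by (simp add: E(5)[THEN Comp_reassoc])
      then show "(?I \<triangleleft> e \<triangleright> D) \<cdot> (D \<triangleleft> c \<triangleright> ?I) \<cdot> u \<cdot> (B' \<triangleleft> r \<triangleright> ?I) = Id C D \<cdot> u \<cdot> (B' \<triangleleft> r \<triangleright> ?I)"
        by (simp add: E(1,2) E(1,2)[THEN Comp_reassoc])
    qed (simp_all add: Hom_def)
    show "(?I \<triangleleft> e \<triangleright> D) \<cdot> (D \<triangleleft> c \<triangleright> ?I) \<cdot> v = Id C D \<cdot> v"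
    proof (rule epi_arr_cancel[OF epi_whisker[OF _ _ er, of "A' \<otimes>\<^sub>o E" ?I], of "A' \<otimes>\<^sub>o (E \<otimes>\<^sub>o E)" "A' \<otimes>\<^sub>o E" _ D])
      \<comment> \<open>\<open>?Z\<close> is the composite to be computed, \<open>?q\<close> comes
        from the subtracted term of \<open>c\<close>, and \<open>?r\<close> is the term
        \<open>\<lambda> \<epsilon>'\<close> of \<open>d_s\<close> sent through \<open>v\<close>.
        The three identities below say that \<open>?Z\<close> has the desired value up to
        \<open>?q\<close> and \<open>?r\<close>, and that these cancel.\<close>
      let ?Z = "(?I \<triangleleft> a_ev \<triangleright> D) \<cdot> (A' \<triangleleft> d \<triangleright> D) \<cdot> ((A' \<otimes>\<^sub>o E) \<triangleleft> c \<triangleright> ?I) \<cdot> ((A' \<otimes>\<^sub>o E) \<triangleleft> r \<triangleright> ?I)"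
      let ?q = "(?I \<triangleleft> a_ev \<triangleright> D) \<cdot> (A' \<triangleleft> (d \<cdot> (E \<triangleleft> i \<triangleright> ?I)) \<triangleright> D) \<cdot> ((A' \<otimes>\<^sub>o (E \<otimes>\<^sub>o A)) \<triangleleft> v \<triangleright> ?I) \<cdot> ((A' \<otimes>\<^sub>o E) \<triangleleft> a_co \<triangleright> E)"
      let ?r = "v \<cdot> (A' \<triangleleft> r \<triangleright> E)"
      have 1: "?Z \<boxplus> ?q = (?I \<triangleleft> a_ev \<triangleright> D) \<cdot> (A' \<triangleleft> d \<triangleright> D) \<cdot> ((A' \<otimes>\<^sub>o (E \<otimes>\<^sub>o X)) \<triangleleft> u \<triangleright> ?I) \<cdot> ((A' \<otimes>\<^sub>o E) \<triangleleft> s \<triangleright> ?I)"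
        using c_eqw[of "A' \<otimes>\<^sub>o E" ?I, simplified, THEN arg_cong, of "\<lambda>f. (?I \<triangleleft> a_ev \<triangleright> D) \<cdot> ((A' \<triangleleft> d \<triangleright> D) \<cdot> f)"]
        by simp
      have 2: "\<dots> \<boxplus> ?r = v \<cdot> ((A' \<otimes>\<^sub>o E) \<triangleleft> r \<triangleright> ?I)"
      proof -
        note E = interchange[of A' ?I ?I d u, simplified] interchange[of ?I ?I ?I a_ev u, simplified] uv
        show ?thesis
          using d_sw[of A' ?I, simplified, THEN arg_cong, of "\<lambda>f. v \<cdot> f"]
          by (simp add: E E[THEN Comp_reassoc])
      qed
      \<comment> \<open>Once the zigzag of \<open>A\<close> is inserted into \<open>?r\<close>, both
        terms share their outer factors and the sum contains the left-hand side of
        \<open>d_i\<close>.\<close>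
      have 3: "?q \<boxplus> ?r = Zero C (A' \<otimes>\<^sub>o (E \<otimes>\<^sub>o E)) D"
      proof -
        note E = interchange[of A' A ?I r v, simplified] interchange[of A' ?I E r a_co, simplified] interchange[of ?I ?I ?I a_ev v, simplified]
           zigzag_whisker(2)[OF dA, of ?I E, simplified]
        have r': "?r = (?I \<triangleleft> a_ev \<triangleright> D) \<cdot> (A' \<triangleleft> r \<triangleright> (A \<otimes>\<^sub>o D)) \<cdot> ((A' \<otimes>\<^sub>o (E \<otimes>\<^sub>o A)) \<triangleleft> v \<triangleright> ?I) \<cdot> ((A' \<otimes>\<^sub>o E) \<triangleleft> a_co \<triangleright> E)"
          by (simp add: E E[THEN Comp_reassoc])
        have "?q \<boxplus> ?r = (?I \<triangleleft> a_ev \<triangleright> D) \<cdot> (A' \<triangleleft> (d \<cdot> (E \<triangleleft> i \<triangleright> ?I) \<boxplus> (?I \<triangleleft> r \<triangleright> A)) \<triangleright> D) \<cdot> ((A' \<otimes>\<^sub>o (E \<otimes>\<^sub>o A)) \<triangleleft> v \<triangleright> ?I) \<cdot> ((A' \<otimes>\<^sub>o E) \<triangleleft> a_co \<triangleright> E)"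
          unfolding r' by simp
        also have "\<dots> = Zero C (A' \<otimes>\<^sub>o (E \<otimes>\<^sub>o E)) D"
          unfolding d_i by simp
        finally show ?thesis .
      qed
      have "?Z \<boxplus> (?q \<boxplus> ?r) = v \<cdot> ((A' \<otimes>\<^sub>o E) \<triangleleft> r \<triangleright> ?I)"
        unfolding 2[symmetric] 1[symmetric]
        by (rule Add_assoc[symmetric, of _ "A' \<otimes>\<^sub>o (E \<otimes>\<^sub>o E)" D]) (simp_all add: Hom_def)
      then have "?Z = v \<cdot> ((A' \<otimes>\<^sub>o E) \<triangleleft> r \<triangleright> ?I)"
        unfolding 3 by simp
      moreover note E = interchange[of ?I ?I ?I v c, simplified, symmetric] evw[of ?I D, simplified]
      ultimately show "(?I \<triangleleft> e \<triangleright> D) \<cdot> (D \<triangleleft> c \<triangleright> ?I) \<cdot> v \<cdot> ((A' \<otimes>\<^sub>o E) \<triangleleft> r \<triangleright> ?I) = Id C D \<cdot> v \<cdot> ((A' \<otimes>\<^sub>o E) \<triangleleft> r \<triangleright> ?I)"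
        by (simp add: E E[THEN Comp_reassoc])
    qed (simp_all add: Hom_def)
  qed (simp_all add: Hom_def)
  have "strict_duality C D X e c"
    using Z1 Z2 by (simp add: strict_duality_def Hom_def whisker_def)
  then show ?thesis
    by blast
qed

end

section \<open>Unit coherence\<close>

context category
begin

lemma inverse_arrs_unique:
  assumes "inverse_arrs C f g" "inverse_arrs C f h"
  shows "g = h"
proof -
  have g: "g \<in> Hom C (Cod C f) (Dom C f)" and h: "h \<in> Hom C (Cod C f) (Dom C f)"
    and f: "f \<in> Hom C (Dom C f) (Cod C f)"
    using assms by (auto simp: inverse_arrs_def Hom_def)
  have "g = g \<cdot> (f \<cdot> h)"
    using assms Comp_Id_right[OF g] by (simp add: inverse_arrs_def)
  also have "\<dots> = h"
    using assms Comp_assoc[OF h f g] Comp_Id_left[OF h] by (simp add: inverse_arrs_def)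
  finally show ?thesis .
qed

lemma inv_arr_eq: "inverse_arrs C f g \<Longrightarrow> inv_arr C f = g"
  unfolding inv_arr_def using inverse_arrs_unique by blast

lemma inverse_arrs_inv_arr: "iso_arr C f \<Longrightarrow> inverse_arrs C f (inv_arr C f)"
  unfolding iso_arr_def using inv_arr_eq by metis

end

section \<open>Calculus with associators, unitors and their inverses\<close>

context monoidal_category
begin

lemma Obj_simps [simp]:
  "f \<in> Arr C \<Longrightarrow> Dom C f \<in> Obj C"
  "f \<in> Arr C \<Longrightarrow> Cod C f \<in> Obj C"
  "Unit C \<in> Obj C"
  "\<lbrakk>X \<in> Obj C; Y \<in> Obj C\<rbrakk> \<Longrightarrow> X \<otimes>\<^sub>o Y \<in> Obj C"
  by (simp_all add: Dom_closed Cod_closed Unit_closed TensO_closed)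

lemma Id_simps [simp]:
  assumes "X \<in> Obj C"
  shows "Id C X \<in> Arr C" "Dom C (Id C X) = X" "Cod C (Id C X) = X"
  using Id_in_Hom[OF assms] by (simp_all add: Hom_def)

lemma Comp_simps [simp]:
  assumes "f \<in> Arr C" "g \<in> Arr C" "Cod C f = Dom C g"
  shows "g \<cdot> f \<in> Arr C" "Dom C (g \<cdot> f) = Dom C f" "Cod C (g \<cdot> f) = Cod C g"
  using Comp_in_Hom[of f "Dom C f" "Dom C g" g "Cod C g"] assms by (simp_all add: Hom_def)

lemma TensA_simps [simp]:
  assumes "f \<in> Arr C" "g \<in> Arr C"
  shows "f \<otimes>\<^sub>a g \<in> Arr C" "Dom C (f \<otimes>\<^sub>a g) = Dom C f \<otimes>\<^sub>o Dom C g" "Cod C (f \<otimes>\<^sub>a g) = Cod C f \<otimes>\<^sub>o Cod C g"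
  using TensA_in_Hom[of f "Dom C f" "Cod C f" g "Dom C g" "Cod C g"] assms by (simp_all add: Hom_def)

lemma Assoc_simps [simp]:
  assumes "X \<in> Obj C" "Y \<in> Obj C" "Z \<in> Obj C"
  shows "Assoc C X Y Z \<in> Arr C" "Dom C (Assoc C X Y Z) = X \<otimes>\<^sub>o Y \<otimes>\<^sub>o Z"
    "Cod C (Assoc C X Y Z) = X \<otimes>\<^sub>o (Y \<otimes>\<^sub>o Z)"
  using Assoc_in_Hom[OF assms] by (simp_all add: Hom_def)

lemma unitor_simps [simp]:
  assumes "X \<in> Obj C"
  shows "Lunit C X \<in> Arr C" "Dom C (Lunit C X) = Unit C \<otimes>\<^sub>o X" "Cod C (Lunit C X) = X"
    "Runit C X \<in> Arr C" "Dom C (Runit C X) = X \<otimes>\<^sub>o Unit C" "Cod C (Runit C X) = X"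
  using Lunit_in_Hom[OF assms] Runit_in_Hom[OF assms] by (simp_all add: Hom_def)

lemma Id_Comp_simps [simp]:
  "\<lbrakk>f \<in> Arr C; Cod C f = X\<rbrakk> \<Longrightarrow> Id C X \<cdot> f = f"
  "\<lbrakk>f \<in> Arr C; Dom C f = X\<rbrakk> \<Longrightarrow> f \<cdot> Id C X = f"
  using Comp_Id_left[of f "Dom C f" X] Comp_Id_right[of f X "Cod C f"] by (simp_all add: Hom_def)

lemma Comp_Comp [simp]:
  "\<lbrakk>f \<in> Arr C; g \<in> Arr C; h \<in> Arr C; Cod C f = Dom C g; Cod C g = Dom C h\<rbrakk> \<Longrightarrow> h \<cdot> g \<cdot> f = h \<cdot> (g \<cdot> f)"
  using Comp_assoc by (simp add: Hom_def)

lemma Comp_reassoc: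
  "\<lbrakk>h \<cdot> g = k; f \<in> Arr C; g \<in> Arr C; h \<in> Arr C; Cod C f = Dom C g; Cod C g = Dom C h\<rbrakk> \<Longrightarrow> h \<cdot> (g \<cdot> f) = k \<cdot> f"
  using Comp_Comp[of f g h] by simp

declare TensA_Id [simp]

text \<open>The orientation is opposite to whiskering: consecutive tensored arrows are fused. Where
  a single factor must stay visible, for instance for \<open>Assoc_nat\<close>, the rule is switched
  off.\<close>

lemma TensA_merge [simp]:
  "\<lbrakk>f \<in> Arr C; g \<in> Arr C; f' \<in> Arr C; g' \<in> Arr C; Cod C f = Dom C g; Cod C f' = Dom C g'\<rbrakk>
    \<Longrightarrow> (g \<otimes>\<^sub>a g') \<cdot> (f \<otimes>\<^sub>a f') = (g \<cdot> f) \<otimes>\<^sub>a (g' \<cdot> f')"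
  using TensA_Comp[of f "Dom C f" "Dom C g" g "Cod C g" f' "Dom C f'" "Dom C g'" g' "Cod C g'"]
  by (simp add: Hom_def)

lemma TensA_merge_reassoc [simp]:
  "\<lbrakk>f \<in> Arr C; g \<in> Arr C; f' \<in> Arr C; g' \<in> Arr C; Cod C f = Dom C g; Cod C f' = Dom C g';
     h \<in> Arr C; Cod C h = Dom C f \<otimes>\<^sub>o Dom C f'\<rbrakk>
    \<Longrightarrow> (g \<otimes>\<^sub>a g') \<cdot> ((f \<otimes>\<^sub>a f') \<cdot> h) = ((g \<cdot> f) \<otimes>\<^sub>a (g' \<cdot> f')) \<cdot> h"
  using TensA_merge[of f g f' g'] Comp_reassoc[of "g \<otimes>\<^sub>a g'" "f \<otimes>\<^sub>a f'" _ h] by simp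

lemma Assoc_nat:
  "\<lbrakk>f \<in> Arr C; g \<in> Arr C; h \<in> Arr C\<rbrakk> \<Longrightarrow>
    Assoc C (Cod C f) (Cod C g) (Cod C h) \<cdot> ((f \<otimes>\<^sub>a g) \<otimes>\<^sub>a h)
      = (f \<otimes>\<^sub>a (g \<otimes>\<^sub>a h)) \<cdot> Assoc C (Dom C f) (Dom C g) (Dom C h)"
  using Assoc_natural Arr_in_Hom by metis

lemma Lunit_nat: "f \<in> Arr C \<Longrightarrow> Lunit C (Cod C f) \<cdot> (Id C (Unit C) \<otimes>\<^sub>a f) = f \<cdot> Lunit C (Dom C f)"
  using Lunit_natural Arr_in_Hom by metis

lemma Runit_nat: "f \<in> Arr C \<Longrightarrow> Runit C (Cod C f) \<cdot> (f \<otimes>\<^sub>a Id C (Unit C)) = f \<cdot> Runit C (Dom C f)"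
  using Runit_natural Arr_in_Hom by metis

lemma inv_arr_simps:
  assumes "iso_arr C f"
  shows "f \<in> Arr C" "inv_arr C f \<in> Arr C" "Dom C (inv_arr C f) = Cod C f" "Cod C (inv_arr C f) = Dom C f"
    "f \<cdot> inv_arr C f = Id C (Cod C f)" "inv_arr C f \<cdot> f = Id C (Dom C f)"
  using inverse_arrs_inv_arr[OF assms] by (auto simp: inverse_arrs_def Hom_def)

lemma iso_arrI:
  assumes "f \<in> Arr C" "g \<in> Arr C" "Dom C g = Cod C f" "Cod C g = Dom C f"
    "g \<cdot> f = Id C (Dom C f)" "f \<cdot> g = Id C (Cod C f)"
  shows "iso_arr C f"
  using assms unfolding iso_arr_def inverse_arrs_def by (auto simp: Hom_def)

lemma iso_Comp:
  assumes "iso_arr C f" "iso_arr C g" "Cod C f = Dom C g"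
  shows "iso_arr C (g \<cdot> f)"
proof -
  note [simp] = inv_arr_simps[OF assms(1)] inv_arr_simps[OF assms(2)] assms(3)
  note E = inv_arr_simps(5,6)[OF assms(1)] inv_arr_simps(5,6)[OF assms(2)]
  show ?thesis
    by (rule iso_arrI[of _ "inv_arr C f \<cdot> inv_arr C g"]) (simp_all add: E[THEN Comp_reassoc])
qed

lemma iso_Id: "X \<in> Obj C \<Longrightarrow> iso_arr C (Id C X)"
  by (rule iso_arrI[of _ "Id C X"]) simp_all

lemma iso_TensA:
  assumes "iso_arr C f" "iso_arr C g"
  shows "iso_arr C (f \<otimes>\<^sub>a g)"
proof -
  note [simp] = inv_arr_simps[OF assms(1)] inv_arr_simps[OF assms(2)]
  show ?thesis
    by (rule iso_arrI[of _ "inv_arr C f \<otimes>\<^sub>a inv_arr C g"]) simp_all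
qed

lemma iso_inv_arr:
  assumes "iso_arr C f"
  shows "iso_arr C (inv_arr C f)"
  using inv_arr_simps[OF assms] by (intro iso_arrI[of _ f]) simp_all

lemma iso_cancel_right:
  assumes "iso_arr C f" "g \<cdot> f = h \<cdot> f" "g \<in> Arr C" "h \<in> Arr C" "Dom C g = Cod C f" "Dom C h = Cod C f"
  shows "g = h"
proof -
  note [simp] = inv_arr_simps[OF assms(1)]
  have "(g \<cdot> f) \<cdot> inv_arr C f = (h \<cdot> f) \<cdot> inv_arr C f"
    using assms(2) by simp
  then show ?thesis
    using assms(3-) by simp
qed

lemma iso_cancel_left:
  assumes "iso_arr C f" "f \<cdot> g = f \<cdot> h" "g \<in> Arr C" "h \<in> Arr C" "Cod C g = Dom C f" "Cod C h = Dom C f"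
  shows "g = h"
proof -
  note [simp] = inv_arr_simps[OF assms(1)]
  note E = inv_arr_simps(6)[OF assms(1), THEN Comp_reassoc]
  have "inv_arr C f \<cdot> (f \<cdot> g) = inv_arr C f \<cdot> (f \<cdot> h)"
    using assms(2) by simp
  then show ?thesis
    using assms(3-) by (simp add: E)
qed

text \<open>Naturality of \<open>Lunit\<close> conjugates tensoring with the unit to the identity
  functor, so it is faithful. Equations may therefore be proved with an extra unit in front, which
  gives the pentagon and the triangle room to apply.\<close>

lemma Unit_TensA_cancel:
  assumes "Id C (Unit C) \<otimes>\<^sub>a f = Id C (Unit C) \<otimes>\<^sub>a g" "f \<in> Arr C" "g \<in> Arr C"
    "Dom C f = Dom C g" "Cod C f = Cod C g"
  shows "f = g"
proof (rule iso_cancel_right[OF Lunit_iso[of "Dom C g"]])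
  show "f \<cdot> Lunit C (Dom C g) = g \<cdot> Lunit C (Dom C g)"
    using Lunit_nat[of f] Lunit_nat[of g] assms by simp
qed (use assms in simp_all)

lemma TensA_Unit_cancel:
  assumes "f \<otimes>\<^sub>a Id C (Unit C) = g \<otimes>\<^sub>a Id C (Unit C)" "f \<in> Arr C" "g \<in> Arr C"
    "Dom C f = Dom C g" "Cod C f = Cod C g"
  shows "f = g"
proof (rule iso_cancel_right[OF Runit_iso[of "Dom C g"]])
  show "f \<cdot> Runit C (Dom C g) = g \<cdot> Runit C (Dom C g)"
    using Runit_nat[of f] Runit_nat[of g] assms by simp
qed (use assms in simp_all)

lemma pentagon':
  assumes "W \<in> Obj C" "X \<in> Obj C" "Y \<in> Obj C" "Z \<in> Obj C"
  shows "(Id C W \<otimes>\<^sub>a Assoc C X Y Z) \<cdot> (Assoc C W (X \<otimes>\<^sub>o Y) Z \<cdot> (Assoc C W X Y \<otimes>\<^sub>a Id C Z))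
      = Assoc C W X (Y \<otimes>\<^sub>o Z) \<cdot> Assoc C (W \<otimes>\<^sub>o X) Y Z"
  using pentagon[OF assms] assms by simp

text \<open>Kelly's derivation of the unit coherences that are not among the axioms.\<close>

lemma Lunit_TensO:
  assumes [simp]: "X \<in> Obj C" "Y \<in> Obj C"
  shows "Lunit C (X \<otimes>\<^sub>o Y) \<cdot> Assoc C (Unit C) X Y = Lunit C X \<otimes>\<^sub>a Id C Y"
proof (rule Unit_TensA_cancel)
  let ?I = "Unit C" and ?a = "Assoc C"
  \<comment> \<open>The isomorphism to be cancelled completes the long side of the pentagon for two
    units, \<open>X\<close> and \<open>Y\<close>. The triangle is then used twice, at
    \<open>X \<otimes> Y\<close> and at \<open>X\<close>.\<close>
  show "Id C ?I \<otimes>\<^sub>a (Lunit C (X \<otimes>\<^sub>o Y) \<cdot> ?a ?I X Y) = Id C ?I \<otimes>\<^sub>a (Lunit C X \<otimes>\<^sub>a Id C Y)"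
  proof (rule iso_cancel_right[of "?a ?I (?I \<otimes>\<^sub>o X) Y \<cdot> (?a ?I ?I X \<otimes>\<^sub>a Id C Y)"])
    show "iso_arr C (?a ?I (?I \<otimes>\<^sub>o X) Y \<cdot> (?a ?I ?I X \<otimes>\<^sub>a Id C Y))"
      by (intro iso_Comp iso_TensA Assoc_iso iso_Id) simp_all
    have "(Id C ?I \<otimes>\<^sub>a (Lunit C (X \<otimes>\<^sub>o Y) \<cdot> ?a ?I X Y)) \<cdot> (?a ?I (?I \<otimes>\<^sub>o X) Y \<cdot> (?a ?I ?I X \<otimes>\<^sub>a Id C Y))
       = (Id C ?I \<otimes>\<^sub>a Lunit C (X \<otimes>\<^sub>o Y)) \<cdot> ((Id C ?I \<otimes>\<^sub>a ?a ?I X Y) \<cdot> (?a ?I (?I \<otimes>\<^sub>o X) Y \<cdot> (?a ?I ?I X \<otimes>\<^sub>a Id C Y)))"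
      by simp
    also have "\<dots> = (Id C ?I \<otimes>\<^sub>a Lunit C (X \<otimes>\<^sub>o Y)) \<cdot> (?a ?I ?I (X \<otimes>\<^sub>o Y) \<cdot> ?a (?I \<otimes>\<^sub>o ?I) X Y)"
      by (simp only: pentagon' Obj_simps assms)
    also have "\<dots> = (Runit C ?I \<otimes>\<^sub>a Id C (X \<otimes>\<^sub>o Y)) \<cdot> ?a (?I \<otimes>\<^sub>o ?I) X Y"
      using triangle[of ?I "X \<otimes>\<^sub>o Y", THEN Comp_reassoc] by simp
    also have "\<dots> = ?a ?I X Y \<cdot> ((Runit C ?I \<otimes>\<^sub>a Id C X) \<otimes>\<^sub>a Id C Y)"
      using Assoc_nat[of "Runit C ?I" "Id C X" "Id C Y"] by simp
    also have "\<dots> = ?a ?I X Y \<cdot> (((Id C ?I \<otimes>\<^sub>a Lunit C X) \<otimes>\<^sub>a Id C Y) \<cdot> (?a ?I ?I X \<otimes>\<^sub>a Id C Y))"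
      using triangle[of ?I X] by simp
    also have "\<dots> = (Id C ?I \<otimes>\<^sub>a (Lunit C X \<otimes>\<^sub>a Id C Y)) \<cdot> (?a ?I (?I \<otimes>\<^sub>o X) Y \<cdot> (?a ?I ?I X \<otimes>\<^sub>a Id C Y))"
      using Assoc_nat[of "Id C ?I" "Lunit C X" "Id C Y", THEN Comp_reassoc, of "?a ?I ?I X \<otimes>\<^sub>a Id C Y"]
      by (simp del: TensA_merge)
    finally show "(Id C ?I \<otimes>\<^sub>a (Lunit C (X \<otimes>\<^sub>o Y) \<cdot> ?a ?I X Y)) \<cdot> (?a ?I (?I \<otimes>\<^sub>o X) Y \<cdot> (?a ?I ?I X \<otimes>\<^sub>a Id C Y))
      = \<dots>" .
  qed simp_all
qed simp_all

text \<open>The mirror image: the pentagon for \<open>X\<close>, \<open>Y\<close> and two units,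
  with the triangle at \<open>Y\<close> and at \<open>X \<otimes> Y\<close>.\<close>

lemma Runit_TensO:
  assumes [simp]: "X \<in> Obj C" "Y \<in> Obj C"
  shows "(Id C X \<otimes>\<^sub>a Runit C Y) \<cdot> Assoc C X Y (Unit C) = Runit C (X \<otimes>\<^sub>o Y)"
proof (rule TensA_Unit_cancel)
  let ?I = "Unit C" and ?a = "Assoc C"
  show "((Id C X \<otimes>\<^sub>a Runit C Y) \<cdot> ?a X Y ?I) \<otimes>\<^sub>a Id C ?I = Runit C (X \<otimes>\<^sub>o Y) \<otimes>\<^sub>a Id C ?I"
  proof (rule iso_cancel_left[OF Assoc_iso[of X Y ?I]])
    have "?a X Y ?I \<cdot> (((Id C X \<otimes>\<^sub>a Runit C Y) \<cdot> ?a X Y ?I) \<otimes>\<^sub>a Id C ?I)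
      = ?a X Y ?I \<cdot> (((Id C X \<otimes>\<^sub>a Runit C Y) \<otimes>\<^sub>a Id C ?I) \<cdot> (?a X Y ?I \<otimes>\<^sub>a Id C ?I))"
      by simp
    also have "\<dots> = (Id C X \<otimes>\<^sub>a (Runit C Y \<otimes>\<^sub>a Id C ?I)) \<cdot> (?a X (Y \<otimes>\<^sub>o ?I) ?I \<cdot> (?a X Y ?I \<otimes>\<^sub>a Id C ?I))"
      using Assoc_nat[of "Id C X" "Runit C Y" "Id C ?I", THEN Comp_reassoc, of "?a X Y ?I \<otimes>\<^sub>a Id C ?I"]
      by (simp del: TensA_merge)
    also have "\<dots> = (Id C X \<otimes>\<^sub>a (Id C Y \<otimes>\<^sub>a Lunit C ?I)) \<cdot>
        ((Id C X \<otimes>\<^sub>a ?a Y ?I ?I) \<cdot> (?a X (Y \<otimes>\<^sub>o ?I) ?I \<cdot> (?a X Y ?I \<otimes>\<^sub>a Id C ?I)))"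
      using triangle[of Y ?I] by simp
    also have "\<dots> = (Id C X \<otimes>\<^sub>a (Id C Y \<otimes>\<^sub>a Lunit C ?I)) \<cdot> (?a X Y (?I \<otimes>\<^sub>o ?I) \<cdot> ?a (X \<otimes>\<^sub>o Y) ?I ?I)"
      by (simp only: pentagon' Obj_simps assms)
    also have "\<dots> = ?a X Y ?I \<cdot> ((Id C (X \<otimes>\<^sub>o Y) \<otimes>\<^sub>a Lunit C ?I) \<cdot> ?a (X \<otimes>\<^sub>o Y) ?I ?I)"
      using Assoc_nat[of "Id C X" "Id C Y" "Lunit C ?I", symmetric, THEN Comp_reassoc, of "?a (X \<otimes>\<^sub>o Y) ?I ?I"]
      by simp
    also have "\<dots> = ?a X Y ?I \<cdot> (Runit C (X \<otimes>\<^sub>o Y) \<otimes>\<^sub>a Id C ?I)"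
      using triangle[of "X \<otimes>\<^sub>o Y" ?I] by simp
    finally show "?a X Y ?I \<cdot> (((Id C X \<otimes>\<^sub>a Runit C Y) \<cdot> ?a X Y ?I) \<otimes>\<^sub>a Id C ?I) = \<dots>" .
  qed simp_all
qed simp_all

text \<open>Naturality of \<open>Lunit\<close> at its own component on the unit shows that the left
  unitor of \<open>1 \<otimes> 1\<close> is \<open>1\<close> tensored with that component. With
  this, \<open>Lunit_TensO\<close> and the triangle express both unitors, tensored with the unit, by
  the same composite.\<close>

lemma Lunit_Unit: "Lunit C (Unit C) = Runit C (Unit C)"
proof (rule TensA_Unit_cancel)
  let ?I = "Unit C"
  have "Lunit C (?I \<otimes>\<^sub>o ?I) = Id C ?I \<otimes>\<^sub>a Lunit C ?I"
    by (rule iso_cancel_left[OF Lunit_iso[of ?I]]) (use Lunit_nat[of "Lunit C ?I"] in simp_all)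
  then show "Lunit C ?I \<otimes>\<^sub>a Id C ?I = Runit C ?I \<otimes>\<^sub>a Id C ?I"
    using Lunit_TensO[of ?I ?I] triangle[of ?I ?I] by simp
qed simp_all

end

section \<open>Strictification\<close>

text \<open>A one-letter word evaluates to the letter itself, not to its product with the unit.
  Duals of \<open>X\<close> and of the word \<open>[X]\<close> can thus be compared without unitors;
  the price is the case distinction in \<open>word_Cons\<close>.\<close>

primrec word_obj :: "('o, 'a, 'm) preadd_mon_cat_scheme \<Rightarrow> 'o list \<Rightarrow> 'o" where
  "word_obj C [] = Unit C"
| "word_obj C (X # u) = (if u = [] then X else X \<otimes>\<^sub>o\<^bsub>C\<^esub> word_obj C u)"

definition word_Cons :: "('o, 'a, 'm) preadd_mon_cat_scheme \<Rightarrow> 'o \<Rightarrow> 'o list \<Rightarrow> 'a" where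
  "word_Cons C X u = (if u = [] then Runit C X else Id C (X \<otimes>\<^sub>o\<^bsub>C\<^esub> word_obj C u))"

text \<open>The comparison isomorphism \<open>word_obj C u \<otimes> word_obj C v \<rightarrow>
  word_obj C (u @ v)\<close>, which is the monoidal structure of the evaluation of words.\<close>

primrec word_append :: "('o, 'a, 'm) preadd_mon_cat_scheme \<Rightarrow> 'o list \<Rightarrow> 'o list \<Rightarrow> 'a" where
  "word_append C [] v = Lunit C (word_obj C v)"
| "word_append C (X # u) v = word_Cons C X (u @ v) \<cdot>\<^bsub>C\<^esub> ((Id C X \<otimes>\<^sub>a\<^bsub>C\<^esub> word_append C u v) \<cdot>\<^bsub>C\<^esub>
     (Assoc C X (word_obj C u) (word_obj C v) \<cdot>\<^bsub>C\<^esub>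
       (inv_arr C (word_Cons C X u) \<otimes>\<^sub>a\<^bsub>C\<^esub> Id C (word_obj C v))))"

text \<open>The strictification: an arrow between words carries its domain and codomain, because
  \<^const>\<open>word_obj\<close> is not injective.\<close>

definition word_cat :: "('o, 'a, 'm) preadd_mon_cat_scheme \<Rightarrow>
    ('o list, 'o list \<times> 'a \<times> 'o list) preadd_mon_cat" where
  "word_cat C = \<lparr>
     Obj = lists (Obj C),
     Arr = {(u, f, v). u \<in> lists (Obj C) \<and> v \<in> lists (Obj C) \<and> f \<in> Hom C (word_obj C u) (word_obj C v)},
     Dom = (\<lambda>(u, f, v). u),
     Cod = (\<lambda>(u, f, v). v),
     Id = (\<lambda>u. (u, Id C (word_obj C u), u)),
     Comp = (\<lambda>(v', g, w) (u, f, v). (u, g \<cdot>\<^bsub>C\<^esub> f, w)),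
     Add = (\<lambda>(u, f, v) (u', g, v'). (u, f \<boxplus>\<^bsub>C\<^esub> g, v)),
     Zero = (\<lambda>u v. (u, Zero C (word_obj C u) (word_obj C v), v)),
     TensO = (@),
     TensA = (\<lambda>(u, f, u') (v, g, v').
       (u @ v, word_append C u' v' \<cdot>\<^bsub>C\<^esub> ((f \<otimes>\<^sub>a\<^bsub>C\<^esub> g) \<cdot>\<^bsub>C\<^esub> inv_arr C (word_append C u v)), u' @ v')),
     Unit = [],
     Assoc = (\<lambda>u v w. (u @ v @ w, Id C (word_obj C (u @ v @ w)), u @ v @ w)),
     Lunit = (\<lambda>u. (u, Id C (word_obj C u), u)),
     Runit = (\<lambda>u. (u, Id C (word_obj C u), u))\<rparr>"

context monoidal_category
begin

lemma word_obj_Obj [simp]: "u \<in> lists (Obj C) \<Longrightarrow> word_obj C u \<in> Obj C"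
  by (induction u) auto

lemma iso_word_Cons: "\<lbrakk>X \<in> Obj C; u \<in> lists (Obj C)\<rbrakk> \<Longrightarrow> iso_arr C (word_Cons C X u)"
  by (simp add: word_Cons_def Runit_iso iso_Id)

lemma word_Cons_simps [simp]:
  "\<lbrakk>X \<in> Obj C; u \<in> lists (Obj C)\<rbrakk> \<Longrightarrow> word_Cons C X u \<in> Arr C"
  "\<lbrakk>X \<in> Obj C; u \<in> lists (Obj C)\<rbrakk> \<Longrightarrow> Dom C (word_Cons C X u) = X \<otimes>\<^sub>o word_obj C u"
  "\<lbrakk>X \<in> Obj C; u \<in> lists (Obj C)\<rbrakk> \<Longrightarrow> Cod C (word_Cons C X u) = word_obj C (X # u)"
  by (auto simp: word_Cons_def)

lemma iso_word_append:
  "\<lbrakk>u \<in> lists (Obj C); v \<in> lists (Obj C)\<rbrakk> \<Longrightarrow> iso_arr C (word_append C u v) \<and>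
    Dom C (word_append C u v) = word_obj C u \<otimes>\<^sub>o word_obj C v \<and> Cod C (word_append C u v) = word_obj C (u @ v)"
proof (induction u)
  case Nil
  then show ?case
    by (simp add: Lunit_iso)
next
  case (Cons X u)
  then have [simp]: "X \<in> Obj C" "u \<in> lists (Obj C)" "v \<in> lists (Obj C)"
    by auto
  have IH: "iso_arr C (word_append C u v)" "Dom C (word_append C u v) = word_obj C u \<otimes>\<^sub>o word_obj C v"
    "Cod C (word_append C u v) = word_obj C (u @ v)"
    using Cons by auto
  note [simp] = inv_arr_simps[OF IH(1)] IH inv_arr_simps[OF iso_word_Cons[of X u]]
  have "iso_arr C (word_append C (X # u) v)"
    unfolding word_append.simps
    by (intro iso_Comp iso_TensA Assoc_iso iso_Id iso_inv_arr iso_word_Cons IH(1)) (simp_all del: word_obj.simps)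
  then show ?case
    by (simp del: word_obj.simps)
qed

lemma word_append_simps [simp]:
  assumes "u \<in> lists (Obj C)" "v \<in> lists (Obj C)"
  shows "word_append C u v \<in> Arr C"
    "Dom C (word_append C u v) = word_obj C u \<otimes>\<^sub>o word_obj C v"
    "Cod C (word_append C u v) = word_obj C (u @ v)"
    "inv_arr C (word_append C u v) \<in> Arr C"
    "Dom C (inv_arr C (word_append C u v)) = word_obj C (u @ v)"
    "Cod C (inv_arr C (word_append C u v)) = word_obj C u \<otimes>\<^sub>o word_obj C v"
    "word_append C u v \<cdot> inv_arr C (word_append C u v) = Id C (word_obj C (u @ v))"
    "inv_arr C (word_append C u v) \<cdot> word_append C u v = Id C (word_obj C u \<otimes>\<^sub>o word_obj C v)"
  using iso_word_append[OF assms] inv_arr_simps[of "word_append C u v"] by auto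

lemmas word_append_inv_reassoc [simp] =
  word_append_simps(7)[THEN Comp_reassoc] word_append_simps(8)[THEN Comp_reassoc]

text \<open>The right unit law of the comparison, which the recursion on the left word does not
  show. It rests on \<open>Lunit_Unit\<close> for the empty word and on \<open>Runit_TensO\<close>
  for the induction step.\<close>

lemma word_append_Nil:
  assumes "u \<in> lists (Obj C)"
  shows "word_append C u [] = Runit C (word_obj C u)"
  using assms
proof (induction u)
  case Nil
  show ?case
    by (simp add: Lunit_Unit)
next
  case (Cons X u)
  then have [simp]: "X \<in> Obj C" "u \<in> lists (Obj C)" and IH: "word_append C u [] = Runit C (word_obj C u)"
    by auto
  note [simp del] = word_obj.simps(2)
  note J = inv_arr_simps[OF iso_word_Cons[of X u], simplified, simp]
  show ?case
    using Runit_TensO[of X "word_obj C u", THEN Comp_reassoc, of "inv_arr C (word_Cons C X u) \<otimes>\<^sub>a Id C (Unit C)"]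
      Runit_nat[of "inv_arr C (word_Cons C X u)"] J(5)[THEN Comp_reassoc]
    by (simp add: IH)
qed

text \<open>This coherence will make the tensor product of arrows between words strictly
  associative. The empty word uses \<open>Lunit_TensO\<close>; the induction step uses the pentagon
  for the first letter and the values of the three words.\<close>

lemma word_append_assoc:
  assumes "u \<in> lists (Obj C)" and [simp]: "v \<in> lists (Obj C)" "w \<in> lists (Obj C)"
  shows "word_append C (u @ v) w \<cdot> (word_append C u v \<otimes>\<^sub>a Id C (word_obj C w))
    = word_append C u (v @ w) \<cdot> ((Id C (word_obj C u) \<otimes>\<^sub>a word_append C v w) \<cdot>
        Assoc C (word_obj C u) (word_obj C v) (word_obj C w))"
  using assms(1)
proof (induction u)
  case Nil
  show ?case
    using Lunit_nat[of "word_append C v w"] Lunit_TensO[of "word_obj C v" "word_obj C w"]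
      Lunit_nat[of "word_append C v w", THEN Comp_reassoc, of "Assoc C (Unit C) (word_obj C v) (word_obj C w)"]
    by simp
next
  case (Cons X u)
  then have [simp]: "X \<in> Obj C" "u \<in> lists (Obj C)"
    by auto
  let ?o = "word_obj C" and ?m = "word_append C" and ?a = "Assoc C" and ?I = "Id C"
  note [simp del] = word_obj.simps(2) TensA_merge TensA_merge_reassoc
  define j where "j = inv_arr C (word_Cons C X u)"
  note J = inv_arr_simps[OF iso_word_Cons[of X u], simplified, folded j_def, simp]
  note J' = inv_arr_simps[OF iso_word_Cons[of X "u @ v"], simplified, simp]
  have IH: "?m (u @ v) w \<cdot> (?m u v \<otimes>\<^sub>a ?I (?o w)) = ?m u (v @ w) \<cdot> ((?I (?o u) \<otimes>\<^sub>a ?m v w) \<cdot> ?a (?o u) (?o v) (?o w))"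
    using Cons by auto
  let ?J = "word_Cons C X (u @ v @ w)"
  let ?R = "(j \<otimes>\<^sub>a ?I (?o v)) \<otimes>\<^sub>a ?I (?o w)"
  have "?m ((X # u) @ v) w \<cdot> (?m (X # u) v \<otimes>\<^sub>a ?I (?o w))
    = ?J \<cdot> ((?I X \<otimes>\<^sub>a ?m (u @ v) w) \<cdot> (?a X (?o (u @ v)) (?o w) \<cdot>
       ((inv_arr C (word_Cons C X (u @ v)) \<cdot> (word_Cons C X (u @ v) \<cdot> ((?I X \<otimes>\<^sub>a ?m u v) \<cdot> (?a X (?o u) (?o v) \<cdot> (j \<otimes>\<^sub>a ?I (?o v))))))
          \<otimes>\<^sub>a ?I (?o w))))"
    by (simp add: j_def[symmetric] TensA_merge)
  \<comment> \<open>The comparison for \<open>X # (u @ v)\<close> meets its inverse and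
    disappears.\<close>
  also have "\<dots> = ?J \<cdot> ((?I X \<otimes>\<^sub>a ?m (u @ v) w) \<cdot> (?a X (?o (u @ v)) (?o w) \<cdot>
       (((?I X \<otimes>\<^sub>a ?m u v) \<otimes>\<^sub>a ?I (?o w)) \<cdot> ((?a X (?o u) (?o v) \<otimes>\<^sub>a ?I (?o w)) \<cdot> ?R))))"
    using J'(6)[THEN Comp_reassoc] by (simp add: TensA_merge)
  also have "\<dots> = ?J \<cdot> ((?I X \<otimes>\<^sub>a ?m (u @ v) w) \<cdot> ((?I X \<otimes>\<^sub>a (?m u v \<otimes>\<^sub>a ?I (?o w))) \<cdot>
       (?a X (?o u \<otimes>\<^sub>o ?o v) (?o w) \<cdot> ((?a X (?o u) (?o v) \<otimes>\<^sub>a ?I (?o w)) \<cdot> ?R))))"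
    using Assoc_nat[of "?I X" "?m u v" "?I (?o w)", THEN Comp_reassoc] by simp
  also have "\<dots> = ?J \<cdot> ((?I X \<otimes>\<^sub>a (?m (u @ v) w \<cdot> (?m u v \<otimes>\<^sub>a ?I (?o w)))) \<cdot>
       (?a X (?o u \<otimes>\<^sub>o ?o v) (?o w) \<cdot> ((?a X (?o u) (?o v) \<otimes>\<^sub>a ?I (?o w)) \<cdot> ?R)))"
    by (simp add: TensA_merge_reassoc)
  also have "\<dots> = ?J \<cdot> ((?I X \<otimes>\<^sub>a ?m u (v @ w)) \<cdot> ((?I X \<otimes>\<^sub>a (?I (?o u) \<otimes>\<^sub>a ?m v w)) \<cdot>
       (((?I X \<otimes>\<^sub>a ?a (?o u) (?o v) (?o w)) \<cdot>
         (?a X (?o u \<otimes>\<^sub>o ?o v) (?o w) \<cdot> (?a X (?o u) (?o v) \<otimes>\<^sub>a ?I (?o w)))) \<cdot> ?R)))"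
    unfolding IH by (simp add: TensA_merge_reassoc)
  \<comment> \<open>The inner bracket was arranged as the long side of the pentagon and is replaced
    by the short one.\<close>
  also have "\<dots> = ?J \<cdot> ((?I X \<otimes>\<^sub>a ?m u (v @ w)) \<cdot> ((?I X \<otimes>\<^sub>a (?I (?o u) \<otimes>\<^sub>a ?m v w)) \<cdot>
       ((?a X (?o u) (?o v \<otimes>\<^sub>o ?o w) \<cdot> ?a (X \<otimes>\<^sub>o ?o u) (?o v) (?o w)) \<cdot> ?R)))"
    by (simp only: pentagon' word_obj_Obj \<open>X \<in> Obj C\<close> \<open>u \<in> lists (Obj C)\<close> assms(2,3))
  also have "\<dots> = ?J \<cdot> ((?I X \<otimes>\<^sub>a ?m u (v @ w)) \<cdot> ((?I X \<otimes>\<^sub>a (?I (?o u) \<otimes>\<^sub>a ?m v w)) \<cdot>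
       (?a X (?o u) (?o v \<otimes>\<^sub>o ?o w) \<cdot> ((j \<otimes>\<^sub>a ?I (?o v \<otimes>\<^sub>o ?o w)) \<cdot> ?a (?o (X # u)) (?o v) (?o w)))))"
    using Assoc_nat[of j "?I (?o v)" "?I (?o w)"] by simp
  also have "\<dots> = ?J \<cdot> ((?I X \<otimes>\<^sub>a ?m u (v @ w)) \<cdot> (?a X (?o u) (?o (v @ w)) \<cdot>
       ((?I (X \<otimes>\<^sub>o ?o u) \<otimes>\<^sub>a ?m v w) \<cdot> ((j \<otimes>\<^sub>a ?I (?o v \<otimes>\<^sub>o ?o w)) \<cdot> ?a (?o (X # u)) (?o v) (?o w)))))"
    using Assoc_nat[of "?I X" "?I (?o u)" "?m v w", THEN Comp_reassoc] by simp
  also have "\<dots> = ?m (X # u) (v @ w) \<cdot> ((?I (?o (X # u)) \<otimes>\<^sub>a ?m v w) \<cdot> ?a (?o (X # u)) (?o v) (?o w))"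
    by (simp add: j_def[symmetric] TensA_merge_reassoc)
  finally show ?case .
qed

end

section \<open>Arrows and universal properties of the word category\<close>

lemma word_cat_simps [simp]:
  "Obj (word_cat C) = lists (Obj C)"
  "Dom (word_cat C) (u, f, v) = u"
  "Cod (word_cat C) (u, f, v) = v"
  "Id (word_cat C) u = (u, Id C (word_obj C u), u)"
  "(v', g, w) \<cdot>\<^bsub>word_cat C\<^esub> (u, f, v) = (u, g \<cdot>\<^bsub>C\<^esub> f, w)"
  "(u, f, v) \<boxplus>\<^bsub>word_cat C\<^esub> (u', h, w') = (u, f \<boxplus>\<^bsub>C\<^esub> h, v)"
  "Zero (word_cat C) u v = (u, Zero C (word_obj C u) (word_obj C v), v)"
  "u \<otimes>\<^sub>o\<^bsub>word_cat C\<^esub> v = u @ v"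
  "(u, f, u') \<otimes>\<^sub>a\<^bsub>word_cat C\<^esub> (v, g, v') =
    (u @ v, word_append C u' v' \<cdot>\<^bsub>C\<^esub> ((f \<otimes>\<^sub>a\<^bsub>C\<^esub> g) \<cdot>\<^bsub>C\<^esub> inv_arr C (word_append C u v)), u' @ v')"
  "Unit (word_cat C) = []"
  by (simp_all add: word_cat_def)

lemma Arr_word_cat [simp]:
  "(u, f, v) \<in> Arr (word_cat C) \<longleftrightarrow>
    u \<in> lists (Obj C) \<and> v \<in> lists (Obj C) \<and> f \<in> Hom C (word_obj C u) (word_obj C v)"
  by (simp add: word_cat_def)

lemma Hom_word_cat [simp]:
  "(u, f, v) \<in> Hom (word_cat C) u' v' \<longleftrightarrow>
    u = u' \<and> v = v' \<and> u \<in> lists (Obj C) \<and> v \<in> lists (Obj C) \<and> f \<in> Hom C (word_obj C u) (word_obj C v)"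
  by (auto simp: Hom_def[of "word_cat C"])

lemma Hom_word_catE:
  assumes "x \<in> Hom (word_cat C) u v"
  obtains f where "x = (u, f, v)" "u \<in> lists (Obj C)" "v \<in> lists (Obj C)" "f \<in> Hom C (word_obj C u) (word_obj C v)"
  using assms by (cases x) auto

lemma Arr_word_catE:
  assumes "x \<in> Arr (word_cat C)"
  obtains u f v where "x = (u, f, v)" "u \<in> lists (Obj C)" "v \<in> lists (Obj C)" "f \<in> Hom C (word_obj C u) (word_obj C v)"
  using assms by (cases x) auto

lemma Ball_Hom_word_cat:
  "(\<forall>x \<in> Hom (word_cat C) u v. P x) \<longleftrightarrow>
    (u \<in> lists (Obj C) \<longrightarrow> v \<in> lists (Obj C) \<longrightarrow> (\<forall>f \<in> Hom C (word_obj C u) (word_obj C v). P (u, f, v)))"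
  by (auto elim: Hom_word_catE)

lemma Ex1_Hom_word_cat:
  assumes "u \<in> lists (Obj C)" "v \<in> lists (Obj C)"
  shows "(\<exists>!x. x \<in> Hom (word_cat C) u v \<and> P x) \<longleftrightarrow>
    (\<exists>!f. f \<in> Hom C (word_obj C u) (word_obj C v) \<and> P (u, f, v))"
proof -
  have "x \<in> Hom (word_cat C) u v \<and> P x \<longleftrightarrow>
      (\<exists>f. x = (u, f, v) \<and> f \<in> Hom C (word_obj C u) (word_obj C v) \<and> P (u, f, v))" for x
    using assms by (auto elim: Hom_word_catE)
  then show ?thesis
    by auto
qed

context monoidal_category
begin

text \<open>Every object is the value of a one-letter word, so testing against all words is testing
  against all objects. As the hom sets correspond too, monos, epis, kernels and cokernels are the
  same in both categories.\<close>

lemma Ball_lists_word_obj: "(\<forall>w \<in> lists (Obj C). P (word_obj C w)) \<longleftrightarrow> (\<forall>X \<in> Obj C. P X)"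
proof
  assume P: "\<forall>w \<in> lists (Obj C). P (word_obj C w)"
  show "\<forall>X \<in> Obj C. P X"
    using bspec[OF P, of "[X]" for X] by simp
qed simp

lemma category_word_cat: "category (word_cat C)"
proof
  fix x assume "x \<in> Arr (word_cat C)"
  then show "Dom (word_cat C) x \<in> Obj (word_cat C)" "Cod (word_cat C) x \<in> Obj (word_cat C)"
    by (auto elim: Arr_word_catE)
next
  fix u assume "u \<in> Obj (word_cat C)"
  then show "Id (word_cat C) u \<in> Hom (word_cat C) u u"
    using Id_in_Hom by simp
next
  fix x y u v w assume "x \<in> Hom (word_cat C) u v" "y \<in> Hom (word_cat C) v w"
  then show "y \<cdot>\<^bsub>word_cat C\<^esub> x \<in> Hom (word_cat C) u w"
    using Comp_in_Hom by (auto elim!: Hom_word_catE)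
next
  fix x u v assume "x \<in> Hom (word_cat C) u v"
  then show "Id (word_cat C) v \<cdot>\<^bsub>word_cat C\<^esub> x = x" "x \<cdot>\<^bsub>word_cat C\<^esub> Id (word_cat C) u = x"
    using Comp_Id_left Comp_Id_right by (auto elim!: Hom_word_catE)
next
  fix x y z u v w s
  assume "x \<in> Hom (word_cat C) s u" "y \<in> Hom (word_cat C) u v" "z \<in> Hom (word_cat C) v w"
  then show "z \<cdot>\<^bsub>word_cat C\<^esub> y \<cdot>\<^bsub>word_cat C\<^esub> x = z \<cdot>\<^bsub>word_cat C\<^esub> (y \<cdot>\<^bsub>word_cat C\<^esub> x)"
    using Comp_assoc by (auto elim!: Hom_word_catE)
qed

lemma mono_word_cat:
  assumes "u \<in> lists (Obj C)" "v \<in> lists (Obj C)" "f \<in> Hom C (word_obj C u) (word_obj C v)"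
  shows "mono_arr (word_cat C) (u, f, v) \<longleftrightarrow> mono_arr C f"
  using assms HomD[OF assms(3)]
    Ball_lists_word_obj[of "\<lambda>W. \<forall>g \<in> Hom C W (word_obj C u). \<forall>h \<in> Hom C W (word_obj C u). f \<cdot> g = f \<cdot> h \<longrightarrow> g = h"]
  by (simp add: mono_arr_def Ball_Hom_word_cat)

lemma epi_word_cat:
  assumes "u \<in> lists (Obj C)" "v \<in> lists (Obj C)" "f \<in> Hom C (word_obj C u) (word_obj C v)"
  shows "epi_arr (word_cat C) (u, f, v) \<longleftrightarrow> epi_arr C f"
  using assms HomD[OF assms(3)]
    Ball_lists_word_obj[of "\<lambda>W. \<forall>g \<in> Hom C (word_obj C v) W. \<forall>h \<in> Hom C (word_obj C v) W. g \<cdot> f = h \<cdot> f \<longrightarrow> g = h"]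
  by (simp add: epi_arr_def Ball_Hom_word_cat)

lemma kernel_word_cat:
  assumes "u \<in> lists (Obj C)" "v \<in> lists (Obj C)" "w \<in> lists (Obj C)"
    "k \<in> Hom C (word_obj C u) (word_obj C v)" "f \<in> Hom C (word_obj C v) (word_obj C w)"
  shows "kernel_arr (word_cat C) (u, k, v) (v, f, w) \<longleftrightarrow> kernel_arr C k f"
  using assms HomD[OF assms(4)] HomD[OF assms(5)]
    Ball_lists_word_obj[of "\<lambda>W. \<forall>g \<in> Hom C W (word_obj C v). f \<cdot> g = Zero C W (word_obj C w) \<longrightarrow>
      (\<exists>!h. h \<in> Hom C W (word_obj C u) \<and> k \<cdot> h = g)"]
  by (simp add: kernel_arr_def Ball_Hom_word_cat Ex1_Hom_word_cat)

lemma cokernel_word_cat: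
  assumes "u \<in> lists (Obj C)" "v \<in> lists (Obj C)" "w \<in> lists (Obj C)"
    "q \<in> Hom C (word_obj C v) (word_obj C w)" "f \<in> Hom C (word_obj C u) (word_obj C v)"
  shows "cokernel_arr (word_cat C) (v, q, w) (u, f, v) \<longleftrightarrow> cokernel_arr C q f"
  using assms HomD[OF assms(4)] HomD[OF assms(5)]
    Ball_lists_word_obj[of "\<lambda>W. \<forall>g \<in> Hom C (word_obj C v) W. g \<cdot> f = Zero C (word_obj C u) W \<longrightarrow>
      (\<exists>!h. h \<in> Hom C (word_obj C w) W \<and> h \<cdot> q = g)"]
  by (simp add: cokernel_arr_def Ball_Hom_word_cat Ex1_Hom_word_cat)

end

section \<open>Abelian and strict monoidal structure on words; comparison of duals\<close>

context abelian_monoidal_category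
begin

lemma preadditive_word_cat: "preadditive_category (word_cat C)"
proof -
  show ?thesis
  proof (intro preadditive_category.intro preadditive_category_axioms.intro category_word_cat)
    fix u v assume "u \<in> Obj (word_cat C)" "v \<in> Obj (word_cat C)"
    then have uv [simp]: "u \<in> lists (Obj C)" "v \<in> lists (Obj C)"
      by auto
    then have O: "word_obj C u \<in> Obj C" "word_obj C v \<in> Obj C"
      by simp_all
    let ?G = "\<lparr>carrier = Hom (word_cat C) u v, monoid.mult = Add (word_cat C), one = Zero (word_cat C) u v\<rparr>"
    show "comm_group ?G"
    proof (rule comm_groupI)
      fix x y z assume "x \<in> carrier ?G" "y \<in> carrier ?G" "z \<in> carrier ?G"
      then show "x \<otimes>\<^bsub>?G\<^esub> y \<otimes>\<^bsub>?G\<^esub> z = x \<otimes>\<^bsub>?G\<^esub> (y \<otimes>\<^bsub>?G\<^esub> z)"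
        using Add_assoc by (auto elim!: Hom_word_catE)
    next
      fix x y assume xy: "x \<in> carrier ?G" "y \<in> carrier ?G"
      then show "x \<otimes>\<^bsub>?G\<^esub> y \<in> carrier ?G"
        using Add_in_Hom by (auto elim!: Hom_word_catE)
      show "x \<otimes>\<^bsub>?G\<^esub> y = y \<otimes>\<^bsub>?G\<^esub> x"
        using xy Add_commute by (auto elim!: Hom_word_catE)
    next
      show "\<one>\<^bsub>?G\<^esub> \<in> carrier ?G"
        using Zero_in_Hom[OF O] by simp
    next
      fix x assume "x \<in> carrier ?G"
      then show "\<one>\<^bsub>?G\<^esub> \<otimes>\<^bsub>?G\<^esub> x = x"
        using Add_Zero(1) by (auto elim!: Hom_word_catE)
    next
      fix x assume "x \<in> carrier ?G"
      then obtain f where f: "x = (u, f, v)" "f \<in> Hom C (word_obj C u) (word_obj C v)"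
        by (auto elim: Hom_word_catE)
      obtain g where "g \<in> Hom C (word_obj C u) (word_obj C v)" "g \<boxplus> f = Zero C (word_obj C u) (word_obj C v)"
        using Add_diff_exists[OF Zero_in_Hom[OF O] f(2)] by metis
      then show "\<exists>y \<in> carrier ?G. y \<otimes>\<^bsub>?G\<^esub> x = \<one>\<^bsub>?G\<^esub>"
        using f by (intro bexI[of _ "(u, g, v)"]) simp_all
    qed
  next
    fix x y z u v w
    assume "x \<in> Hom (word_cat C) u v" "y \<in> Hom (word_cat C) v w" "z \<in> Hom (word_cat C) v w"
    then show "(y \<boxplus>\<^bsub>word_cat C\<^esub> z) \<cdot>\<^bsub>word_cat C\<^esub> x = (y \<cdot>\<^bsub>word_cat C\<^esub> x) \<boxplus>\<^bsub>word_cat C\<^esub> (z \<cdot>\<^bsub>word_cat C\<^esub> x)"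
      using Comp_Add_left by (auto elim!: Hom_word_catE)
  next
    fix x y z u v w
    assume "x \<in> Hom (word_cat C) u v" "y \<in> Hom (word_cat C) u v" "z \<in> Hom (word_cat C) v w"
    then show "z \<cdot>\<^bsub>word_cat C\<^esub> (x \<boxplus>\<^bsub>word_cat C\<^esub> y) = (z \<cdot>\<^bsub>word_cat C\<^esub> x) \<boxplus>\<^bsub>word_cat C\<^esub> (z \<cdot>\<^bsub>word_cat C\<^esub> y)"
      using Comp_Add_right by (auto elim!: Hom_word_catE)
  qed
qed

text \<open>Zero objects, biproducts, kernels and cokernels are those of \<open>C\<close>, placed on
  one-letter words.\<close>

lemma abelian_word_cat: "abelian_category (word_cat C)"
proof -
  interpret W: preadditive_category "word_cat C"
    by (rule preadditive_word_cat)
  show ?thesis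
  proof
    obtain Z where Z: "zero_object C Z"
      using ex_zero_object by blast
    have "(\<exists>!x. x \<in> Hom (word_cat C) u [Z]) \<and> (\<exists>!x. x \<in> Hom (word_cat C) [Z] u)" if "u \<in> lists (Obj C)" for u
      using that Z word_obj_Obj[OF that] Ex1_Hom_word_cat[of u C "[Z]" "\<lambda>_. True"]
        Ex1_Hom_word_cat[of "[Z]" C u "\<lambda>_. True"] by (simp add: zero_object_def)
    then have "zero_object (word_cat C) [Z]"
      using Z by (simp add: zero_object_def del: in_lists_conv_set)
    then show "\<exists>z. zero_object (word_cat C) z"
      by blast
  next
    fix u v assume "u \<in> Obj (word_cat C)" "v \<in> Obj (word_cat C)"
    then have uv: "u \<in> lists (Obj C)" "v \<in> lists (Obj C)"
      by auto
    then obtain P i j p q where b: "biproduct C (word_obj C u) (word_obj C v) P i j p q"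
      using ex_biproduct word_obj_Obj by meson
    then have "P \<in> Obj C"
      using Hom_Obj by (auto simp: biproduct_def)
    then have "biproduct (word_cat C) u v [P] (u, i, [P]) (v, j, [P]) ([P], p, u) ([P], q, v)"
      using b uv by (simp add: biproduct_def)
    then show "\<exists>P i j p q. biproduct (word_cat C) u v P i j p q"
      by blast
  next
    fix x assume "x \<in> Arr (word_cat C)"
    then obtain u f v where x: "x = (u, f, v)" "u \<in> lists (Obj C)" "v \<in> lists (Obj C)"
      and f: "f \<in> Hom C (word_obj C u) (word_obj C v)"
      by (rule Arr_word_catE)
    obtain K k where k: "k \<in> Hom C K (word_obj C u)" "kernel_arr C k f"
      using kernel_exists[OF f] by metis
    then show "\<exists>k. kernel_arr (word_cat C) k x"
      using kernel_word_cat[of "[K]" u v k f] x f Hom_Obj[OF k(1)] by auto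
    obtain Q q where q: "q \<in> Hom C (word_obj C v) Q" "cokernel_arr C q f"
      using cokernel_exists[OF f] by metis
    then show "\<exists>q. cokernel_arr (word_cat C) q x"
      using cokernel_word_cat[of u v "[Q]" q f] x f Hom_Obj[OF q(1)] by auto
  next
    fix x assume m: "mono_arr (word_cat C) x"
    then have "x \<in> Arr (word_cat C)"
      by (simp add: mono_arr_def)
    then obtain u f v where x: "x = (u, f, v)" "u \<in> lists (Obj C)" "v \<in> lists (Obj C)"
      and f: "f \<in> Hom C (word_obj C u) (word_obj C v)"
      by (rule Arr_word_catE)
    then obtain g where g: "kernel_arr C f g"
      using m x f mono_word_cat[of u v f] mono_normal[of f] by auto
    then have "g \<in> Hom C (word_obj C v) (Cod C g)"
      using HomD[OF f] by (auto simp: kernel_arr_def Hom_def)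
    then show "\<exists>g. kernel_arr (word_cat C) x g"
      using kernel_word_cat[of u v "[Cod C g]" f g] x f g Hom_Obj[of g] by auto
  next
    fix x assume m: "epi_arr (word_cat C) x"
    then have "x \<in> Arr (word_cat C)"
      by (simp add: epi_arr_def)
    then obtain u f v where x: "x = (u, f, v)" "u \<in> lists (Obj C)" "v \<in> lists (Obj C)"
      and f: "f \<in> Hom C (word_obj C u) (word_obj C v)"
      by (rule Arr_word_catE)
    then obtain g where g: "cokernel_arr C f g"
      using m x f epi_word_cat[of u v f] epi_normal[of f] by auto
    then have "g \<in> Hom C (Dom C g) (word_obj C u)"
      using HomD[OF f] by (auto simp: cokernel_arr_def Hom_def)
    then show "\<exists>g. cokernel_arr (word_cat C) x g"
      using cokernel_word_cat[of "[Dom C g]" u v f g] x f g Hom_Obj[of g] by auto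
  qed
qed

text \<open>The tensor product of the word category is that of \<open>C\<close> conjugated by
  comparison isomorphisms, so cokernels have to be carried along such a conjugation.\<close>

lemma cokernel_conj_iso:
  assumes f: "f \<in> Hom C X Y" and q: "q \<in> Hom C Y Q" "cokernel_arr C q f"
    and a: "iso_arr C a" "Dom C a = X" and b: "iso_arr C b" "Dom C b = Y" and c: "iso_arr C c" "Dom C c = Q"
  shows "cokernel_arr C (c \<cdot> (q \<cdot> inv_arr C b)) (b \<cdot> (f \<cdot> inv_arr C a))"
proof -
  note [simp] = HomD[OF f] HomD[OF q(1)] inv_arr_simps[OF a(1)] inv_arr_simps[OF b(1)] inv_arr_simps[OF c(1)]
    a(2) b(2) c(2) Hom_Obj[OF f] Hom_Obj[OF q(1)]
  note E = inv_arr_simps(6)[OF b(1), THEN Comp_reassoc] inv_arr_simps(6)[OF c(1), THEN Comp_reassoc]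
    inv_arr_simps(5)[OF b(1), THEN Comp_reassoc]
  have aH: "inv_arr C a \<in> Hom C (Cod C a) X" and bH: "inv_arr C b \<in> Hom C (Cod C b) Y"
    and cH: "c \<in> Hom C Q (Cod C c)"
    by (simp_all add: Hom_def)
  have qf: "q \<cdot> f = Zero C X Q"
    using cokernel_arr_Zero[OF q(2,1) f] .
  show ?thesis
  proof (rule cokernel_arrI[of _ "Cod C a" "Cod C b" _ "Cod C c"])
    show "c \<cdot> (q \<cdot> inv_arr C b) \<cdot> (b \<cdot> (f \<cdot> inv_arr C a)) = Zero C (Cod C a) (Cod C c)"
      using Comp_Zero_left[OF _ aH, of Q] Comp_Zero_right[OF _ cH, of "Cod C a"]
      by (simp add: E qf[THEN Comp_reassoc])
  next
    show "epi_arr C (c \<cdot> (q \<cdot> inv_arr C b))"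
    proof (rule epi_arrI[of _ _ "Cod C b" "Cod C c"])
      fix W g h assume gh: "g \<in> Hom C (Cod C c) W" "h \<in> Hom C (Cod C c) W"
        "g \<cdot> (c \<cdot> (q \<cdot> inv_arr C b)) = h \<cdot> (c \<cdot> (q \<cdot> inv_arr C b))"
      note [simp] = HomD[OF gh(1)] HomD[OF gh(2)]
      have "(g \<cdot> c) \<cdot> q = (h \<cdot> c) \<cdot> q"
        by (rule iso_cancel_right[OF iso_inv_arr[OF b(1)]]) (use gh(3) in simp_all)
      moreover have "g \<cdot> c \<in> Hom C Q W" "h \<cdot> c \<in> Hom C Q W"
        by (simp_all add: Hom_def)
      ultimately have "g \<cdot> c = h \<cdot> c"
        using epi_arr_cancel[OF cokernel_arr_epi[OF q(2)] q(1)] by blast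
      then show "g = h"
        by (rule iso_cancel_right[OF c(1)]) simp_all
    qed (simp add: Hom_def)
  next
    fix W g assume g: "g \<in> Hom C (Cod C b) W" "g \<cdot> (b \<cdot> (f \<cdot> inv_arr C a)) = Zero C (Cod C a) W"
    note [simp] = HomD[OF g(1)] Hom_Obj[OF g(1)]
    have "(g \<cdot> b) \<cdot> f = Zero C X W"
    proof (rule iso_cancel_right[OF iso_inv_arr[OF a(1)]])
      show "g \<cdot> b \<cdot> f \<cdot> inv_arr C a = Zero C X W \<cdot> inv_arr C a"
        using g(2) Comp_Zero_left[OF _ aH, of W] by simp
    qed (use HomD[OF Zero_in_Hom[of X W]] in simp_all)
    moreover have "g \<cdot> b \<in> Hom C Y W"
      by (simp add: Hom_def)
    ultimately obtain t where t: "t \<in> Hom C Q W" "t \<cdot> q = g \<cdot> b"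
      using cokernel_arr_factor[OF q(2,1) f] by metis
    note [simp] = HomD[OF t(1)]
    have "(t \<cdot> inv_arr C c) \<cdot> (c \<cdot> (q \<cdot> inv_arr C b)) = g"
      by (simp add: E t(2)[THEN Comp_reassoc])
    then show "\<exists>u \<in> Hom C (Cod C c) W. u \<cdot> (c \<cdot> (q \<cdot> inv_arr C b)) = g"
      by (intro bexI[of _ "t \<cdot> inv_arr C c"]) (simp_all add: Hom_def)
  qed (simp_all add: Hom_def)
qed

lemma cokernel_tens_left:
  assumes W: "W \<in> Obj C" and f: "f \<in> Hom C X Y" and q: "q \<in> Hom C Y Q" "cokernel_arr C q f"
  shows "cokernel_arr C (Id C W \<otimes>\<^sub>a q) (Id C W \<otimes>\<^sub>a f)"
  using right_exact_cokernel[OF _ _ right_exact_tens_left[OF W] f q, of "\<lambda>X. W \<otimes>\<^sub>o X"] W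
  by (simp add: tens_left_def Hom_def)

lemma cokernel_tens_right:
  assumes W: "W \<in> Obj C" and f: "f \<in> Hom C X Y" and q: "q \<in> Hom C Y Q" "cokernel_arr C q f"
  shows "cokernel_arr C (q \<otimes>\<^sub>a Id C W) (f \<otimes>\<^sub>a Id C W)"
  using right_exact_cokernel[OF _ _ right_exact_tens_right[OF W] f q, of "\<lambda>X. X \<otimes>\<^sub>o W"] W
  by (simp add: tens_right_def Hom_def)

lemma TensA_Add:
  assumes "W \<in> Obj C" "f \<in> Hom C X Y" "g \<in> Hom C X Y"
  shows "Id C W \<otimes>\<^sub>a (f \<boxplus> g) = (Id C W \<otimes>\<^sub>a f) \<boxplus> (Id C W \<otimes>\<^sub>a g)"
    "(f \<boxplus> g) \<otimes>\<^sub>a Id C W = (f \<otimes>\<^sub>a Id C W) \<boxplus> (g \<otimes>\<^sub>a Id C W)"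
  using additive_tens_left[OF assms(1)] additive_tens_right[OF assms(1)] Hom_Obj[OF assms(2)] assms(2,3)
  by (auto simp: additive_functor_def tens_left_def tens_right_def)

lemma Add_conj:
  assumes "f \<in> Hom C X Y" "g \<in> Hom C X Y" "a \<in> Hom C W X" "b \<in> Hom C Y Z"
  shows "b \<cdot> ((f \<boxplus> g) \<cdot> a) = (b \<cdot> (f \<cdot> a)) \<boxplus> (b \<cdot> (g \<cdot> a))"
  using assms Comp_Add_left[OF assms(3,1,2)] Comp_Add_right[OF Comp_in_Hom[OF assms(3,1)] Comp_in_Hom[OF assms(3,2)] assms(4)]
  by simp

text \<open>After precomposition with the comparison for three words the inner inverses telescope.
  What remains are the two sides of \<open>word_append_assoc\<close> at the codomains, linked by
  naturality of the associator.\<close>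

lemma word_cat_TensA_assoc:
  assumes "x \<in> Arr (word_cat C)" "y \<in> Arr (word_cat C)" "z \<in> Arr (word_cat C)"
  shows "x \<otimes>\<^sub>a\<^bsub>word_cat C\<^esub> y \<otimes>\<^sub>a\<^bsub>word_cat C\<^esub> z = x \<otimes>\<^sub>a\<^bsub>word_cat C\<^esub> (y \<otimes>\<^sub>a\<^bsub>word_cat C\<^esub> z)"
proof -
  obtain u f u' v g v' w h w' where xyz: "x = (u, f, u')" "y = (v, g, v')" "z = (w, h, w')"
    and [simp]: "u \<in> lists (Obj C)" "u' \<in> lists (Obj C)" "v \<in> lists (Obj C)" "v' \<in> lists (Obj C)"
      "w \<in> lists (Obj C)" "w' \<in> lists (Obj C)"
    and H: "f \<in> Hom C (word_obj C u) (word_obj C u')" "g \<in> Hom C (word_obj C v) (word_obj C v')"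
      "h \<in> Hom C (word_obj C w) (word_obj C w')"
    using assms by (elim Arr_word_catE) blast
  note [simp] = HomD[OF H(1)] HomD[OF H(2)] HomD[OF H(3)]
  let ?o = "word_obj C" and ?m = "word_append C" and ?n = "\<lambda>u v. inv_arr C (word_append C u v)" and ?I = "Id C"
  let ?L = "?m (u' @ v') w' \<cdot> (((?m u' v' \<cdot> ((f \<otimes>\<^sub>a g) \<cdot> ?n u v)) \<otimes>\<^sub>a h) \<cdot> ?n (u @ v) w)"
  let ?R = "?m u' (v' @ w') \<cdot> ((f \<otimes>\<^sub>a (?m v' w' \<cdot> ((g \<otimes>\<^sub>a h) \<cdot> ?n v w))) \<cdot> ?n u (v @ w))"
  have "?L = ?R"
  proof (rule iso_cancel_right[of "?m (u @ v) w \<cdot> (?m u v \<otimes>\<^sub>a ?I (?o w))"])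
    show "iso_arr C (?m (u @ v) w \<cdot> (?m u v \<otimes>\<^sub>a ?I (?o w)))"
      by (intro iso_Comp iso_TensA iso_Id conjunct1[OF iso_word_append]) simp_all
    have "?L \<cdot> (?m (u @ v) w \<cdot> (?m u v \<otimes>\<^sub>a ?I (?o w))) = ?m (u' @ v') w' \<cdot> ((?m u' v' \<cdot> (f \<otimes>\<^sub>a g)) \<otimes>\<^sub>a h)"
      by simp
    also have "\<dots> = (?m (u' @ v') w' \<cdot> (?m u' v' \<otimes>\<^sub>a ?I (?o w'))) \<cdot> ((f \<otimes>\<^sub>a g) \<otimes>\<^sub>a h)"
      by simp
    also have "\<dots> = ?m u' (v' @ w') \<cdot> ((?I (?o u') \<otimes>\<^sub>a ?m v' w') \<cdot> (Assoc C (?o u') (?o v') (?o w') \<cdot> ((f \<otimes>\<^sub>a g) \<otimes>\<^sub>a h)))"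
      unfolding word_append_assoc[OF \<open>u' \<in> lists (Obj C)\<close> \<open>v' \<in> lists (Obj C)\<close> \<open>w' \<in> lists (Obj C)\<close>] by simp
    also have "\<dots> = ?m u' (v' @ w') \<cdot> ((f \<otimes>\<^sub>a (?m v' w' \<cdot> (g \<otimes>\<^sub>a h))) \<cdot> Assoc C (?o u) (?o v) (?o w))"
      using Assoc_nat[of f g h] by simp
    also have "\<dots> = ?R \<cdot> (?m u (v @ w) \<cdot> ((?I (?o u) \<otimes>\<^sub>a ?m v w) \<cdot> Assoc C (?o u) (?o v) (?o w)))"
      by simp
    also have "\<dots> = ?R \<cdot> (?m (u @ v) w \<cdot> (?m u v \<otimes>\<^sub>a ?I (?o w)))"
      unfolding word_append_assoc[OF \<open>u \<in> lists (Obj C)\<close> \<open>v \<in> lists (Obj C)\<close> \<open>w \<in> lists (Obj C)\<close>] ..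
    finally show "?L \<cdot> (?m (u @ v) w \<cdot> (?m u v \<otimes>\<^sub>a ?I (?o w))) = \<dots>" .
  qed simp_all
  then show ?thesis
    by (simp add: xyz)
qed

lemma strict_word_cat: "strict_abelian_monoidal (word_cat C)"
proof -
  interpret W: abelian_category "word_cat C"
    by (rule abelian_word_cat)
  show ?thesis
  proof
    fix x y :: "'o list \<times> 'a \<times> 'o list"
    \<comment> \<open>Every element of the arrow type is a triple, whether or not it is an arrow, so
      the equations for domains and codomains hold on junk arguments as well.\<close>
    obtain u f u' v g v' where xy: "x = (u, f, u')" "y = (v, g, v')"
      by (cases x, cases y) auto
    show "Dom (word_cat C) (x \<cdot>\<^bsub>word_cat C\<^esub> y) = Dom (word_cat C) y"
      "Cod (word_cat C) (x \<cdot>\<^bsub>word_cat C\<^esub> y) = Cod (word_cat C) x"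
      "Dom (word_cat C) (x \<boxplus>\<^bsub>word_cat C\<^esub> y) = Dom (word_cat C) x"
      "Cod (word_cat C) (x \<boxplus>\<^bsub>word_cat C\<^esub> y) = Cod (word_cat C) x"
      "Dom (word_cat C) (x \<otimes>\<^sub>a\<^bsub>word_cat C\<^esub> y) = Dom (word_cat C) x \<otimes>\<^sub>o\<^bsub>word_cat C\<^esub> Dom (word_cat C) y"
      "Cod (word_cat C) (x \<otimes>\<^sub>a\<^bsub>word_cat C\<^esub> y) = Cod (word_cat C) x \<otimes>\<^sub>o\<^bsub>word_cat C\<^esub> Cod (word_cat C) y"
      by (simp_all add: xy)
  next
    fix x y assume "x \<in> Arr (word_cat C)" "y \<in> Arr (word_cat C)"
    then obtain u f u' v g v' where xy: "x = (u, f, u')" "y = (v, g, v')"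
      and [simp]: "u \<in> lists (Obj C)" "u' \<in> lists (Obj C)" "v \<in> lists (Obj C)" "v' \<in> lists (Obj C)"
      and H: "f \<in> Hom C (word_obj C u) (word_obj C u')" "g \<in> Hom C (word_obj C v) (word_obj C v')"
      by (elim Arr_word_catE) blast
    note [simp] = HomD[OF H(1)] HomD[OF H(2)]
    show "x \<otimes>\<^sub>a\<^bsub>word_cat C\<^esub> y \<in> Arr (word_cat C)"
      by (simp add: xy Hom_def)
  next
    fix u v assume "u \<in> Obj (word_cat C)" "v \<in> Obj (word_cat C)"
    then show "Id (word_cat C) u \<otimes>\<^sub>a\<^bsub>word_cat C\<^esub> Id (word_cat C) v = Id (word_cat C) (u \<otimes>\<^sub>o\<^bsub>word_cat C\<^esub> v)"
      by simp
  next
    fix x x' y y'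
    assume "x \<in> Arr (word_cat C)" "y \<in> Arr (word_cat C)" "x' \<in> Arr (word_cat C)" "y' \<in> Arr (word_cat C)"
      and eq: "Cod (word_cat C) x = Dom (word_cat C) y" "Cod (word_cat C) x' = Dom (word_cat C) y'"
    then obtain u f v t g w u' f' v' t' g' w' where
      xy: "x = (u, f, v)" "y = (t, g, w)" "x' = (u', f', v')" "y' = (t', g', w')"
      and [simp]: "u \<in> lists (Obj C)" "v \<in> lists (Obj C)" "w \<in> lists (Obj C)"
        "u' \<in> lists (Obj C)" "v' \<in> lists (Obj C)" "w' \<in> lists (Obj C)"
      and H: "f \<in> Hom C (word_obj C u) (word_obj C v)" "g \<in> Hom C (word_obj C t) (word_obj C w)"
        "f' \<in> Hom C (word_obj C u') (word_obj C v')" "g' \<in> Hom C (word_obj C t') (word_obj C w')"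
      by (elim Arr_word_catE) blast
    have [simp]: "t = v" "t' = v'"
      using eq by (simp_all add: xy)
    note [simp] = HomD[OF H(1)] HomD[OF H(2)] HomD[OF H(3)] HomD[OF H(4)]
    show "(y \<cdot>\<^bsub>word_cat C\<^esub> x) \<otimes>\<^sub>a\<^bsub>word_cat C\<^esub> (y' \<cdot>\<^bsub>word_cat C\<^esub> x')
        = (y \<otimes>\<^sub>a\<^bsub>word_cat C\<^esub> y') \<cdot>\<^bsub>word_cat C\<^esub> (x \<otimes>\<^sub>a\<^bsub>word_cat C\<^esub> x')"
      by (simp add: xy)
  next
    fix x assume "x \<in> Arr (word_cat C)"
    then obtain u f v where x: "x = (u, f, v)" and uv [simp]: "u \<in> lists (Obj C)" "v \<in> lists (Obj C)"
      and f: "f \<in> Hom C (word_obj C u) (word_obj C v)"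
      by (rule Arr_word_catE)
    note [simp] = HomD[OF f] inv_arr_simps[OF Lunit_iso[of "word_obj C u"]] inv_arr_simps[OF Runit_iso[of "word_obj C u"]]
    show "Id (word_cat C) (Unit (word_cat C)) \<otimes>\<^sub>a\<^bsub>word_cat C\<^esub> x = x"
      using Lunit_nat[of f, THEN Comp_reassoc] by (simp add: x)
    show "x \<otimes>\<^sub>a\<^bsub>word_cat C\<^esub> Id (word_cat C) (Unit (word_cat C)) = x"
      using Runit_nat[of f, THEN Comp_reassoc] by (simp add: x word_append_Nil)
  next
    fix w x y u v assume w: "w \<in> Obj (word_cat C)" and "x \<in> Hom (word_cat C) u v" "y \<in> Hom (word_cat C) u v"
    then obtain f g where xy: "x = (u, f, v)" "y = (u, g, v)" and [simp]: "u \<in> lists (Obj C)" "v \<in> lists (Obj C)"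
      and H: "f \<in> Hom C (word_obj C u) (word_obj C v)" "g \<in> Hom C (word_obj C u) (word_obj C v)"
      by (elim Hom_word_catE) blast
    have [simp]: "w \<in> lists (Obj C)"
      using w by simp
    note [simp] = HomD[OF H(1)] HomD[OF H(2)]
    show "Id (word_cat C) w \<otimes>\<^sub>a\<^bsub>word_cat C\<^esub> (x \<boxplus>\<^bsub>word_cat C\<^esub> y) =
       (Id (word_cat C) w \<otimes>\<^sub>a\<^bsub>word_cat C\<^esub> x) \<boxplus>\<^bsub>word_cat C\<^esub> (Id (word_cat C) w \<otimes>\<^sub>a\<^bsub>word_cat C\<^esub> y)"
      using TensA_Add(1)[OF _ H, of "word_obj C w"]
        Add_conj[of "Id C (word_obj C w) \<otimes>\<^sub>a f" "word_obj C w \<otimes>\<^sub>o word_obj C u" "word_obj C w \<otimes>\<^sub>o word_obj C v"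
          "Id C (word_obj C w) \<otimes>\<^sub>a g" "inv_arr C (word_append C w u)" "word_obj C (w @ u)" "word_append C w v" "word_obj C (w @ v)"]
      by (simp add: xy Hom_def)
    show "(x \<boxplus>\<^bsub>word_cat C\<^esub> y) \<otimes>\<^sub>a\<^bsub>word_cat C\<^esub> Id (word_cat C) w =
       (x \<otimes>\<^sub>a\<^bsub>word_cat C\<^esub> Id (word_cat C) w) \<boxplus>\<^bsub>word_cat C\<^esub> (y \<otimes>\<^sub>a\<^bsub>word_cat C\<^esub> Id (word_cat C) w)"
      using TensA_Add(2)[OF _ H, of "word_obj C w"]
        Add_conj[of "f \<otimes>\<^sub>a Id C (word_obj C w)" "word_obj C u \<otimes>\<^sub>o word_obj C w" "word_obj C v \<otimes>\<^sub>o word_obj C w"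
          "g \<otimes>\<^sub>a Id C (word_obj C w)" "inv_arr C (word_append C u w)" "word_obj C (u @ w)" "word_append C v w" "word_obj C (v @ w)"]
      by (simp add: xy Hom_def)
  next
    fix w q x assume w: "w \<in> Obj (word_cat C)" and q: "cokernel_arr (word_cat C) q x"
    then have A: "x \<in> Arr (word_cat C)" "q \<in> Arr (word_cat C)" and eq: "Dom (word_cat C) q = Cod (word_cat C) x"
      by (simp_all add: cokernel_arr_def)
    from A obtain a f b t g c where qx: "x = (a, f, b)" "q = (t, g, c)"
      and [simp]: "a \<in> lists (Obj C)" "b \<in> lists (Obj C)" "c \<in> lists (Obj C)"
      and H: "f \<in> Hom C (word_obj C a) (word_obj C b)" "g \<in> Hom C (word_obj C t) (word_obj C c)"
      by (elim Arr_word_catE) blast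
    have [simp]: "t = b"
      using eq by (simp add: qx)
    note H = H[unfolded \<open>t = b\<close>]
    have [simp]: "w \<in> lists (Obj C)"
      using w by simp
    note [simp] = HomD[OF H(1)] HomD[OF H(2)]
    have gf: "cokernel_arr C g f"
      using q cokernel_word_cat[of a b c g f] H by (simp add: qx)
    have "cokernel_arr C (word_append C w c \<cdot> ((Id C (word_obj C w) \<otimes>\<^sub>a g) \<cdot> inv_arr C (word_append C w b)))
      (word_append C w b \<cdot> ((Id C (word_obj C w) \<otimes>\<^sub>a f) \<cdot> inv_arr C (word_append C w a)))"
      by (rule cokernel_conj_iso[OF _ _ cokernel_tens_left[OF _ H gf]])
        (simp_all add: Hom_def iso_word_append)
    then show "cokernel_arr (word_cat C) (Id (word_cat C) w \<otimes>\<^sub>a\<^bsub>word_cat C\<^esub> q) (Id (word_cat C) w \<otimes>\<^sub>a\<^bsub>word_cat C\<^esub> x)"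
      by (simp add: qx cokernel_word_cat Hom_def)
    have "cokernel_arr C (word_append C c w \<cdot> ((g \<otimes>\<^sub>a Id C (word_obj C w)) \<cdot> inv_arr C (word_append C b w)))
      (word_append C b w \<cdot> ((f \<otimes>\<^sub>a Id C (word_obj C w)) \<cdot> inv_arr C (word_append C a w)))"
      by (rule cokernel_conj_iso[OF _ _ cokernel_tens_right[OF _ H gf]])
        (simp_all add: Hom_def iso_word_append)
    then show "cokernel_arr (word_cat C) (q \<otimes>\<^sub>a\<^bsub>word_cat C\<^esub> Id (word_cat C) w) (x \<otimes>\<^sub>a\<^bsub>word_cat C\<^esub> Id (word_cat C) w)"
      by (simp add: qx cokernel_word_cat Hom_def)
  qed (use word_cat_TensA_assoc in simp_all)
qed

text \<open>Once the comparisons cancel, each strict zigzag becomes the long composite of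
  \<open>duality\<close> followed by the inverse of a unitor. Being the identity is then the
  corresponding equation of \<open>duality\<close>.\<close>

lemma strict_duality_word_cat:
  assumes [simp]: "u \<in> lists (Obj C)" "v \<in> lists (Obj C)"
    and e: "e \<in> Hom C (word_obj C u \<otimes>\<^sub>o word_obj C v) (Unit C)"
    and c: "c \<in> Hom C (Unit C) (word_obj C v \<otimes>\<^sub>o word_obj C u)"
  shows "strict_duality (word_cat C) u v (u @ v, e \<cdot> inv_arr C (word_append C u v), []) ([], word_append C v u \<cdot> c, v @ u)
    \<longleftrightarrow> duality C (word_obj C u) (word_obj C v) e c"
proof -
  let ?o = "word_obj C" and ?m = "word_append C" and ?n = "\<lambda>u v. inv_arr C (word_append C u v)" and ?I = "Id C"
  let ?U = "?o u" and ?V = "?o v"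
  note a = inv_arr_simps[OF Assoc_iso[of ?U ?V ?U], simplified]
  note l = inv_arr_simps[OF Lunit_iso[of ?V], simplified]
  note r = inv_arr_simps[OF Runit_iso[of ?U], simplified]
  note [simp] = HomD[OF e] HomD[OF c] a l r
  have m1: "?m (v @ u) v \<cdot> (?m v u \<otimes>\<^sub>a ?I ?V) = ?m v (u @ v) \<cdot> ((?I ?V \<otimes>\<^sub>a ?m u v) \<cdot> Assoc C ?V ?U ?V)"
    by (rule word_append_assoc) simp_all
  \<comment> \<open>The second zigzag uses the associator backwards, so the coherence is solved for
    its inverse.\<close>
  have m2: "?m u (v @ u) \<cdot> (?I ?U \<otimes>\<^sub>a ?m v u) = ?m (u @ v) u \<cdot> ((?m u v \<otimes>\<^sub>a ?I ?U) \<cdot> inv_arr C (Assoc C ?U ?V ?U))"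
    using arg_cong[OF word_append_assoc[of u v u], of "\<lambda>f. f \<cdot> inv_arr C (Assoc C ?U ?V ?U)"] by simp
  define z1 where "z1 = Runit C ?V \<cdot> ((?I ?V \<otimes>\<^sub>a e) \<cdot> (Assoc C ?V ?U ?V \<cdot> (c \<otimes>\<^sub>a ?I ?V)))"
  define z2 where "z2 = Lunit C ?U \<cdot> ((e \<otimes>\<^sub>a ?I ?U) \<cdot> (inv_arr C (Assoc C ?U ?V ?U) \<cdot> (?I ?U \<otimes>\<^sub>a c)))"
  have z: "z1 \<in> Arr C" "Dom C z1 = Unit C \<otimes>\<^sub>o ?V" "z2 \<in> Arr C" "Dom C z2 = ?U \<otimes>\<^sub>o Unit C"
    by (simp_all add: z1_def z2_def)
  have "(?m v [] \<cdot> ((?I ?V \<otimes>\<^sub>a (e \<cdot> ?n u v)) \<cdot> ?n v (u @ v))) \<cdot> (?m (v @ u) v \<cdot> (((?m v u \<cdot> c) \<otimes>\<^sub>a ?I ?V) \<cdot> ?n [] v))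
     = Runit C ?V \<cdot> ((?I ?V \<otimes>\<^sub>a (e \<cdot> ?n u v)) \<cdot> (?n v (u @ v) \<cdot> ((?m (v @ u) v \<cdot> (?m v u \<otimes>\<^sub>a ?I ?V)) \<cdot> ((c \<otimes>\<^sub>a ?I ?V) \<cdot> inv_arr C (Lunit C ?V)))))"
    by (simp add: word_append_Nil)
  also have "\<dots> = z1 \<cdot> inv_arr C (Lunit C ?V)"
    unfolding m1 z1_def by simp
  finally have 1: "(?m v [] \<cdot> ((?I ?V \<otimes>\<^sub>a (e \<cdot> ?n u v)) \<cdot> ?n v (u @ v))) \<cdot> (?m (v @ u) v \<cdot> (((?m v u \<cdot> c) \<otimes>\<^sub>a ?I ?V) \<cdot> ?n [] v))
     = z1 \<cdot> inv_arr C (Lunit C ?V)" .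
  have "(?m [] u \<cdot> (((e \<cdot> ?n u v) \<otimes>\<^sub>a ?I ?U) \<cdot> ?n (u @ v) u)) \<cdot> (?m u (v @ u) \<cdot> ((?I ?U \<otimes>\<^sub>a (?m v u \<cdot> c)) \<cdot> ?n u []))
     = Lunit C ?U \<cdot> (((e \<cdot> ?n u v) \<otimes>\<^sub>a ?I ?U) \<cdot> (?n (u @ v) u \<cdot> ((?m u (v @ u) \<cdot> (?I ?U \<otimes>\<^sub>a ?m v u)) \<cdot> ((?I ?U \<otimes>\<^sub>a c) \<cdot> inv_arr C (Runit C ?U)))))"
    by (simp add: word_append_Nil)
  also have "\<dots> = z2 \<cdot> inv_arr C (Runit C ?U)"
    unfolding m2 z2_def by simp
  finally have 2: "(?m [] u \<cdot> (((e \<cdot> ?n u v) \<otimes>\<^sub>a ?I ?U) \<cdot> ?n (u @ v) u)) \<cdot> (?m u (v @ u) \<cdot> ((?I ?U \<otimes>\<^sub>a (?m v u \<cdot> c)) \<cdot> ?n u []))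
     = z2 \<cdot> inv_arr C (Runit C ?U)" .
  have 3: "z1 \<cdot> inv_arr C (Lunit C ?V) = ?I ?V \<longleftrightarrow> z1 = Lunit C ?V"
    using iso_cancel_right[OF iso_inv_arr[OF Lunit_iso[of ?V]], of z1 "Lunit C ?V"] z by auto
  have 4: "z2 \<cdot> inv_arr C (Runit C ?U) = ?I ?U \<longleftrightarrow> z2 = Runit C ?U"
    using iso_cancel_right[OF iso_inv_arr[OF Runit_iso[of ?U]], of z2 "Runit C ?U"] z by auto
  have "strict_duality (word_cat C) u v (u @ v, e \<cdot> ?n u v, []) ([], ?m v u \<cdot> c, v @ u) \<longleftrightarrow>
    (?m v [] \<cdot> ((?I ?V \<otimes>\<^sub>a (e \<cdot> ?n u v)) \<cdot> ?n v (u @ v))) \<cdot> (?m (v @ u) v \<cdot> (((?m v u \<cdot> c) \<otimes>\<^sub>a ?I ?V) \<cdot> ?n [] v)) = ?I ?V \<and>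
    (?m [] u \<cdot> (((e \<cdot> ?n u v) \<otimes>\<^sub>a ?I ?U) \<cdot> ?n (u @ v) u)) \<cdot> (?m u (v @ u) \<cdot> ((?I ?U \<otimes>\<^sub>a (?m v u \<cdot> c)) \<cdot> ?n u [])) = ?I ?U"
    by (simp add: strict_duality_def Hom_def del: word_append.simps Comp_Comp)
  also have "\<dots> \<longleftrightarrow> z1 = Lunit C ?V \<and> z2 = Runit C ?U"
    unfolding 1 2 3 4 ..
  also have "\<dots> \<longleftrightarrow> duality C ?U ?V e c"
    unfolding z1_def z2_def duality_def using e c by simp
  finally show ?thesis .
qed

lemma strict_duality_word_cat_exists:
  assumes "u \<in> lists (Obj C)" "v \<in> lists (Obj C)"
  shows "(\<exists>e c. strict_duality (word_cat C) u v e c) \<longleftrightarrow> (\<exists>e c. duality C (word_obj C u) (word_obj C v) e c)"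
proof
  assume "\<exists>e c. strict_duality (word_cat C) u v e c"
  then obtain e c where ec: "strict_duality (word_cat C) u v (u @ v, e, []) ([], c, v @ u)"
    and H: "e \<in> Hom C (word_obj C (u @ v)) (Unit C)" "c \<in> Hom C (Unit C) (word_obj C (v @ u))"
    by (auto simp: strict_duality_def elim!: Hom_word_catE)
  note [simp] = HomD[OF H(1)] HomD[OF H(2)] assms
  have "duality C (word_obj C u) (word_obj C v) (e \<cdot> word_append C u v) (inv_arr C (word_append C v u) \<cdot> c)"
    using strict_duality_word_cat[of u v "e \<cdot> word_append C u v" "inv_arr C (word_append C v u) \<cdot> c"] ec
    by (simp add: Hom_def)
  then show "\<exists>e c. duality C (word_obj C u) (word_obj C v) e c"
    by blast
next
  assume "\<exists>e c. duality C (word_obj C u) (word_obj C v) e c"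
  then obtain e c where ec: "duality C (word_obj C u) (word_obj C v) e c"
    by blast
  then show "\<exists>e c. strict_duality (word_cat C) u v e c"
    using strict_duality_word_cat[OF assms, of e c] unfolding duality_def by blast
qed

text \<open>A dual found in the word category may be a long word; its value is then a dual in
  \<open>C\<close>.\<close>

lemma has_left_dual_word_cat:
  assumes X: "X \<in> Obj C"
  shows "has_left_dual C X \<longleftrightarrow> (\<exists>D e c. strict_duality (word_cat C) D [X] e c)"
proof
  assume "has_left_dual C X"
  then obtain D e c where D: "duality C D X e c"
    unfolding has_left_dual_def by blast
  then have "D \<in> Obj C"
    unfolding duality_def by blast
  then have "\<exists>e c. strict_duality (word_cat C) [D] [X] e c"
    using D X strict_duality_word_cat_exists[of "[D]" "[X]"] by auto
  then show "\<exists>D e c. strict_duality (word_cat C) D [X] e c"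
    by blast
next
  assume "\<exists>D e c. strict_duality (word_cat C) D [X] e c"
  then obtain D where D: "\<exists>e c. strict_duality (word_cat C) D [X] e c"
    by blast
  then have "D \<in> lists (Obj C)"
    unfolding strict_duality_def by auto
  then have "\<exists>e c. duality C (word_obj C D) X e c"
    using D X strict_duality_word_cat_exists[of D "[X]"] by simp
  then show "has_left_dual C X"
    unfolding has_left_dual_def by blast
qed

lemma has_right_dual_word_cat:
  assumes X: "X \<in> Obj C"
  shows "has_right_dual C X \<longleftrightarrow> (\<exists>D e c. strict_duality (word_cat C) [X] D e c)"
proof
  assume "has_right_dual C X"
  then obtain D e c where D: "duality C X D e c"
    unfolding has_right_dual_def by blast
  then have "D \<in> Obj C"
    unfolding duality_def by blast
  then have "\<exists>e c. strict_duality (word_cat C) [X] [D] e c"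
    using D X strict_duality_word_cat_exists[of "[X]" "[D]"] by auto
  then show "\<exists>D e c. strict_duality (word_cat C) [X] D e c"
    by blast
next
  assume "\<exists>D e c. strict_duality (word_cat C) [X] D e c"
  then obtain D where D: "\<exists>e c. strict_duality (word_cat C) [X] D e c"
    by blast
  then have "D \<in> lists (Obj C)"
    unfolding strict_duality_def by auto
  then have "\<exists>e c. duality C X (word_obj C D) e c"
    using D X strict_duality_word_cat_exists[of "[X]" D] by simp
  then show "has_right_dual C X"
    unfolding has_right_dual_def by blast
qed

end

section \<open>Rigidity\<close>

text \<open>Only the tensor products are swapped. The constraints can stay as they are, since
  strictness is expressed by equations that do not mention them; a genuine reversal would invert the
  associator.\<close>

definition reverse_tensor :: "('o, 'a, 'm) preadd_mon_cat_scheme \<Rightarrow> ('o, 'a, 'm) preadd_mon_cat_scheme" where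
  "reverse_tensor C = C\<lparr>TensO := \<lambda>X Y. Y \<otimes>\<^sub>o\<^bsub>C\<^esub> X, TensA := \<lambda>f g. g \<otimes>\<^sub>a\<^bsub>C\<^esub> f\<rparr>"

lemma reverse_tensor_simps [simp]:
  "Obj (reverse_tensor C) = Obj C" "Arr (reverse_tensor C) = Arr C"
  "Dom (reverse_tensor C) = Dom C" "Cod (reverse_tensor C) = Cod C" "Id (reverse_tensor C) = Id C"
  "Comp (reverse_tensor C) = Comp C" "Add (reverse_tensor C) = Add C" "Zero (reverse_tensor C) = Zero C"
  "X \<otimes>\<^sub>o\<^bsub>reverse_tensor C\<^esub> Y = Y \<otimes>\<^sub>o\<^bsub>C\<^esub> X" "f \<otimes>\<^sub>a\<^bsub>reverse_tensor C\<^esub> g = g \<otimes>\<^sub>a\<^bsub>C\<^esub> f"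
  "Unit (reverse_tensor C) = Unit C"
  by (simp_all add: reverse_tensor_def)

lemma reverse_tensor_notions [simp]:
  "Hom (reverse_tensor C) = Hom C"
  "mono_arr (reverse_tensor C) = mono_arr C" "epi_arr (reverse_tensor C) = epi_arr C"
  "zero_object (reverse_tensor C) = zero_object C" "biproduct (reverse_tensor C) = biproduct C"
  "kernel_arr (reverse_tensor C) = kernel_arr C" "cokernel_arr (reverse_tensor C) = cokernel_arr C"
  by (simp_all add: fun_eq_iff Hom_def mono_arr_def epi_arr_def zero_object_def biproduct_def
      kernel_arr_def cokernel_arr_def)

text \<open>Reversal exchanges the two zigzags and keeps evaluation and coevaluation, so right duals
  turn into left duals.\<close>

lemma strict_duality_reverse_tensor [simp]:
  "strict_duality (reverse_tensor C) D X = strict_duality C X D"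
  by (auto simp: strict_duality_def fun_eq_iff)

lemma (in strict_abelian_monoidal) strict_reverse_tensor: "strict_abelian_monoidal (reverse_tensor C)"
proof -
  have "abelian_category (reverse_tensor C)"
    using abelian_category_axioms
    unfolding abelian_category_def preadditive_category_def category_def
      abelian_category_axioms_def preadditive_category_axioms_def by simp
  then show ?thesis
    using TensA_Comp TensA_assoc TensA_Add_right TensA_Add_left cokernel_TensA_left cokernel_TensA_right
    by (intro strict_abelian_monoidal.intro strict_abelian_monoidal_axioms.intro) auto
qed

text \<open>The composition series is climbed one simple quotient at a time, with exactness already
  unpacked into a kernel and an epi.\<close>

lemma (in abelian_category) finite_length_induct [consumes 1, case_names zero ext]:
  assumes X: "finite_length C X"
    and zero: "\<And>Z. zero_object C Z \<Longrightarrow> P Z"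
    and ext: "\<And>m q A Y S. \<lbrakk>m \<in> Hom C A Y; q \<in> Hom C Y S; kernel_arr C m q; epi_arr C q; simple_object C S; P A\<rbrakk> \<Longrightarrow> P Y"
  shows "P X"
proof -
  obtain n Y m q where Y: "zero_object C (Y 0)" "Y n = X"
    "\<And>k. k < n \<Longrightarrow> m k \<in> Hom C (Y k) (Y (Suc k)) \<and> short_exact C (m k) (q k) \<and> simple_object C (Cod C (q k))"
    using X unfolding finite_length_def by (metis (no_types))
  have "P (Y k)" if "k \<le> n" for k
    using that
  proof (induction k)
    case 0
    then show ?case
      using Y zero by blast
  next
    case (Suc k)
    then have k: "m k \<in> Hom C (Y k) (Y (Suc k))" "short_exact C (m k) (q k)" "simple_object C (Cod C (q k))"
      using Y(3)[of k] by auto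
    have q: "epi_arr C (q k)" "q k \<in> Arr C"
      using k(2) by (auto simp: short_exact_def epi_arr_def)
    note D = short_exactD[OF k(2,1) q(2)]
    show ?case
      using ext[OF k(1) D(1,2) q(1) k(3)] Suc by simp
  qed
  then show ?thesis
    using Y(2) by blast
qed

section \<open>Duals of zero objects and of extensions\<close>

context abelian_monoidal_category
begin

text \<open>Both zigzag equations compare arrows into \<open>Z\<close>, and each object has only one
  such arrow; so zero maps serve as evaluation and coevaluation.\<close>

lemma zero_object_duality:
  assumes Z: "zero_object C Z"
  shows "\<exists>e c. duality C Z Z e c"
proof -
  have [simp]: "Z \<in> Obj C"
    using Z by (simp add: zero_object_def)
  have uniq: "f = g" if "f \<in> Arr C" "g \<in> Arr C" "Cod C f = Z" "Cod C g = Z" "Dom C f = Dom C g" for f g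
  proof -
    have "\<exists>!h. h \<in> Hom C (Dom C f) Z"
      using Z that by (simp add: zero_object_def)
    then show ?thesis
      using that by (auto simp: Hom_def)
  qed
  note e = Zero_in_Hom[of "Z \<otimes>\<^sub>o Z" "Unit C", simplified] and c = Zero_in_Hom[of "Unit C" "Z \<otimes>\<^sub>o Z", simplified]
  note [simp] = HomD[OF e] HomD[OF c] inv_arr_simps[OF Assoc_iso[of Z Z Z], simplified]
  have "duality C Z Z (Zero C (Z \<otimes>\<^sub>o Z) (Unit C)) (Zero C (Unit C) (Z \<otimes>\<^sub>o Z))"
    unfolding duality_def using e c by (intro conjI uniq) simp_all
  then show ?thesis
    by blast
qed

text \<open>The sequence is placed on one-letter words. Kernels and epis do not see the tensor
  product, so it is also a sequence in the reversed category, where the left duals are the right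
  duals.\<close>

lemma dual_extension:
  assumes m: "m \<in> Hom C A X" and q: "q \<in> Hom C X B" and mq: "kernel_arr C m q" "epi_arr C q"
  shows "\<lbrakk>has_left_dual C A; has_left_dual C B\<rbrakk> \<Longrightarrow> has_left_dual C X"
    and "\<lbrakk>has_right_dual C A; has_right_dual C B\<rbrakk> \<Longrightarrow> has_right_dual C X"
proof -
  have O: "A \<in> Obj C" "X \<in> Obj C" "B \<in> Obj C"
    using Hom_Obj m q by blast+
  interpret W: strict_abelian_monoidal "word_cat C"
    by (rule strict_word_cat)
  interpret R: strict_abelian_monoidal "reverse_tensor (word_cat C)"
    by (rule W.strict_reverse_tensor)
  have H: "([A], m, [X]) \<in> Hom (word_cat C) [A] [X]" "([X], q, [B]) \<in> Hom (word_cat C) [X] [B]"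
    "kernel_arr (word_cat C) ([A], m, [X]) ([X], q, [B])" "epi_arr (word_cat C) ([X], q, [B])"
    using O m q mq kernel_word_cat[of "[A]" "[X]" "[B]" m q] epi_word_cat[of "[X]" "[B]" q] by simp_all
  show "has_left_dual C X" if "has_left_dual C A" "has_left_dual C B"
    using that W.strict_duality_extension[OF _ _ H] O has_left_dual_word_cat by metis
  show "has_right_dual C X" if "has_right_dual C A" "has_right_dual C B"
    using that R.strict_duality_extension[of _ "[A]" _ _ _ "[B]" _ _ "([A], m, [X])" "[X]" "([X], q, [B])"] H O has_right_dual_word_cat
    by auto
qed

lemma finite_length_rigid_object:
  assumes "finite_length C X" "\<And>S. simple_object C S \<Longrightarrow> rigid_object C S"
  shows "rigid_object C X"
  using assms(1)
proof (induction rule: finite_length_induct)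
  case (zero Z)
  then show ?case
    using zero_object_duality unfolding rigid_object_def has_left_dual_def has_right_dual_def by blast
next
  case (ext m q A Y S)
  then show ?case
    using dual_extension[OF ext(1-4)] assms(2)[OF ext(5)] ext(6) unfolding rigid_object_def by blast
qed

end

theorem theoremA2:
  fixes C :: "('o, 'a, 'm) preadd_mon_cat_scheme"
  assumes "abelian_monoidal_category C"
    and "\<forall>X \<in> Obj C. finite_length C X"
    and "enough_left_flat C"
    and "enough_right_flat C"
    and "\<forall>S. simple_object C S \<longrightarrow> rigid_object C S"
  shows "rigid_category C"
  unfolding rigid_category_def
  using abelian_monoidal_category.finite_length_rigid_object[OF assms(1)] assms(2,5) by blast

end
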